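(* The following complete isometric equalities hold (multipliers being identified with their symbols): $$(H^1,\mathrm{BMOA})_{cb}=\mathrm{BMOA}\qquad\text{and}\qquad(H^1,H^2)_{cb}=(H^2,\mathrm{BMOA})_{cb}=\mathrm{BMOA}^{(2)} .$$
   Context: $\mathbb{T}$ is the unit circle with normalized Haar measure; $L^p=L^p(\mathbb{T})$, $H^p=\{f\in L^p:\widehat f(n)=0\ \forall n<0\}$; for a finite-dimensional $C^*$-algebra $E$, $\overline{H_0^\infty}(\mathbb{T};E)$ is the space of $f\in L^\infty(\mathbb{T};E)$ with $\widehat f(n)=0$ for all $n\ge0$, and $\overline{H_0^\infty}=\overline{H_0^\infty}(\mathbb{T};\mathbb{C})$. $M_d$ denotes the complex $d\times d$ matrices, and $\overline{M}_d$ its complex conjugate ($\overline a$ being identified with the entrywise conjugate of $a$); $M_d(Z)$ denotes $d\times d$ matrices over $Z$. Operator space structures: $L^\infty$ has its natural structure as a commutative $C^*$-algebra, $L^1$ its structure as predual of $L^\infty$, and $L^2=(L^\infty,L^1)_{1/2}$ by complex interpolation, i.e. $L^2$ is Pisier's operator Hilbert space $OH$. $H^1,H^2$ are subspaces of $L^1,L^2$. $\mathrm{BMOA}:=L^\infty/\overline{H_0^\infty}$ with the quotient norm and quotient operator space structure; the class of $\varphi\in L^\infty$ is identified with $\sum_{n\ge0}\widehat\varphi(n)e^{in\theta}$. $\mathrm{BMOA}^{(2)}$ is the space of formal series $\varphi=\sum_{n\ge0}\widehat\varphi(n)e^{in\theta}$ with $\big\|\sum_{n\ge0}|\widehat\varphi(n)|^2e^{in\theta}\big\|_{\mathrm{BMOA}}^{1/2}<\infty$,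 with operator space structure given for every $d\ge1$ by $$\Big\|\sum_{n\ge0}a_n\otimes e^{in\theta}\Big\|_{M_d(\mathrm{BMOA}^{(2)})}=\Big\|\sum_{n\ge0}a_n\otimes\overline{a}_n\,e^{in\theta}\Big\|^{1/2}_{L^\infty(\mathbb{T};M_d\otimes\overline{M}_d)/\overline{H_0^\infty}(\mathbb{T};M_d\otimes\overline{M}_d)},\qquad a_n\in M_d .$$ $(X,Y)_{cb}$ is the space of completely bounded Fourier multipliers, i.e. completely bounded maps $T_m:X\to Y$ of the form $\sum_{n\ge0}\widehat f(n)e^{in\theta}\mapsto\sum_{n\ge0}m_n\widehat f(n)e^{in\theta}$, with the cb-norm; $T_m$ is identified with its symbol $\sum_{n\ge0}m_ne^{in\theta}$. Its operator space structure is given by $M_d((X,Y)_{cb})=(X,M_d(Y))_{cb}$ isometrically for all $d\ge1$ (multipliers with matrix coefficients $m_n\in M_d$). *)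

theory Defs
  imports "HOL-Analysis.Analysis" "Jordan_Normal_Form.Matrix"
begin

hide_const (open) Finite_Cartesian_Product.mat Finite_Cartesian_Product.vec

section \<open>Matrices\<close>

definition vec_l2norm :: "complex vec \<Rightarrow> real" where
  "vec_l2norm v = L2_set (\<lambda>i. cmod (vec_index v i)) {..<dim_vec v}"

definition opnorm :: "complex mat \<Rightarrow> real" where
  "opnorm A = Sup {vec_l2norm (A *\<^sub>v v) | v. v \<in> carrier_vec (dim_col A) \<and> vec_l2norm v \<le> 1}"

text \<open>The Kronecker product realises the identification of the tensor product of \<open>M\<^sub>k\<close> and
  \<open>M\<^sub>d\<close> with \<open>M\<^sub>k\<^sub>d\<close>; the first factor is the outer (block) index.\<close>

definition kron :: "complex mat \<Rightarrow> complex mat \<Rightarrow> complex mat" where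
  "kron A B = mat (dim_row A * dim_row B) (dim_col A * dim_col B)
     (\<lambda>(r, c). A $$ (r div dim_row B, c div dim_col B) * B $$ (r mod dim_row B, c mod dim_col B))"

definition tensor_conj :: "complex mat \<Rightarrow> complex mat" where
  "tensor_conj A = kron A (map_mat cnj A)"

section \<open>Concrete operator spaces\<close>

text \<open>All spaces consist of complex functions on some set \<open>'x\<close>: functions on the circle
  (\<open>'x = complex\<close>), formal series given by their coefficients (\<open>'x = nat\<close>), or the scalar field
  (\<open>'x = unit\<close>). A \<open>d \<times> d\<close> matrix over such a space is regarded as a function with values in
  \<open>M\<^sub>d\<close>. An operator space \<open>X\<close> is given by the sets \<open>M\<^sub>d(X)\<close> and the norms on them, for all
  \<open>d \<ge> 1\<close>; functions are not quotiented by equality almost everywhere, so that on spaces of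
  functions these are seminorms.\<close>

record 'x opspace =
  mcarr :: "nat \<Rightarrow> ('x \<Rightarrow> complex mat) set"
  mnorm :: "nat \<Rightarrow> ('x \<Rightarrow> complex mat) \<Rightarrow> real"

definition matrices_over :: "('x \<Rightarrow> complex) set \<Rightarrow> nat \<Rightarrow> ('x \<Rightarrow> complex mat) set" where
  "matrices_over S d = {F. (\<forall>x. F x \<in> carrier_mat d d) \<and>
     (\<forall>i<d. \<forall>j<d. (\<lambda>x. F x $$ (i, j)) \<in> S)}"

definition scalars :: "'x opspace \<Rightarrow> ('x \<Rightarrow> complex) set" where
  "scalars X = {f. (\<lambda>x. mat 1 1 (\<lambda>_. f x)) \<in> mcarr X 1}"

text \<open>The \<open>k\<close>-th amplification \<open>M\<^sub>k(X) \<rightarrow> M\<^sub>k(M\<^sub>d(Y)) = M\<^sub>k\<^sub>d(Y)\<close> of a map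
  \<open>T : X \<rightarrow> M\<^sub>d(Y)\<close>, which applies \<open>T\<close> to each of the entries.\<close>

definition amplify ::
    "nat \<Rightarrow> nat \<Rightarrow> (('x \<Rightarrow> complex) \<Rightarrow> 'y \<Rightarrow> complex mat) \<Rightarrow> ('x \<Rightarrow> complex mat) \<Rightarrow> 'y \<Rightarrow> complex mat"
  where
  "amplify k d T F = (\<lambda>y. mat (k * d) (k * d)
     (\<lambda>(r, c). T (\<lambda>x. F x $$ (r div d, c div d)) y $$ (r mod d, c mod d)))"

text \<open>Complete boundedness and the cb-norm of \<open>T : X \<rightarrow> M\<^sub>d(Y)\<close>. They are only applied to maps
  that are linear by construction.\<close>

definition cb_map ::
    "nat \<Rightarrow> 'x opspace \<Rightarrow> 'y opspace \<Rightarrow> (('x \<Rightarrow> complex) \<Rightarrow> 'y \<Rightarrow> complex mat) \<Rightarrow> bool" where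
  "cb_map d X Y T \<longleftrightarrow>
     (\<forall>k\<ge>1. \<forall>F\<in>mcarr X k. amplify k d T F \<in> mcarr Y (k * d)) \<and>
     (\<exists>C. \<forall>k\<ge>1. \<forall>F\<in>mcarr X k. mnorm Y (k * d) (amplify k d T F) \<le> C * mnorm X k F)"

definition cb_norm ::
    "nat \<Rightarrow> 'x opspace \<Rightarrow> 'y opspace \<Rightarrow> (('x \<Rightarrow> complex) \<Rightarrow> 'y \<Rightarrow> complex mat) \<Rightarrow> real" where
  "cb_norm d X Y T =
     Sup {mnorm Y (k * d) (amplify k d T F) | k F. 1 \<le> k \<and> F \<in> mcarr X k \<and> mnorm X k F \<le> 1}"

definition complete_isometric_eq :: "'x opspace \<Rightarrow> 'x opspace \<Rightarrow> bool" where
  "complete_isometric_eq X Y \<longleftrightarrow>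
     (\<forall>d\<ge>1. mcarr X d = mcarr Y d \<and> (\<forall>F\<in>mcarr X d. mnorm X d F = mnorm Y d F))"

definition scalar_field :: "unit opspace" where
  "scalar_field = \<lparr>mcarr = matrices_over UNIV, mnorm = (\<lambda>d A. opnorm (A ()))\<rparr>"

section \<open>Function spaces on the circle\<close>

definition circle :: "complex measure" where
  "circle = distr (uniform_measure lborel {0..2 * pi}) (restrict_space borel (sphere 0 1)) cis"

definition fourier :: "(complex \<Rightarrow> complex) \<Rightarrow> int \<Rightarrow> complex" where
  "fourier f n = (LINT z|circle. f z * z powi (- n))"

definition Lp :: "real \<Rightarrow> (complex \<Rightarrow> complex) set" where
  "Lp p = {f \<in> borel_measurable circle. integrable circle (\<lambda>z. cmod (f z) powr p)}"

definition Linf :: "(complex \<Rightarrow> complex) set" where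
  "Linf = {f \<in> borel_measurable circle. \<exists>C. AE z in circle. cmod (f z) \<le> C}"

definition Hp :: "real \<Rightarrow> (complex \<Rightarrow> complex) set" where
  "Hp p = {f \<in> Lp p. \<forall>n<0. fourier f n = 0}"

definition conj_H0inf :: "(complex \<Rightarrow> complex) set" where
  "conj_H0inf = {f \<in> Linf. \<forall>n\<ge>0. fourier f n = 0}"

definition mat_integral :: "nat \<Rightarrow> (complex \<Rightarrow> complex mat) \<Rightarrow> complex mat" where
  "mat_integral d F = mat d d (\<lambda>(i, j). LINT z|circle. F z $$ (i, j))"

definition Linf_mnorm :: "nat \<Rightarrow> (complex \<Rightarrow> complex mat) \<Rightarrow> real" where
  "Linf_mnorm d F = Inf {C. 0 \<le> C \<and> (AE z in circle. opnorm (F z) \<le> C)}"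

definition Linf_space :: "complex opspace" where
  "Linf_space = \<lparr>mcarr = matrices_over Linf, mnorm = Linf_mnorm\<rparr>"

text \<open>\<open>L\<^sup>1\<close> as the predual of \<open>L\<^sup>\<infinity>\<close>: an element \<open>F\<close> of \<open>M\<^sub>d(L\<^sup>1)\<close> is normed as the completely
  bounded map \<open>g \<mapsto> \<integral> g F\<close> from \<open>L\<^sup>\<infinity>\<close> to \<open>M\<^sub>d\<close>.\<close>

definition L1_mnorm :: "nat \<Rightarrow> (complex \<Rightarrow> complex mat) \<Rightarrow> real" where
  "L1_mnorm d F =
     cb_norm d Linf_space scalar_field (\<lambda>g _. mat_integral d (\<lambda>z. g z \<cdot>\<^sub>m F z))"

text \<open>The operator Hilbert space structure on \<open>L\<^sup>2\<close>. If \<open>F = \<Sum> a\<^sub>i \<otimes> e\<^sub>i\<close> with \<open>(e\<^sub>i)\<close>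
  orthonormal, the integral below is \<open>\<Sum> a\<^sub>i \<otimes> cnj a\<^sub>i\<close>; in general it is the matrix of all the inner
  products of the entries of \<open>F\<close>.\<close>

definition OH_mnorm :: "nat \<Rightarrow> (complex \<Rightarrow> complex mat) \<Rightarrow> real" where
  "OH_mnorm d F = sqrt (opnorm (mat_integral (d * d) (\<lambda>z. tensor_conj (F z))))"

definition BMO_quotient_mnorm :: "nat \<Rightarrow> (complex \<Rightarrow> complex mat) \<Rightarrow> real" where
  "BMO_quotient_mnorm d F = Inf {Linf_mnorm d (\<lambda>z. F z - h z) | h. h \<in> matrices_over conj_H0inf d}"

section \<open>Spaces of analytic series\<close>

definition coeffs :: "nat \<Rightarrow> (complex \<Rightarrow> complex mat) \<Rightarrow> nat \<Rightarrow> complex mat" where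
  "coeffs d F = (\<lambda>n. mat d d (\<lambda>(i, j). fourier (\<lambda>z. F z $$ (i, j)) (int n)))"

text \<open>Identification of a function with the series of its Fourier coefficients of index \<open>\<ge> 0\<close>.
  For the three spaces below two functions with the same series differ by a function of
  seminorm zero, so the norm of a series is that of any function representing it.\<close>

definition series_space :: "complex opspace \<Rightarrow> nat opspace" where
  "series_space X = \<lparr>
     mcarr = (\<lambda>d. coeffs d ` mcarr X d),
     mnorm = (\<lambda>d a. THE r. \<exists>F\<in>mcarr X d. coeffs d F = a \<and> r = mnorm X d F)\<rparr>"

definition H1 :: "nat opspace" where
  "H1 = series_space \<lparr>mcarr = matrices_over (Hp 1), mnorm = L1_mnorm\<rparr>"

definition H2 :: "nat opspace" where
  "H2 = series_space \<lparr>mcarr = matrices_over (Hp 2), mnorm = OH_mnorm\<rparr>"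

definition BMOA :: "nat opspace" where
  "BMOA = series_space \<lparr>mcarr = matrices_over Linf, mnorm = BMO_quotient_mnorm\<rparr>"

definition BMOA2 :: "nat opspace" where
  "BMOA2 = \<lparr>
     mcarr = matrices_over {a. (\<lambda>n. complex_of_real ((cmod (a n))\<^sup>2)) \<in> scalars BMOA},
     mnorm = (\<lambda>d a. sqrt (mnorm BMOA (d * d) (\<lambda>n. tensor_conj (a n))))\<rparr>"

definition multiplier :: "(nat \<Rightarrow> complex mat) \<Rightarrow> (nat \<Rightarrow> complex) \<Rightarrow> nat \<Rightarrow> complex mat" where
  "multiplier m a = (\<lambda>n. a n \<cdot>\<^sub>m m n)"

text \<open>The space \<open>(X, Y)\<^sub>c\<^sub>b\<close>, with \<open>M\<^sub>d((X, Y)\<^sub>c\<^sub>b) = (X, M\<^sub>d(Y))\<^sub>c\<^sub>b\<close>.\<close>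

definition cb_multipliers :: "nat opspace \<Rightarrow> nat opspace \<Rightarrow> nat opspace" where
  "cb_multipliers X Y = \<lparr>
     mcarr = (\<lambda>d. {m. (\<forall>n. m n \<in> carrier_mat d d) \<and> cb_map d X Y (multiplier m)}),
     mnorm = (\<lambda>d m. cb_norm d X Y (multiplier m))\<rparr>"

end

theory Submission
  imports Defs "Jordan_Normal_Form.Determinant"
begin

text \<open>
  All norms in the theorem are norms of scalar matrices, possibly infinite. For a series \<open>a\<close> with
  coefficients in \<open>M\<^sub>d\<close>, the norm in \<open>M\<^sub>d(BMOA)\<close> is the norm of the block Hankel matrix
  \<open>(a\<^sub>p\<^sub>+\<^sub>q)\<close>: this is the operator valued theorem of Nehari, Page and Sarason (\<open>nehari\<close>,
  \<open>BMOA_mnorm_le_iff\<close>). The square of the norm in \<open>M\<^sub>d(H\<^sup>2)\<close> is the norm of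
  \<open>\<Sum> a\<^sub>n \<otimes> cnj a\<^sub>n\<close> (\<open>H2_mnorm_le_iff\<close>), and hence the square of the norm of a symbol \<open>m\<close> in the
  quadratic version of BMOA is the norm of the block Hankel matrix of \<open>m\<^sub>n \<otimes> cnj m\<^sub>n\<close>
  (\<open>BMOA2_mnorm_le_iff\<close>). Over \<open>H\<^sup>1\<close> the functions themselves are used, through the duality
  \<open>\<parallel>\<integral> G \<otimes> F\<parallel> \<le> \<parallel>G\<parallel> \<parallel>F\<parallel>\<close> between \<open>L\<^sup>\<infinity>\<close> and \<open>L\<^sup>1\<close> (\<open>pairing_bound\<close>). A matrix is handled as a kernel
  on two index sets together with a bound for its bilinear form, so that Kronecker products,
  permutations of tensor factors and compressions are relabellings of indices.

  Lower bounds come from one test element. The function \<open>\<Sum> z\<^sup>i\<^sup>+\<^sup>j e\<^sub>i\<^sub>j\<close> (\<open>i, j < N\<close>) has norm at most \<open>1\<close>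
  over \<open>H\<^sup>1\<close>, because pairing it with \<open>g\<close> yields a Hankel section of \<open>g\<close>. The multiplier with
  symbol \<open>m\<close> sends it to a series whose Hankel matrix, compressed to the indices \<open>(p, p)\<close>, is the
  Hankel section of \<open>m\<close>; measured in \<open>H\<^sup>2\<close> instead, the same compression yields the Hankel
  section of \<open>m \<otimes> cnj m\<close>. On \<open>H\<^sup>2\<close> the test element is this one tensored with the conjugated
  coefficients of \<open>m\<close> itself.

  Upper bounds. From \<open>H\<^sup>1\<close> to BMOA, the Hankel sections of the image of \<open>F\<close> are the integrals of
  \<open>F \<otimes> G\<close> with \<open>G(w) = (w\<^sup>-\<^sup>(\<^sup>p\<^sup>+\<^sup>q\<^sup>) m\<^sub>p\<^sub>+\<^sub>q)\<close>, and the norm of \<open>G(w)\<close> does not depend on \<open>w\<close>. From \<open>H\<^sup>1\<close>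
  to \<open>H\<^sup>2\<close>, the matrix \<open>\<Sum> F\<^sub>n \<otimes> cnj F\<^sub>n \<otimes> m\<^sub>n \<otimes> cnj m\<^sub>n\<close>, with Fejer weights, is a double integral of
  \<open>F(w) \<otimes> cnj F(v)\<close> against a bounded trigonometric polynomial in \<open>v/w\<close> with coefficients
  \<open>m\<^sub>n \<otimes> cnj m\<^sub>n\<close> for \<open>n \<ge> 0\<close> (\<open>fejer_mean_pairing\<close>). From \<open>H\<^sup>2\<close> to BMOA, the inequality of
  Haagerup and Pisier \<open>\<parallel>\<Sum> a\<^sub>n \<otimes> b\<^sub>n\<parallel>\<^sup>2 \<le> \<parallel>\<Sum> a\<^sub>n \<otimes> cnj a\<^sub>n\<parallel> \<parallel>\<Sum> b\<^sub>n \<otimes> cnj b\<^sub>n\<parallel>\<close>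
  (\<open>tensor_kernel_cauchy_schwarz\<close>) separates \<open>F\<close> from \<open>m\<close>. So the multipliers from \<open>H\<^sup>1\<close> to \<open>H\<^sup>2\<close> and
  those from \<open>H\<^sup>2\<close> to BMOA are both the quadratic version of BMOA.

  Nehari's theorem is proved by extending the Hankel matrix one block at a time. A new first block
  occurs only in the corner of the shifted matrix, so Parrott's theorem provides it without
  increasing the norm (\<open>hankel_extension\<close>). The Fejer means of the resulting two-sided sequence are
  compressions of its sections, hence bounded by the same constant, and they converge to the wanted
  function because the columns are square summable.
\<close>

section \<open>Kernels and their bilinear forms\<close>

definition l2norm :: "'i set \<Rightarrow> ('i \<Rightarrow> complex) \<Rightarrow> real" where
  "l2norm I x = L2_set (\<lambda>i. cmod (x i)) I"

text \<open>The form is bilinear, without conjugation, so that transposes, tensor products and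
  relabellings of kernels are plain substitutions.\<close>

definition kernel_form ::
    "'i set \<Rightarrow> 'j set \<Rightarrow> ('i \<Rightarrow> 'j \<Rightarrow> complex) \<Rightarrow> ('i \<Rightarrow> complex) \<Rightarrow> ('j \<Rightarrow> complex) \<Rightarrow> complex" where
  "kernel_form I J a y x = (\<Sum>i\<in>I. \<Sum>j\<in>J. y i * a i j * x j)"

text \<open>Quantifying over finite subsets gives a meaning to infinite index sets, which Hankel kernels
  need; for finite sets it is equivalent to the bound on the whole sets.\<close>

definition form_bounded :: "'i set \<Rightarrow> 'j set \<Rightarrow> ('i \<Rightarrow> 'j \<Rightarrow> complex) \<Rightarrow> real \<Rightarrow> bool" where
  "form_bounded I J a C \<longleftrightarrow> 0 \<le> C \<and>
     (\<forall>I' J' y x. finite I' \<longrightarrow> finite J' \<longrightarrow> I' \<subseteq> I \<longrightarrow> J' \<subseteq> J \<longrightarrow>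
        cmod (kernel_form I' J' a y x) \<le> C * l2norm I' y * l2norm J' x)"

abbreviation form_bounded_on :: "'i set \<Rightarrow> ('i \<Rightarrow> 'i \<Rightarrow> complex) \<Rightarrow> real \<Rightarrow> bool" where
  "form_bounded_on I \<equiv> form_bounded I I"

lemma l2norm_nonneg [simp]: "0 \<le> l2norm I x"
  by (simp add: l2norm_def L2_set_nonneg)

lemma l2norm_power2: "(l2norm I x)\<^sup>2 = (\<Sum>i\<in>I. (cmod (x i))\<^sup>2)"
  by (simp add: l2norm_def L2_set_def sum_nonneg)

lemma l2norm_cong: "I = I' \<Longrightarrow> (\<And>i. i \<in> I' \<Longrightarrow> x i = x' i) \<Longrightarrow> l2norm I x = l2norm I' x'"
  by (auto simp: l2norm_def intro!: L2_set_cong)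

lemma l2norm_cmod_cong: "(\<And>i. i \<in> I \<Longrightarrow> cmod (x i) = cmod (x' i)) \<Longrightarrow> l2norm I x = l2norm I x'"
  by (auto simp: l2norm_def intro!: L2_set_cong)

lemma l2norm_scale: "l2norm I (\<lambda>i. c * x i) = cmod c * l2norm I x"
  by (simp add: l2norm_def L2_set_right_distrib norm_mult)

lemma l2norm_zero_iff: "finite I \<Longrightarrow> l2norm I x = 0 \<longleftrightarrow> (\<forall>i\<in>I. x i = 0)"
  by (simp add: l2norm_def L2_set_eq_0_iff)

lemma l2norm_mono_set: "finite I \<Longrightarrow> I' \<subseteq> I \<Longrightarrow> l2norm I' x \<le> l2norm I x"
  unfolding l2norm_def L2_set_def by (intro real_sqrt_le_mono sum_mono2) auto

lemma l2norm_mono: "(\<And>i. i \<in> I \<Longrightarrow> cmod (x i) \<le> cmod (y i)) \<Longrightarrow> l2norm I x \<le> l2norm I y"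
  unfolding l2norm_def by (rule L2_set_mono) auto

lemma l2norm_reindex: "inj_on f I \<Longrightarrow> l2norm (f ` I) x = l2norm I (\<lambda>i. x (f i))"
  by (simp add: l2norm_def L2_set_def sum.reindex)

lemma l2norm_entry_le: "finite I \<Longrightarrow> i \<in> I \<Longrightarrow> cmod (x i) \<le> l2norm I x"
  unfolding l2norm_def using member_le_L2_set[of I i "\<lambda>i. cmod (x i)"] by simp

lemma l2norm_singleton [simp]: "l2norm {i} x = cmod (x i)"
  by (simp add: l2norm_def)

lemma l2norm_cauchy_schwarz: "cmod (\<Sum>i\<in>I. x i * y i) \<le> l2norm I x * l2norm I y"
proof -
  have "cmod (\<Sum>i\<in>I. x i * y i) \<le> (\<Sum>i\<in>I. \<bar>cmod (x i)\<bar> * \<bar>cmod (y i)\<bar>)"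
    by (rule order_trans[OF norm_sum]) (simp add: norm_mult)
  also have "\<dots> \<le> l2norm I x * l2norm I y" unfolding l2norm_def by (rule L2_set_mult_ineq)
  finally show ?thesis .
qed

lemma l2norm_Times: "l2norm (I \<times> K) (\<lambda>(i, k). x i * y k) = l2norm I x * l2norm K y"
  by (rule power2_eq_imp_eq)
    (simp_all add: l2norm_power2 power_mult_distrib sum_product norm_mult sum.cartesian_product
      case_prod_unfold)

lemma form_bounded_nonneg: "form_bounded I J a C \<Longrightarrow> 0 \<le> C"
  by (simp add: form_bounded_def)

lemma form_boundedD:
  "form_bounded I J a C \<Longrightarrow> finite I' \<Longrightarrow> finite J' \<Longrightarrow> I' \<subseteq> I \<Longrightarrow> J' \<subseteq> J \<Longrightarrow>
    cmod (kernel_form I' J' a y x) \<le> C * l2norm I' y * l2norm J' x"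
  unfolding form_bounded_def by blast

lemma form_bounded_mono: "form_bounded I J a C \<Longrightarrow> C \<le> D \<Longrightarrow> form_bounded I J a D"
  unfolding form_bounded_def
  by (meson order_trans mult_right_mono l2norm_nonneg)

lemma form_bounded_subset:
  "form_bounded I J a C \<Longrightarrow> I' \<subseteq> I \<Longrightarrow> J' \<subseteq> J \<Longrightarrow> form_bounded I' J' a C"
  unfolding form_bounded_def by (meson order_trans)

lemma kernel_form_cong:
  "I = I' \<Longrightarrow> J = J' \<Longrightarrow> (\<And>i. i \<in> I' \<Longrightarrow> y i = y' i) \<Longrightarrow> (\<And>j. j \<in> J' \<Longrightarrow> x j = x' j) \<Longrightarrow>
    (\<And>i j. i \<in> I' \<Longrightarrow> j \<in> J' \<Longrightarrow> a i j = a' i j) \<Longrightarrow> kernel_form I J a y x = kernel_form I' J' a' y' x'"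
  unfolding kernel_form_def by (auto intro!: sum.cong)

lemma form_bounded_cong:
  assumes "\<And>i j. i \<in> I \<Longrightarrow> j \<in> J \<Longrightarrow> a i j = b i j"
  shows "form_bounded I J a C \<longleftrightarrow> form_bounded I J b C"
proof -
  have "kernel_form I' J' a y x = kernel_form I' J' b y x" if "I' \<subseteq> I" "J' \<subseteq> J" for I' J' y x
    using that assms by (intro kernel_form_cong) auto
  then show ?thesis unfolding form_bounded_def by (metis (no_types, lifting))
qed

lemma form_bounded_finiteI:
  assumes "finite I" "finite J" "0 \<le> C"
    and "\<And>y x. cmod (kernel_form I J a y x) \<le> C * l2norm I y * l2norm J x"
  shows "form_bounded I J a C"
  unfolding form_bounded_def
proof (intro conjI allI impI)
  fix I' J' and y x :: "_ \<Rightarrow> complex" assume *: "finite I'" "finite J'" "I' \<subseteq> I" "J' \<subseteq> J"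
  define y' where "y' = (\<lambda>i. if i \<in> I' then y i else 0)"
  define x' where "x' = (\<lambda>j. if j \<in> J' then x j else 0)"
  have "kernel_form I J a y' x' = (\<Sum>i\<in>I'. \<Sum>j\<in>J. y i * a i j * x' j)"
    unfolding kernel_form_def using * assms
    by (intro sum.mono_neutral_cong_right) (auto simp: y'_def)
  also have "\<dots> = kernel_form I' J' a y x"
    unfolding kernel_form_def using * assms
    by (intro sum.cong[OF refl] sum.mono_neutral_cong_right) (auto simp: x'_def)
  finally have 1: "kernel_form I J a y' x' = kernel_form I' J' a y x" .
  have "(l2norm I y')\<^sup>2 = (l2norm I' y)\<^sup>2"
    unfolding l2norm_power2 using * assms by (intro sum.mono_neutral_cong_right) (auto simp: y'_def)
  then have 2: "l2norm I y' = l2norm I' y" by (rule power2_eq_imp_eq) simp_all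
  have "(l2norm J x')\<^sup>2 = (l2norm J' x)\<^sup>2"
    unfolding l2norm_power2 using * assms by (intro sum.mono_neutral_cong_right) (auto simp: x'_def)
  then have 3: "l2norm J x' = l2norm J' x" by (rule power2_eq_imp_eq) simp_all
  show "cmod (kernel_form I' J' a y x) \<le> C * l2norm I' y * l2norm J' x"
    using assms(4)[of y' x'] unfolding 1 2 3 .
qed (use assms in auto)

lemma kernel_form_scale:
  "kernel_form I J a (\<lambda>i. c * y i) (\<lambda>j. d * x j) = c * d * kernel_form I J a y x"
  by (simp add: kernel_form_def sum_distrib_left mult_ac)

text \<open>By homogeneity the product of the norms may be replaced by the mean of their squares. In this
  shape the bound can be integrated, as integrals of squared norms are given by orthogonality.\<close>

lemma form_boundedI_squares:
  assumes fin: "finite I" "finite J" and C: "0 \<le> C"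
    and am: "\<And>y x. cmod (kernel_form I J a y x) \<le> C * ((l2norm I y)\<^sup>2 + (l2norm J x)\<^sup>2) / 2"
  shows "form_bounded I J a C"
proof (rule form_bounded_finiteI[OF fin C])
  fix y x
  let ?Y = "l2norm I y" and ?X = "l2norm J x"
  show "cmod (kernel_form I J a y x) \<le> C * ?Y * ?X"
  proof (cases "?Y = 0 \<or> ?X = 0")
    case True
    then have "kernel_form I J a y x = 0" using fin by (auto simp: l2norm_zero_iff kernel_form_def)
    then show ?thesis using C by simp
  next
    case False
    then have pos: "?Y > 0" "?X > 0" using l2norm_nonneg[of I y] l2norm_nonneg[of J x] by linarith+
    let ?c = "complex_of_real (1 / ?Y)" and ?d = "complex_of_real (1 / ?X)"
    have "cmod (kernel_form I J a (\<lambda>i. ?c * y i) (\<lambda>j. ?d * x j))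
        \<le> C * ((l2norm I (\<lambda>i. ?c * y i))\<^sup>2 + (l2norm J (\<lambda>j. ?d * x j))\<^sup>2) / 2" by (rule am)
    also have "\<dots> = C" unfolding l2norm_scale using pos by (simp add: norm_divide)
    finally show ?thesis unfolding kernel_form_scale norm_mult using pos
      by (simp add: norm_divide field_simps)
  qed
qed

lemma kernel_form_apply: "kernel_form I J a y x = (\<Sum>i\<in>I. y i * (\<Sum>j\<in>J. a i j * x j))"
  by (simp add: kernel_form_def sum_distrib_left mult_ac)

lemma form_bounded_apply:
  assumes "form_bounded I J a C" "finite I" "finite J"
  shows "l2norm I (\<lambda>i. \<Sum>j\<in>J. a i j * x j) \<le> C * l2norm J x"
proof -
  define v where "v = (\<lambda>i. \<Sum>j\<in>J. a i j * x j)"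
  have v: "(\<Sum>j\<in>J. a i j * x j) = v i" for i by (simp add: v_def)
  have "kernel_form I J a (\<lambda>i. cnj (v i)) x = of_real ((l2norm I v)\<^sup>2)"
    unfolding kernel_form_apply v l2norm_power2 of_real_sum
    by (intro sum.cong refl) (subst mult.commute, simp add: complex_norm_square[symmetric])
  moreover have "l2norm I (\<lambda>i. cnj (v i)) = l2norm I v" by (intro l2norm_cmod_cong) simp
  ultimately have "(l2norm I v)\<^sup>2 \<le> C * l2norm I v * l2norm J x"
    using form_boundedD[OF assms(1) assms(2,3) subset_refl subset_refl, of "\<lambda>i. cnj (v i)" x]
    by (simp add: norm_power)
  then have "l2norm I v * l2norm I v \<le> l2norm I v * (C * l2norm J x)"
    by (simp add: power2_eq_square mult_ac)
  moreover have "0 \<le> C * l2norm J x" using form_bounded_nonneg[OF assms(1)] by simp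
  moreover have "l2norm I v = 0 \<or> l2norm I v > 0" using l2norm_nonneg[of I v] by linarith
  ultimately show ?thesis unfolding v
    using mult_le_cancel_left_pos by metis
qed

lemma form_bounded_applyI:
  assumes "finite I" "finite J" "0 \<le> C" "\<And>x. l2norm I (\<lambda>i. \<Sum>j\<in>J. a i j * x j) \<le> C * l2norm J x"
  shows "form_bounded I J a C"
proof (rule form_bounded_finiteI[OF assms(1-3)])
  fix y x
  have "cmod (kernel_form I J a y x) \<le> l2norm I y * l2norm I (\<lambda>i. \<Sum>j\<in>J. a i j * x j)"
    unfolding kernel_form_apply by (rule l2norm_cauchy_schwarz)
  also have "\<dots> \<le> l2norm I y * (C * l2norm J x)" by (intro mult_left_mono assms(4)) simp
  finally show "cmod (kernel_form I J a y x) \<le> C * l2norm I y * l2norm J x" by (simp add: mult_ac)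
qed

lemma form_bounded_transpose:
  assumes "form_bounded I J a C"
  shows "form_bounded J I (\<lambda>j i. a i j) C"
  unfolding form_bounded_def
proof (intro conjI allI impI)
  fix J' I' and x y :: "_ \<Rightarrow> complex" assume *: "finite J'" "finite I'" "J' \<subseteq> J" "I' \<subseteq> I"
  have "kernel_form J' I' (\<lambda>j i. a i j) x y = kernel_form I' J' a y x"
    unfolding kernel_form_def by (subst sum.swap) (simp add: mult_ac)
  then show "cmod (kernel_form J' I' (\<lambda>j i. a i j) x y) \<le> C * l2norm J' x * l2norm I' y"
    using form_boundedD[OF assms *(2,1,4,3), of y x] by (simp add: mult_ac)
qed (rule form_bounded_nonneg[OF assms])

lemma form_bounded_compress:
  assumes "form_bounded I J a C" "inj_on f I'" "inj_on g J'" "f ` I' \<subseteq> I" "g ` J' \<subseteq> J"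
  shows "form_bounded I' J' (\<lambda>i j. a (f i) (g j)) C"
  unfolding form_bounded_def
proof (intro conjI allI impI)
  fix I'' J'' and y x :: "_ \<Rightarrow> complex" assume *: "finite I''" "finite J''" "I'' \<subseteq> I'" "J'' \<subseteq> J'"
  have inj: "inj_on f I''" "inj_on g J''" using * assms inj_on_subset by blast+
  define y' where "y' = (\<lambda>i. y (the_inv_into I'' f i))"
  define x' where "x' = (\<lambda>i. x (the_inv_into J'' g i))"
  have y': "y' (f i) = y i" if "i \<in> I''" for i using that inj by (simp add: y'_def the_inv_into_f_f)
  have x': "x' (g i) = x i" if "i \<in> J''" for i using that inj by (simp add: x'_def the_inv_into_f_f)
  have "cmod (kernel_form (f ` I'') (g ` J'') a y' x') \<le> C * l2norm (f ` I'') y' * l2norm (g ` J'') x'"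
    using * assms(4,5) by (intro form_boundedD[OF assms(1)]) blast+
  moreover have "kernel_form (f ` I'') (g ` J'') a y' x' = kernel_form I'' J'' (\<lambda>i j. a (f i) (g j)) y x"
    unfolding kernel_form_def by (simp add: sum.reindex inj y' x')
  moreover have "l2norm (f ` I'') y' = l2norm I'' y" "l2norm (g ` J'') x' = l2norm J'' x"
    by (simp_all add: l2norm_reindex inj y' x' cong: l2norm_cong)
  ultimately show "cmod (kernel_form I'' J'' (\<lambda>i j. a (f i) (g j)) y x) \<le> C * l2norm I'' y * l2norm J'' x"
    by simp
qed (rule form_bounded_nonneg[OF assms(1)])

text \<open>Compression along an injective relabelling. Identifications of tensor products and restrictions
  to diagonals are all of this kind.\<close>

lemma form_bounded_transfer:
  assumes "form_bounded_on S a C" "inj_on f T" "f ` T \<subseteq> S"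
    and "\<And>x y. x \<in> T \<Longrightarrow> y \<in> T \<Longrightarrow> a (f x) (f y) = b x y"
  shows "form_bounded_on T b C"
  by (rule iffD1[OF form_bounded_cong[OF assms(4)] form_bounded_compress[OF assms(1) assms(2,2) assms(3,3)]])

lemma form_bounded_reindex:
  assumes "bij_betw f I' I" "bij_betw g J' J"
  shows "form_bounded I' J' (\<lambda>i j. a (f i) (g j)) C \<longleftrightarrow> form_bounded I J a C"
proof
  assume *: "form_bounded I' J' (\<lambda>i j. a (f i) (g j)) C"
  let ?f = "the_inv_into I' f" and ?g = "the_inv_into J' g"
  have b: "bij_betw ?f I I'" "bij_betw ?g J J'" using assms bij_betw_the_inv_into by blast+
  have "form_bounded I J (\<lambda>i j. a (f (?f i)) (g (?g j))) C"
    by (rule form_bounded_compress[OF *]) (use b in \<open>auto simp: bij_betw_def\<close>)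
  moreover have "f (?f i) = i" if "i \<in> I" for i
    using that assms(1) by (metis bij_betw_def f_the_inv_into_f)
  moreover have "g (?g i) = i" if "i \<in> J" for i
    using that assms(2) by (metis bij_betw_def f_the_inv_into_f)
  ultimately show "form_bounded I J a C" by (simp cong: form_bounded_cong)
next
  assume "form_bounded I J a C"
  then show "form_bounded I' J' (\<lambda>i j. a (f i) (g j)) C"
    by (rule form_bounded_compress) (use assms in \<open>auto simp: bij_betw_def\<close>)
qed

lemma form_bounded_cnj: "form_bounded I J (\<lambda>i j. cnj (a i j)) C \<longleftrightarrow> form_bounded I J a C"
proof -
  have "form_bounded I J (\<lambda>i j. cnj (a i j)) C" if a: "form_bounded I J a C" for a :: "'a \<Rightarrow> 'b \<Rightarrow> complex"
    unfolding form_bounded_def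
  proof (intro conjI allI impI)
    fix I' J' and y x :: "_ \<Rightarrow> complex" assume *: "finite I'" "finite J'" "I' \<subseteq> I" "J' \<subseteq> J"
    have "kernel_form I' J' (\<lambda>i j. cnj (a i j)) y x
        = cnj (kernel_form I' J' a (\<lambda>i. cnj (y i)) (\<lambda>j. cnj (x j)))"
      by (simp add: kernel_form_def)
    then have "cmod (kernel_form I' J' (\<lambda>i j. cnj (a i j)) y x)
        \<le> C * l2norm I' (\<lambda>i. cnj (y i)) * l2norm J' (\<lambda>j. cnj (x j))"
      using form_boundedD[OF a *] by simp
    also have "l2norm I' (\<lambda>i. cnj (y i)) = l2norm I' y" by (intro l2norm_cmod_cong) simp
    also have "l2norm J' (\<lambda>i. cnj (x i)) = l2norm J' x" by (intro l2norm_cmod_cong) simp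
    finally show "cmod (kernel_form I' J' (\<lambda>i j. cnj (a i j)) y x) \<le> C * l2norm I' y * l2norm J' x" .
  qed (rule form_bounded_nonneg[OF a])
  from this[of a] this[of "\<lambda>i j. cnj (a i j)"] show ?thesis by auto
qed

text \<open>Multiplication by diagonal contractions. With characters on the diagonals it shows that the
  bound of a Hankel kernel is not affected by the factor \<open>w\<^sup>p\<^sup>+\<^sup>q\<close> at the entry \<open>(p, q)\<close>.\<close>

lemma form_bounded_diag:
  assumes "form_bounded I J a C" "\<And>i. i \<in> I \<Longrightarrow> cmod (u i) \<le> 1" "\<And>j. j \<in> J \<Longrightarrow> cmod (v j) \<le> 1"
  shows "form_bounded I J (\<lambda>i j. u i * a i j * v j) C"
  unfolding form_bounded_def
proof (intro conjI allI impI)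
  fix I' J' and y x :: "_ \<Rightarrow> complex" assume *: "finite I'" "finite J'" "I' \<subseteq> I" "J' \<subseteq> J"
  have "kernel_form I' J' (\<lambda>i j. u i * a i j * v j) y x = kernel_form I' J' a (\<lambda>i. u i * y i) (\<lambda>j. v j * x j)"
    by (simp add: kernel_form_def mult_ac)
  also have "cmod \<dots> \<le> C * l2norm I' (\<lambda>i. u i * y i) * l2norm J' (\<lambda>j. v j * x j)"
    using * assms by (intro form_boundedD)
  also have "\<dots> \<le> C * l2norm I' y * l2norm J' x"
    using form_bounded_nonneg[OF assms(1)] * assms
    by (intro mult_mono l2norm_mono mult_left_mono) (auto simp: norm_mult mult_left_le_one_le subset_iff)
  finally show "cmod (kernel_form I' J' (\<lambda>i j. u i * a i j * v j) y x) \<le> C * l2norm I' y * l2norm J' x" .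
qed (rule form_bounded_nonneg[OF assms(1)])

lemma form_bounded_scale:
  assumes "form_bounded I J a C"
  shows "form_bounded I J (\<lambda>i j. c * a i j) (cmod c * C)"
proof -
  have 1: "kernel_form I' J' (\<lambda>i j. c * a i j) y x = c * kernel_form I' J' a y x" for I' J' y x
    by (simp add: kernel_form_def sum_distrib_left mult_ac)
  show ?thesis unfolding form_bounded_def 1 norm_mult
    using assms by (auto simp: form_bounded_def mult.assoc intro!: mult_left_mono)
qed

lemma form_bounded_zero [simp]: "0 \<le> C \<Longrightarrow> form_bounded I J (\<lambda>i j. 0) C"
  by (simp add: form_bounded_def kernel_form_def)

lemma form_bounded_add:
  assumes "form_bounded I J a A" "form_bounded I J b B"
  shows "form_bounded I J (\<lambda>i j. a i j + b i j) (A + B)"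
proof -
  have 1: "kernel_form I' J' (\<lambda>i j. a i j + b i j) y x = kernel_form I' J' a y x + kernel_form I' J' b y x"
    for I' J' y x by (simp add: kernel_form_def sum.distrib algebra_simps)
  show ?thesis unfolding form_bounded_def 1
  proof (intro conjI allI impI)
    fix I' J' and y x :: "_ \<Rightarrow> complex" assume *: "finite I'" "finite J'" "I' \<subseteq> I" "J' \<subseteq> J"
    show "cmod (kernel_form I' J' a y x + kernel_form I' J' b y x) \<le> (A + B) * l2norm I' y * l2norm J' x"
      using form_boundedD[OF assms(1) *, of y x] form_boundedD[OF assms(2) *, of y x]
        norm_triangle_ineq[of "kernel_form I' J' a y x" "kernel_form I' J' b y x"]
      by (simp add: algebra_simps)
  qed (use form_bounded_nonneg[OF assms(1)] form_bounded_nonneg[OF assms(2)] in simp)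
qed

lemma form_bounded_sum:
  assumes "finite S" "\<And>s. s \<in> S \<Longrightarrow> form_bounded I J (a s) (A s)"
  shows "form_bounded I J (\<lambda>i j. \<Sum>s\<in>S. a s i j) (\<Sum>s\<in>S. A s)"
  using assms by (induction S) (auto intro: form_bounded_add)

lemma form_bounded_tendsto:
  assumes "\<forall>\<^sub>F n in F. form_bounded I J (a n) (C n)" "F \<noteq> bot"
    and "\<And>i j. i \<in> I \<Longrightarrow> j \<in> J \<Longrightarrow> ((\<lambda>n. a n i j) \<longlongrightarrow> b i j) F" "(C \<longlongrightarrow> D) F"
  shows "form_bounded I J b D"
  unfolding form_bounded_def
proof (intro conjI allI impI)
  show "0 \<le> D" using assms(1)
    by (intro tendsto_lowerbound[OF assms(4) _ assms(2)]) (auto elim!: eventually_mono dest: form_bounded_nonneg)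
  fix I' J' and y x :: "_ \<Rightarrow> complex" assume *: "finite I'" "finite J'" "I' \<subseteq> I" "J' \<subseteq> J"
  have "((\<lambda>n. cmod (kernel_form I' J' (a n) y x)) \<longlongrightarrow> cmod (kernel_form I' J' b y x)) F"
    unfolding kernel_form_def using * assms(3) by (intro tendsto_intros) auto
  moreover have "((\<lambda>n. C n * l2norm I' y * l2norm J' x) \<longlongrightarrow> D * l2norm I' y * l2norm J' x) F"
    by (intro tendsto_intros assms)
  moreover have "\<forall>\<^sub>F n in F. cmod (kernel_form I' J' (a n) y x) \<le> C n * l2norm I' y * l2norm J' x"
    by (rule eventually_mono[OF assms(1)], rule form_boundedD) (use * in auto)
  ultimately show "cmod (kernel_form I' J' b y x) \<le> D * l2norm I' y * l2norm J' x"
    using tendsto_le[OF assms(2)] by blast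
qed

lemma form_bounded_eps:
  assumes "\<And>e. e > 0 \<Longrightarrow> form_bounded I J a (C + e)"
  shows "form_bounded I J a C"
proof (rule form_bounded_tendsto[where F = sequentially])
  show "\<forall>\<^sub>F n in sequentially. form_bounded I J a (C + 1 / real (Suc n))"
    by (intro always_eventually allI assms) auto
  show "(\<lambda>n. C + 1 / real (Suc n)) \<longlonglongrightarrow> C"
    using tendsto_add[OF tendsto_const LIMSEQ_Suc[OF lim_1_over_n], of C] by simp
qed auto

lemma form_bounded_entry:
  assumes "form_bounded I J a C" "i \<in> I" "j \<in> J"
  shows "cmod (a i j) \<le> C"
  using form_boundedD[OF assms(1), of "{i}" "{j}" "\<lambda>_. 1" "\<lambda>_. 1"] assms by (simp add: kernel_form_def)

lemma form_bounded_comp: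
  assumes "form_bounded I K a A" "form_bounded K J b B" "finite I" "finite J" "finite K"
  shows "form_bounded I J (\<lambda>i j. \<Sum>k\<in>K. a i k * b k j) (A * B)"
proof (rule form_bounded_applyI)
  fix x
  have "(\<Sum>j\<in>J. (\<Sum>k\<in>K. a i k * b k j) * x j) = (\<Sum>k\<in>K. a i k * (\<Sum>j\<in>J. b k j * x j))" for i
    unfolding sum_distrib_left sum_distrib_right by (subst sum.swap) (simp add: mult_ac)
  then have "l2norm I (\<lambda>i. \<Sum>j\<in>J. (\<Sum>k\<in>K. a i k * b k j) * x j) \<le> A * l2norm K (\<lambda>k. \<Sum>j\<in>J. b k j * x j)"
    using form_bounded_apply[OF assms(1)] assms by simp
  also have "\<dots> \<le> A * (B * l2norm J x)"
    using form_bounded_apply[OF assms(2)] assms form_bounded_nonneg[OF assms(1)] by (intro mult_left_mono) auto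
  finally show "l2norm I (\<lambda>i. \<Sum>j\<in>J. (\<Sum>k\<in>K. a i k * b k j) * x j) \<le> A * B * l2norm J x" by simp
qed (use assms form_bounded_nonneg[OF assms(1)] form_bounded_nonneg[OF assms(2)] in auto)

lemma form_bounded_single_block:
  assumes "form_bounded I J a C" 
  shows "form_bounded (I \<times> P) (J \<times> Q) (\<lambda>(i, p) (j, q). if p = r \<and> q = s then a i j else 0) C"
  unfolding form_bounded_def
proof (intro conjI allI impI)
  fix I' J' and y x :: "_ \<Rightarrow> complex" assume *: "finite I'" "finite J'" "I' \<subseteq> I \<times> P" "J' \<subseteq> J \<times> Q"
  let ?a = "\<lambda>(i, p) (j, q). if p = r \<and> q = s then a i j else 0"
  define I1 where "I1 = {i. (i, r) \<in> I'}"
  define J1 where "J1 = {j. (j, s) \<in> J'}"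
  have im: "(\<lambda>i. (i, r)) ` I1 \<subseteq> I'" "(\<lambda>j. (j, s)) ` J1 \<subseteq> J'" by (auto simp: I1_def J1_def)
  have fin: "finite I1" "finite J1"
    by (rule finite_imageD[of "\<lambda>i. (i, r)"], rule finite_subset[OF im(1)]; use * in \<open>simp add: inj_on_def\<close>)
       (rule finite_imageD[of "\<lambda>i. (i, s)"], rule finite_subset[OF im(2)]; use * in \<open>simp add: inj_on_def\<close>)
  have "kernel_form I' J' ?a y x = kernel_form ((\<lambda>i. (i, r)) ` I1) ((\<lambda>j. (j, s)) ` J1) ?a y x"
    unfolding kernel_form_def using * im
    by (intro sum.mono_neutral_cong_right ballI sum.neutral) (auto simp: I1_def J1_def image_iff)
  also have "\<dots> = kernel_form I1 J1 a (\<lambda>i. y (i, r)) (\<lambda>j. x (j, s))"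
    unfolding kernel_form_def by (simp add: sum.reindex inj_on_def)
  also have "cmod \<dots> \<le> C * l2norm I1 (\<lambda>i. y (i, r)) * l2norm J1 (\<lambda>j. x (j, s))"
    using * fin by (intro form_boundedD[OF assms]) (auto simp: I1_def J1_def)
  also have "\<dots> = C * l2norm ((\<lambda>i. (i, r)) ` I1) y * l2norm ((\<lambda>j. (j, s)) ` J1) x"
    by (simp add: l2norm_reindex inj_on_def)
  also have "\<dots> \<le> C * l2norm I' y * l2norm J' x"
    using form_bounded_nonneg[OF assms] im * by (intro mult_mono mult_left_mono l2norm_mono_set) auto
  finally show "cmod (kernel_form I' J' ?a y x) \<le> C * l2norm I' y * l2norm J' x" .
qed (rule form_bounded_nonneg[OF assms(1)])

text \<open>Summing the bounds of all blocks is wasteful, but it is enough wherever only finiteness matters.\<close>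

lemma form_bounded_blocks:
  assumes "finite P" "finite Q" "\<And>p q. p \<in> P \<Longrightarrow> q \<in> Q \<Longrightarrow> form_bounded I J (a p q) (A p q)"
  shows "form_bounded (I \<times> P) (J \<times> Q) (\<lambda>(i, p) (j, q). a p q i j) (\<Sum>p\<in>P. \<Sum>q\<in>Q. A p q)"
proof -
  let ?k = "\<lambda>r s. (\<lambda>(i, p) (j, q). if p = r \<and> q = s then a r s i j else 0)"
  have "form_bounded (I \<times> P) (J \<times> Q) (\<lambda>i j. \<Sum>r\<in>P. \<Sum>s\<in>Q. ?k r s i j) (\<Sum>p\<in>P. \<Sum>q\<in>Q. A p q)"
    using assms by (intro form_bounded_sum form_bounded_single_block)
  moreover have "(\<Sum>r\<in>P. \<Sum>s\<in>Q. ?k r s i j) = (case i of (i, p) \<Rightarrow> case j of (j, q) \<Rightarrow> a p q i j)"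
    if "i \<in> I \<times> P" "j \<in> J \<times> Q" for i j
  proof -
    obtain i0 p j0 q where ij: "i = (i0, p)" "j = (j0, q)" by (cases i, cases j) auto
    have "(\<Sum>r\<in>P. \<Sum>s\<in>Q. ?k r s i j) = (\<Sum>r\<in>P. if p = r then (\<Sum>s\<in>Q. if q = s then a r s i0 j0 else 0) else 0)"
      unfolding ij by (intro sum.cong refl) auto
    also have "\<dots> = a p q i0 j0" using that assms by (simp add: ij)
    finally show ?thesis by (simp add: ij)
  qed
  ultimately show ?thesis
    by (subst form_bounded_cong[where b = "\<lambda>i j. \<Sum>r\<in>P. \<Sum>s\<in>Q. ?k r s i j"]) (auto simp: case_prod_unfold)
qed

section \<open>The Cauchy--Schwarz inequality for tensor products of kernels\<close>

text \<open>The norm of \<open>S\<^sup>* S\<close> is the square of the norm of \<open>S\<close>.\<close>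

lemma form_bounded_squareI:
  assumes fin: "finite I" "finite J"
    and D: "form_bounded_on J (\<lambda>j j'. \<Sum>i\<in>I. cnj (m i j) * m i j') D"
  shows "form_bounded I J m (sqrt D)"
proof (rule form_bounded_applyI[OF fin])
  show "0 \<le> sqrt D" using form_bounded_nonneg[OF D] by simp
  fix x
  define v where "v = (\<lambda>i. \<Sum>j\<in>J. m i j * x j)"
  have "kernel_form J J (\<lambda>j j'. \<Sum>i\<in>I. cnj (m i j) * m i j') (\<lambda>j. cnj (x j)) x
      = (\<Sum>j\<in>J. \<Sum>j'\<in>J. \<Sum>i\<in>I. cnj (m i j * x j) * (m i j' * x j'))"
    unfolding kernel_form_def by (simp add: sum_distrib_left sum_distrib_right mult_ac)
  also have "\<dots> = (\<Sum>i\<in>I. \<Sum>j\<in>J. \<Sum>j'\<in>J. cnj (m i j * x j) * (m i j' * x j'))"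
    by (subst (2) sum.swap, subst sum.swap) simp
  also have "\<dots> = (\<Sum>i\<in>I. cnj (v i) * v i)"
    by (simp add: v_def sum_product)
  also have "\<dots> = of_real ((l2norm I v)\<^sup>2)"
    unfolding l2norm_power2 of_real_sum
    by (intro sum.cong refl) (subst mult.commute, simp add: complex_norm_square[symmetric])
  finally have *: "kernel_form J J (\<lambda>j j'. \<Sum>i\<in>I. cnj (m i j) * m i j') (\<lambda>j. cnj (x j)) x
      = of_real ((l2norm I v)\<^sup>2)" .
  have cnj: "l2norm J (\<lambda>j. cnj (x j)) = l2norm J x" by (intro l2norm_cmod_cong) simp
  have sq: "(sqrt D * l2norm J x)\<^sup>2 = D * l2norm J x * l2norm J x"
    using form_bounded_nonneg[OF D] by (simp add: power_mult_distrib power2_eq_square[of "l2norm J x"])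
  have "(l2norm I v)\<^sup>2 \<le> (sqrt D * l2norm J x)\<^sup>2"
    using form_boundedD[OF D fin(2,2) subset_refl subset_refl, of "\<lambda>j. cnj (x j)" x]
    unfolding * cnj sq by (simp add: norm_power)
  then show "l2norm I (\<lambda>i. \<Sum>j\<in>J. m i j * x j) \<le> sqrt D * l2norm J x"
    unfolding v_def[symmetric]
    by (rule power2_le_imp_le) (use form_bounded_nonneg[OF D] in simp)
qed

lemma form_bounded_entriesI:
  assumes fin: "finite I" "finite J" and c: "0 \<le> c" "\<And>i j. i \<in> I \<Longrightarrow> j \<in> J \<Longrightarrow> cmod (a i j) \<le> c"
  shows "form_bounded I J a (real (card I) * real (card J) * c)"
proof (rule form_bounded_finiteI[OF fin])
  fix y x :: "_ \<Rightarrow> complex"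
  have "cmod (kernel_form I J a y x) \<le> (\<Sum>i\<in>I. \<Sum>j\<in>J. cmod (y i * a i j * x j))"
    unfolding kernel_form_def by (intro sum_norm_le order_refl)
  also have "\<dots> \<le> (\<Sum>i\<in>I. \<Sum>j\<in>J. c * l2norm I y * l2norm J x)"
  proof (intro sum_mono)
    fix i j assume *: "i \<in> I" "j \<in> J"
    have "cmod (y i * a i j * x j) = cmod (a i j) * (cmod (y i) * cmod (x j))" by (simp add: norm_mult)
    also have "\<dots> \<le> c * (l2norm I y * l2norm J x)"
      using * c fin by (intro mult_mono l2norm_entry_le) auto
    finally show "cmod (y i * a i j * x j) \<le> c * l2norm I y * l2norm J x" by (simp add: mult_ac)
  qed
  also have "\<dots> = real (card I) * real (card J) * c * l2norm I y * l2norm J x" by simp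
  finally show "cmod (kernel_form I J a y x) \<le> real (card I) * real (card J) * c * l2norm I y * l2norm J x" .
qed (use c in simp)

text \<open>The matrix \<open>\<Sum> a\<^sub>s \<otimes> cnj a\<^sub>s\<close>; its norm is the square of the norm of \<open>\<Sum> a\<^sub>s \<otimes> e\<^sub>s\<close> over the operator
  Hilbert space with orthonormal basis \<open>(e\<^sub>s)\<close>.\<close>

definition square_kernel :: "'s set \<Rightarrow> ('s \<Rightarrow> 'i \<Rightarrow> 'j \<Rightarrow> complex) \<Rightarrow> 'i \<times> 'i \<Rightarrow> 'j \<times> 'j \<Rightarrow> complex" where
  "square_kernel S a = (\<lambda>(i, i') (j, j'). \<Sum>s\<in>S. a s i j * cnj (a s i' j'))"

definition tensor_kernel ::
    "'s set \<Rightarrow> ('s \<Rightarrow> 'i \<Rightarrow> 'j \<Rightarrow> complex) \<Rightarrow> ('s \<Rightarrow> 'k \<Rightarrow> 'l \<Rightarrow> complex) \<Rightarrow> 'i \<times> 'k \<Rightarrow> 'j \<times> 'l \<Rightarrow> complex" where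
  "tensor_kernel S a b = (\<lambda>(i, k) (j, l). \<Sum>s\<in>S. a s i j * b s k l)"

text \<open>The scalar Cauchy--Schwarz inequality in every entry proves the inequality up to a constant that
  depends on the sizes of the matrices.\<close>

lemma tensor_kernel_crude:
  assumes fin: "finite I" "finite J" "finite K" "finite L"
    and A: "form_bounded (I \<times> I) (J \<times> J) (square_kernel S a) A"
    and B: "form_bounded (K \<times> K) (L \<times> L) (square_kernel S b) B"
  shows "form_bounded (I \<times> K) (J \<times> L) (tensor_kernel S a b)
           (real (card (I \<times> K)) * real (card (J \<times> L)) * sqrt (A * B))"
proof (rule form_bounded_entriesI)
  show "0 \<le> sqrt (A * B)" using form_bounded_nonneg[OF A] form_bounded_nonneg[OF B] by simp
  have sq: "(l2norm S (\<lambda>s. a s i j))\<^sup>2 = cmod (square_kernel S a (i, i) (j, j))" for a :: "_ \<Rightarrow> 'z \<Rightarrow> 'w \<Rightarrow> _" and i j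
  proof -
    have "square_kernel S a (i, i) (j, j) = of_real ((l2norm S (\<lambda>s. a s i j))\<^sup>2)"
      unfolding square_kernel_def l2norm_power2 of_real_sum by (simp add: complex_norm_square[symmetric])
    then show ?thesis by (simp add: norm_power)
  qed
  fix x y assume *: "x \<in> I \<times> K" "y \<in> J \<times> L"
  obtain i k j l where xy: "x = (i, k)" "y = (j, l)" by (cases x, cases y) auto
  have "cmod (tensor_kernel S a b x y) \<le> l2norm S (\<lambda>s. a s i j) * l2norm S (\<lambda>s. b s k l)"
    unfolding xy tensor_kernel_def by (simp add: l2norm_cauchy_schwarz)
  also have "\<dots> = sqrt ((l2norm S (\<lambda>s. a s i j))\<^sup>2 * (l2norm S (\<lambda>s. b s k l))\<^sup>2)"
    by (simp add: real_sqrt_mult)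
  also have "\<dots> \<le> sqrt (A * B)"
    unfolding sq using * xy form_bounded_nonneg[OF A]
    by (intro real_sqrt_le_mono mult_mono form_bounded_entry[OF A] form_bounded_entry[OF B]) auto
  finally show "cmod (tensor_kernel S a b x y) \<le> sqrt (A * B)" .
qed (use fin in auto)

lemma sum_Times: "(\<Sum>z\<in>A \<times> B. h z) = (\<Sum>x\<in>A. \<Sum>y\<in>B. h (x, y))"
  by (simp add: sum.cartesian_product)

text \<open>For the family of products \<open>a\<^sub>s\<^sup>* a\<^sub>t\<close> the matrix \<open>A = \<Sum> a\<^sub>s \<otimes> cnj a\<^sub>s\<close> is replaced by \<open>A\<^sup>* A\<close>.\<close>

lemma square_kernel_gram:
  assumes fin: "finite I" "finite J" and A: "form_bounded (I \<times> I) (J \<times> J) (square_kernel S a) A"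
  shows "form_bounded_on (J \<times> J)
     (square_kernel (S \<times> S) (\<lambda>(s, t) j j'. \<Sum>i\<in>I. cnj (a s i j) * a t i j')) (A * A)"
proof -
  have "form_bounded_on (J \<times> J)
     (\<lambda>x y. \<Sum>z\<in>I\<times>I. cnj (square_kernel S a z x) * square_kernel S a z y) (A * A)"
    using form_bounded_transpose[OF A[folded form_bounded_cnj[of _ _ "square_kernel S a"]]] A fin
    by (intro form_bounded_comp) auto
  moreover have "(\<Sum>z\<in>I\<times>I. cnj (square_kernel S a z x) * square_kernel S a z y)
     = square_kernel (S \<times> S) (\<lambda>(s, t) j j'. \<Sum>i\<in>I. cnj (a s i j) * a t i j') x y" for x y
  proof -
    obtain j j1 l l1 where xy: "x = (j, j1)" "y = (l, l1)" by (cases x, cases y) auto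
    have "(\<Sum>z\<in>I\<times>I. cnj (square_kernel S a z x) * square_kernel S a z y)
      = (\<Sum>i\<in>I. \<Sum>i'\<in>I. \<Sum>s\<in>S. \<Sum>t\<in>S. (cnj (a s i j) * a t i l) * cnj (cnj (a s i' j1) * a t i' l1))"
      unfolding sum_Times by (simp add: xy square_kernel_def sum_product) (simp add: mult_ac)
    also have "\<dots> = (\<Sum>s\<in>S. \<Sum>t\<in>S. \<Sum>i\<in>I. \<Sum>i'\<in>I. (cnj (a s i j) * a t i l) * cnj (cnj (a s i' j1) * a t i' l1))"
      by (subst (2) sum.swap, subst sum.swap, subst (3) sum.swap, subst (2) sum.swap) simp
    also have "\<dots> = square_kernel (S \<times> S) (\<lambda>(s, t) j j'. \<Sum>i\<in>I. cnj (a s i j) * a t i j') x y"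
      unfolding square_kernel_def sum_Times by (simp add: xy sum_product sum_Times)
    finally show ?thesis .
  qed
  ultimately show ?thesis by simp
qed

text \<open>For the families \<open>a\<^sub>s\<^sup>* a\<^sub>t\<close> and \<open>b\<^sub>s\<^sup>* b\<^sub>t\<close> the matrix \<open>S = \<Sum> a\<^sub>s \<otimes> b\<^sub>s\<close> is replaced by \<open>S\<^sup>* S\<close>.\<close>

lemma tensor_kernel_gram:
  "tensor_kernel (S \<times> S) (\<lambda>(s, t) j j'. \<Sum>i\<in>I. cnj (a s i j) * a t i j')
      (\<lambda>(s, t) l l'. \<Sum>k\<in>K. cnj (b s k l) * b t k l') x y
    = (\<Sum>z\<in>I\<times>K. cnj (tensor_kernel S a b z x) * tensor_kernel S a b z y)"
proof -
  obtain j l j' l' where xy: "x = (j, l)" "y = (j', l')" by (cases x, cases y) auto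
  have "(\<Sum>z\<in>I\<times>K. cnj (tensor_kernel S a b z x) * tensor_kernel S a b z y)
    = (\<Sum>i\<in>I. \<Sum>k\<in>K. \<Sum>s\<in>S. \<Sum>t\<in>S. (cnj (a s i j) * a t i j') * (cnj (b s k l) * b t k l'))"
    unfolding sum_Times by (simp add: xy tensor_kernel_def sum_product) (simp add: mult_ac)
  also have "\<dots> = (\<Sum>s\<in>S. \<Sum>t\<in>S. \<Sum>i\<in>I. \<Sum>k\<in>K. (cnj (a s i j) * a t i j') * (cnj (b s k l) * b t k l'))"
    by (subst (2) sum.swap, subst sum.swap, subst (3) sum.swap, subst (2) sum.swap) simp
  finally show ?thesis
    by (simp add: xy tensor_kernel_def sum_Times sum_product)
qed

text \<open>Passing to products squares \<open>A\<close>, \<open>B\<close> and the norm of \<open>S\<close>, but not the constant \<open>c\<close>, which may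
  therefore be replaced by its square root. The families are indexed by natural numbers because
  the hypothesis is needed for one type of indices that also encodes pairs.\<close>

lemma tensor_kernel_improve:
  fixes a :: "nat \<Rightarrow> 'i \<Rightarrow> 'j \<Rightarrow> complex" and b :: "nat \<Rightarrow> 'k \<Rightarrow> 'l \<Rightarrow> complex"
  assumes hyp: "\<And>S a b A B. finite S \<Longrightarrow>
      form_bounded_on (J \<times> J) (square_kernel S a) A \<Longrightarrow>
      form_bounded_on (L \<times> L) (square_kernel S b) B \<Longrightarrow>
      form_bounded_on (J \<times> L) (tensor_kernel (S :: nat set) a b) (c * sqrt (A * B))"
    and fin: "finite S" "finite I" "finite J" "finite K" "finite L"
    and A: "form_bounded (I \<times> I) (J \<times> J) (square_kernel S a) A"
    and B: "form_bounded (K \<times> K) (L \<times> L) (square_kernel S b) B"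
  shows "form_bounded (I \<times> K) (J \<times> L) (tensor_kernel S a b) (sqrt c * sqrt (A * B))"
proof -
  define a' where "a' = (\<lambda>(s, t) j j'. \<Sum>i\<in>I. cnj (a s i j) * a t i j')"
  define b' where "b' = (\<lambda>(s, t) l l'. \<Sum>k\<in>K. cnj (b s k l) * b t k l')"
  let ?S = "prod_encode ` (S \<times> S)"
  have inj: "inj_on prod_encode (S \<times> S)" using inj_prod_encode inj_on_subset by blast
  have sq: "square_kernel ?S (\<lambda>s. c (prod_decode s)) = square_kernel (S \<times> S) c" for c :: "_ \<Rightarrow> 'z \<Rightarrow> 'z \<Rightarrow> _"
    unfolding square_kernel_def by (simp add: sum.reindex[OF inj])
  have te: "tensor_kernel ?S (\<lambda>s. a' (prod_decode s)) (\<lambda>s. b' (prod_decode s)) = tensor_kernel (S \<times> S) a' b'"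
    unfolding tensor_kernel_def by (simp add: sum.reindex[OF inj])
  have "form_bounded_on (J \<times> L) (tensor_kernel ?S (\<lambda>s. a' (prod_decode s)) (\<lambda>s. b' (prod_decode s)))
      (c * sqrt ((A * A) * (B * B)))"
    by (rule hyp; (unfold sq)?)
      (use fin square_kernel_gram[OF _ _ A] square_kernel_gram[OF _ _ B] in \<open>simp_all add: a'_def b'_def\<close>)
  also have "sqrt ((A * A) * (B * B)) = A * B"
    using form_bounded_nonneg[OF A] form_bounded_nonneg[OF B] by (simp add: real_sqrt_mult)
  finally have "form_bounded_on (J \<times> L)
      (\<lambda>x y. \<Sum>z\<in>I\<times>K. cnj (tensor_kernel S a b z x) * tensor_kernel S a b z y) (c * (A * B))"
    unfolding te unfolding a'_def b'_def tensor_kernel_gram[abs_def] .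
  then have "form_bounded (I \<times> K) (J \<times> L) (tensor_kernel S a b) (sqrt (c * (A * B)))"
    using fin by (intro form_bounded_squareI) auto
  then show ?thesis by (simp add: real_sqrt_mult)
qed

text \<open>The inequality of Haagerup and Pisier: the constant of the crude bound, replaced by its square
  root again and again, tends to \<open>1\<close>.\<close>

theorem tensor_kernel_cauchy_schwarz:
  fixes a :: "nat \<Rightarrow> 'i \<Rightarrow> 'j \<Rightarrow> complex" and b :: "nat \<Rightarrow> 'k \<Rightarrow> 'l \<Rightarrow> complex"
  assumes fin: "finite S" "finite I" "finite J" "finite K" "finite L"
    and A: "form_bounded (I \<times> I) (J \<times> J) (square_kernel S a) A"
    and B: "form_bounded (K \<times> K) (L \<times> L) (square_kernel S b) B"
  shows "form_bounded (I \<times> K) (J \<times> L) (tensor_kernel S a b) (sqrt (A * B))"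
proof -
  define Q where "Q c \<longleftrightarrow> (\<forall>S a b A B. finite S \<longrightarrow>
      form_bounded_on (J \<times> J) (square_kernel S a) A \<longrightarrow>
      form_bounded_on (L \<times> L) (square_kernel S b) B \<longrightarrow>
      form_bounded_on (J \<times> L) (tensor_kernel (S :: nat set) a b) (c * sqrt (A * B)))" for c
  \<comment> \<open>The successor makes \<open>N\<close> positive, so that its roots tend to \<open>1\<close>.\<close>
  define N where "N = Suc (card (J \<times> L))"
  have Qk: "Q (root (2 ^ k) (real N * real N))" for k
  proof (induction k)
    case 0
    have "real (card (J \<times> L)) * real (card (J \<times> L)) * z \<le> real N * real N * z" if "z \<ge> 0" for z
      using that by (intro mult_right_mono mult_mono) (auto simp: N_def)
    moreover have "A * B \<ge> 0" if "form_bounded_on (J \<times> J) (square_kernel S a) A"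
      "form_bounded_on (L \<times> L) (square_kernel S b) B" for A B a b and S :: "nat set"
      using that by (meson form_bounded_nonneg mult_nonneg_nonneg)
    ultimately show ?case unfolding Q_def using fin
      by (auto intro!: form_bounded_mono[OF tensor_kernel_crude])
  next
    case (Suc k)
    have "Q (sqrt (root (2 ^ k) (real N * real N)))"
      unfolding Q_def by (intro allI impI tensor_kernel_improve) (use Suc fin in \<open>auto simp: Q_def\<close>)
    also have "sqrt (root (2 ^ k) (real N * real N)) = root (2 ^ Suc k) (real N * real N)"
      by (simp add: sqrt_def real_root_mult_exp)
    finally show ?case .
  qed
  have "(\<lambda>k. root (2 ^ k) (real N * real N)) \<longlonglongrightarrow> 1"
  proof -
    have "filterlim (\<lambda>k::nat. (2::nat) ^ k) sequentially sequentially"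
      by (rule filterlim_subseq) (simp add: strict_mono_def)
    moreover have "(\<lambda>n. root n (real N * real N)) \<longlonglongrightarrow> 1"
      by (rule LIMSEQ_root_const) (simp add: N_def)
    ultimately show ?thesis by (rule filterlim_compose[rotated])
  qed
  note lim = this
  have "Q 1" unfolding Q_def
  proof (intro allI impI)
    fix S :: "nat set" and a :: "nat \<Rightarrow> 'j \<Rightarrow> 'j \<Rightarrow> complex" and b :: "nat \<Rightarrow> 'l \<Rightarrow> 'l \<Rightarrow> complex" and A B
    assume *: "finite S" "form_bounded_on (J \<times> J) (square_kernel S a) A"
      "form_bounded_on (L \<times> L) (square_kernel S b) B"
    show "form_bounded_on (J \<times> L) (tensor_kernel S a b) (1 * sqrt (A * B))"
    proof (rule form_bounded_tendsto[where F = sequentially])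
      show "\<forall>\<^sub>F k in sequentially. form_bounded_on (J \<times> L) (tensor_kernel S a b)
          (root (2 ^ k) (real N * real N) * sqrt (A * B))"
        using Qk * unfolding Q_def by (intro always_eventually allI) blast
      show "(\<lambda>k. root (2 ^ k) (real N * real N) * sqrt (A * B)) \<longlonglongrightarrow> 1 * sqrt (A * B)"
        by (intro tendsto_intros lim)
    qed simp_all
  qed
  then have "form_bounded (I \<times> K) (J \<times> L) (tensor_kernel S a b) (sqrt 1 * sqrt (A * B))"
    by (intro tensor_kernel_improve fin A B) (auto simp: Q_def)
  then show ?thesis by simp
qed

section \<open>Parrott's theorem and the extension of Hankel kernels\<close>

lemma finite_linear_system:
  fixes M :: "'i \<Rightarrow> 'i \<Rightarrow> complex"
  assumes fin: "finite I" and inj: "\<And>w. (\<And>i. i \<in> I \<Longrightarrow> (\<Sum>j\<in>I. M i j * w j) = 0) \<Longrightarrow> (\<And>i. i \<in> I \<Longrightarrow> w i = 0)"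
  obtains w where "\<And>i. i \<in> I \<Longrightarrow> (\<Sum>j\<in>I. M i j * w j) = b i"
proof -
  define n where "n = card I"
  obtain h where h: "bij_betw h {0..<n} I" using ex_bij_betw_nat_finite[OF fin] n_def by auto
  define g where "g = the_inv_into {0..<n} h"
  have g: "g i < n" "h (g i) = i" if "i \<in> I" for i
    using that bij_betwE[OF bij_betw_the_inv_into[OF h]] f_the_inv_into_f[of h "{0..<n}" i] h
    by (auto simp: g_def bij_betw_def)
  have gh: "g (h r) = r" if "r < n" for r
    using that h by (auto simp: g_def bij_betw_def the_inv_into_f_f)
  have sum: "(\<Sum>j\<in>I. F j) = (\<Sum>c\<in>{0..<n}. F (h c))" for F :: "'i \<Rightarrow> complex"
    using sum.reindex_bij_betw[OF h, of F] by simp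
  define A where "A = mat n n (\<lambda>(r, c). M (h r) (h c))"
  have A: "A \<in> carrier_mat n n" by (simp add: A_def)
  have Av: "(A *\<^sub>v v) $ r = (\<Sum>j\<in>I. M (h r) j * (v $ g j))" if "v \<in> carrier_vec n" "r < n" for v r
    using that by (simp add: A_def scalar_prod_def sum gh)
  have "det A \<noteq> 0"
  proof
    assume "det A = 0"
    then obtain v where v: "v \<in> carrier_vec n" "v \<noteq> 0\<^sub>v n" "A *\<^sub>v v = 0\<^sub>v n"
      using det_0_iff_vec_prod_zero_field[OF A] by auto
    have "v $ g i = 0" if "i \<in> I" for i
    proof (rule inj[OF _ that])
      fix i assume i: "i \<in> I"
      show "(\<Sum>j\<in>I. M i j * v $ g j) = 0" using Av[OF v(1) g(1)[OF i]] v(3) g[OF i] by simp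
    qed
    then have "v $ r = 0" if "r < n" for r using that bij_betwE[OF h] gh[OF that] by force
    then have "v = 0\<^sub>v n" using v(1) by (intro eq_vecI) auto
    then show False using v by simp
  qed
  define B where "B = (1 / det A) \<cdot>\<^sub>m adj_mat A"
  have B: "B \<in> carrier_mat n n" using adj_mat(1)[OF A] by (simp add: B_def)
  have "A * B = (1 / det A) \<cdot>\<^sub>m (A * adj_mat A)"
    unfolding B_def by (rule mult_smult_distrib[OF A adj_mat(1)[OF A]])
  also have "\<dots> = 1\<^sub>m n"
    unfolding adj_mat(2)[OF A] using \<open>det A \<noteq> 0\<close> by (intro eq_matI) auto
  finally have AB: "A * B = 1\<^sub>m n" .
  define v where "v = B *\<^sub>v vec n (\<lambda>r. b (h r))"
  have v: "v \<in> carrier_vec n" using B by (simp add: v_def)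
  have "A *\<^sub>v v = (A * B) *\<^sub>v vec n (\<lambda>r. b (h r))"
    unfolding v_def by (rule assoc_mult_mat_vec[OF A B, symmetric]) (rule vec_carrier)
  also have "\<dots> = vec n (\<lambda>r. b (h r))"
    unfolding AB by (rule one_mult_mat_vec) (rule vec_carrier)
  finally have Avb: "A *\<^sub>v v = vec n (\<lambda>r. b (h r))" .
  have "(\<Sum>j\<in>I. M i j * v $ g j) = b i" if "i \<in> I" for i
    using Av[OF v g(1)[OF that]] g[OF that] unfolding Avb by simp
  then show ?thesis by (rule that)
qed

lemma l2norm_add_power2:
  "(l2norm I (\<lambda>i. p i + q i))\<^sup>2 = (l2norm I p)\<^sup>2 + 2 * Re (\<Sum>i\<in>I. p i * cnj (q i)) + (l2norm I q)\<^sup>2"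
  unfolding l2norm_power2 Re_sum sum_distrib_left sum.distrib[symmetric]
  by (intro sum.cong refl) (simp only: cmod_power2, simp add: power2_eq_square algebra_simps)

lemma l2norm_insert_power2:
  "finite I \<Longrightarrow> i \<notin> I \<Longrightarrow> (l2norm (insert i I) x)\<^sup>2 = (cmod (x i))\<^sup>2 + (l2norm I x)\<^sup>2"
  by (simp add: l2norm_power2)

definition set_entry :: "('i \<Rightarrow> 'j \<Rightarrow> complex) \<Rightarrow> 'i \<Rightarrow> 'j \<Rightarrow> complex \<Rightarrow> 'i \<Rightarrow> 'j \<Rightarrow> complex" where
  "set_entry a i0 j0 z = (\<lambda>i j. if i = i0 \<and> j = j0 then z else a i j)"

text \<open>Write the matrix as \<open>A\<close> with the new column \<open>b\<close>, the new row \<open>c\<close> and the corner \<open>z\<close>. If \<open>w\<close> solves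
  \<open>w - A A\<^sup>* w = b\<close> then \<open>z = - c A\<^sup>* w\<close> is a solution. Indeed, for the argument with components \<open>x\<close>
  and \<open>s\<close> put \<open>u = x - s A\<^sup>* w\<close>; the image has the components \<open>A u + s w\<close> and \<open>c u\<close>, and expanding the
  squares leaves the condition \<open>t \<le> 1\<close> for \<open>t = \<parallel>w\<parallel>\<^sup>2 - \<parallel>A\<^sup>* w\<parallel>\<^sup>2\<close>. As \<open>t\<close> is the inner product of \<open>b\<close>
  and \<open>w\<close>, the bound for the adjoint of the first row at \<open>w\<close> says \<open>t\<^sup>2 \<le> t\<close>.\<close>

lemma parrott_strict_contraction:
  assumes fin: "finite I" "finite J" and new: "i0 \<notin> I" "j0 \<notin> J" and r: "r < 1"
    and row: "form_bounded I (insert j0 J) a r" and col: "form_bounded (insert i0 I) J a r"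
  obtains z where "form_bounded (insert i0 I) (insert j0 J) (set_entry a i0 j0 z) 1"
proof -
  have r0: "0 \<le> r" using form_bounded_nonneg[OF row] .
  have core: "form_bounded I J a r" by (rule form_bounded_subset[OF row]) auto
  have adj: "form_bounded (insert j0 J) I (\<lambda>j i. cnj (a i j)) r"
    using form_bounded_transpose[OF row] form_bounded_cnj[of "insert j0 J" I "\<lambda>j i. a i j" r] by simp
  define ad where "ad w j = (\<Sum>i\<in>I. cnj (a i j) * w i)" for w j
  have ad_norm: "l2norm (insert j0 J) (ad w) \<le> r * l2norm I w" for w
    unfolding ad_def using form_bounded_apply[OF adj] fin by simp
  have ad_norm': "l2norm J (ad w) \<le> r * l2norm I w" for w
    by (rule order_trans[OF l2norm_mono_set ad_norm]) (use fin in auto)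
  \<comment> \<open>The matrix of \<open>1 - A A\<^sup>*\<close>.\<close>
  define M where "M i i' = (if i = i' then 1 else 0) - (\<Sum>j\<in>J. a i j * cnj (a i' j))" for i i'
  have M: "(\<Sum>i'\<in>I. M i i' * w i') = w i - (\<Sum>j\<in>J. a i j * ad w j)" if "i \<in> I" for i w
  proof -
    have "(\<Sum>i'\<in>I. (if i = i' then 1 else 0) * w i') = (\<Sum>i'\<in>I. if i = i' then w i' else 0)"
      by (intro sum.cong) auto
    also have "\<dots> = w i" using that fin by simp
    finally have 1: "(\<Sum>i'\<in>I. (if i = i' then 1 else 0) * w i') = w i" .
    have "(\<Sum>i'\<in>I. (\<Sum>j\<in>J. a i j * cnj (a i' j)) * w i') = (\<Sum>j\<in>J. a i j * ad w j)"
      unfolding ad_def sum_distrib_left sum_distrib_right by (subst sum.swap) (simp add: mult_ac)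
    with 1 show ?thesis by (simp add: M_def left_diff_distrib sum_subtractf)
  qed
  have "w i = 0" if *: "\<And>i. i \<in> I \<Longrightarrow> (\<Sum>i'\<in>I. M i i' * w i') = 0" and i: "i \<in> I" for w i
  proof -
    have "l2norm I w = l2norm I (\<lambda>i. \<Sum>j\<in>J. a i j * ad w j)"
      using * M by (intro l2norm_cong) auto
    also have "\<dots> \<le> r * l2norm J (ad w)" using form_bounded_apply[OF core] fin by simp
    also have "\<dots> \<le> r * (r * l2norm I w)" using r0 by (intro mult_left_mono ad_norm')
    finally have "l2norm I w \<le> (r * r) * l2norm I w" by (simp add: mult.assoc)
    moreover have "r * r < 1" using r r0 mult_strict_mono[of r 1 r 1] by simp
    ultimately have "\<not> l2norm I w > 0"
      using mult_strict_right_mono[of "r * r" 1 "l2norm I w"] by auto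
    then have "l2norm I w = 0" using l2norm_nonneg[of I w] by linarith
    then show ?thesis using l2norm_zero_iff fin i by blast
  qed
  then obtain w where w: "\<And>i. i \<in> I \<Longrightarrow> (\<Sum>i'\<in>I. M i i' * w i') = a i j0"
    using finite_linear_system[OF fin(1), of M "\<lambda>i. a i j0"] by blast
  define v where "v = ad w"
  have b: "a i j0 = w i - (\<Sum>j\<in>J. a i j * v j)" if "i \<in> I" for i
    using w[OF that] M[OF that] by (simp add: v_def)
  define z where "z = - (\<Sum>j\<in>J. a i0 j * v j)"
  define t where "t = (l2norm I w)\<^sup>2 - (l2norm J v)\<^sup>2"
  have pair: "(\<Sum>i\<in>I. (\<Sum>j\<in>J. a i j * x j) * cnj (w i)) = (\<Sum>j\<in>J. x j * cnj (v j))" for x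
    unfolding v_def ad_def sum_distrib_right sum_distrib_left cnj_sum
    by (subst sum.swap) (simp add: mult_ac)
  have norm: "(\<Sum>i\<in>I. f i * cnj (f i)) = of_real ((l2norm I f)\<^sup>2)" for I :: "'z set" and f
    unfolding l2norm_power2 of_real_sum by (simp add: complex_norm_square[symmetric])
  have "(\<Sum>i\<in>I. a i j0 * cnj (w i)) = (\<Sum>i\<in>I. w i * cnj (w i)) - (\<Sum>i\<in>I. (\<Sum>j\<in>J. a i j * v j) * cnj (w i))"
    using b by (simp add: left_diff_distrib sum_subtractf)
  also have "\<dots> = of_real t" unfolding pair norm t_def by simp
  finally have bt: "(\<Sum>i\<in>I. a i j0 * cnj (w i)) = of_real t" .
  have "ad w j0 = cnj (of_real t)" unfolding bt[symmetric] ad_def by (simp add: mult_ac)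
  then have "(cmod (ad w j0))\<^sup>2 = t\<^sup>2" by simp
  moreover have "(l2norm (insert j0 J) (ad w))\<^sup>2 \<le> (l2norm I w)\<^sup>2"
    using ad_norm[of w] r mult_right_mono[of r 1 "l2norm I w"] by (intro power_mono) auto
  ultimately have "t\<^sup>2 \<le> t" using fin new by (simp add: l2norm_insert_power2 t_def v_def)
  have t1: "t \<le> 1"
  proof (rule ccontr)
    assume "\<not> t \<le> 1"
    then have "1 * t < t * t" by (intro mult_strict_right_mono) auto
    then show False using \<open>t\<^sup>2 \<le> t\<close> by (simp add: power2_eq_square)
  qed
  have "form_bounded (insert i0 I) (insert j0 J) (set_entry a i0 j0 z) 1"
  proof (rule form_bounded_applyI)
    fix x :: "_ \<Rightarrow> complex"
    define s where "s = x j0"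
    define u where "u j = x j - s * v j" for j
    let ?y = "\<lambda>i. \<Sum>j\<in>insert j0 J. set_entry a i0 j0 z i j * x j"
    have y0: "?y i0 = (\<Sum>j\<in>J. a i0 j * u j)"
    proof -
      have "(\<Sum>j\<in>J. set_entry a i0 j0 z i0 j * x j) = (\<Sum>j\<in>J. a i0 j * x j)"
        using new by (intro sum.cong) (auto simp: set_entry_def)
      then have "?y i0 = z * s + (\<Sum>j\<in>J. a i0 j * x j)"
        using fin new by (simp add: set_entry_def s_def)
      also have "(\<Sum>j\<in>J. a i0 j * x j) = (\<Sum>j\<in>J. a i0 j * u j) + s * (\<Sum>j\<in>J. a i0 j * v j)"
        unfolding u_def sum_distrib_left sum.distrib[symmetric] by (intro sum.cong) (simp_all add: algebra_simps)
      finally show ?thesis by (simp add: z_def)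
    qed
    have yi: "?y i = (\<Sum>j\<in>J. a i j * u j) + s * w i" if "i \<in> I" for i
    proof -
      have "(\<Sum>j\<in>J. set_entry a i0 j0 z i j * x j) = (\<Sum>j\<in>J. a i j * x j)"
        using new that by (intro sum.cong) (auto simp: set_entry_def)
      moreover have "set_entry a i0 j0 z i j0 = a i j0" using that new by (auto simp: set_entry_def)
      ultimately have "?y i = a i j0 * s + (\<Sum>j\<in>J. a i j * x j)"
        using fin new by (simp add: s_def)
      also have "(\<Sum>j\<in>J. a i j * x j) = (\<Sum>j\<in>J. a i j * u j) + s * (\<Sum>j\<in>J. a i j * v j)"
        unfolding u_def sum_distrib_left sum.distrib[symmetric] by (intro sum.cong) (simp_all add: algebra_simps)
      finally show ?thesis unfolding b[OF that] by (simp add: algebra_simps)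
    qed
    have "(l2norm (insert i0 I) ?y)\<^sup>2 = (cmod (\<Sum>j\<in>J. a i0 j * u j))\<^sup>2
        + (l2norm I (\<lambda>i. (\<Sum>j\<in>J. a i j * u j) + s * w i))\<^sup>2"
      unfolding l2norm_insert_power2[OF fin(1) new(1)] y0 by (simp add: yi cong: l2norm_cong)
    also have "\<dots> = (l2norm (insert i0 I) (\<lambda>i. \<Sum>j\<in>J. a i j * u j))\<^sup>2
        + 2 * Re (\<Sum>i\<in>I. (\<Sum>j\<in>J. a i j * u j) * cnj (s * w i)) + (cmod s)\<^sup>2 * (l2norm I w)\<^sup>2"
      unfolding l2norm_add_power2 l2norm_scale l2norm_insert_power2[OF fin(1) new(1)]
      by (simp add: power_mult_distrib)
    also have "(\<Sum>i\<in>I. (\<Sum>j\<in>J. a i j * u j) * cnj (s * w i)) = (\<Sum>j\<in>J. u j * cnj (s * v j))"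
      using pair[of "\<lambda>j. cnj s * u j"] by (simp add: sum_distrib_left mult_ac)
    also have "(l2norm (insert i0 I) (\<lambda>i. \<Sum>j\<in>J. a i j * u j))\<^sup>2 \<le> (l2norm J u)\<^sup>2"
      using form_bounded_apply[OF col, of u] fin r mult_right_mono[of r 1 "l2norm J u"] by (intro power_mono) auto
    finally have "(l2norm (insert i0 I) ?y)\<^sup>2
      \<le> (l2norm J u)\<^sup>2 + 2 * Re (\<Sum>j\<in>J. u j * cnj (s * v j)) + (cmod s)\<^sup>2 * (l2norm J v)\<^sup>2 + (cmod s)\<^sup>2 * t"
      by (simp add: t_def algebra_simps)
    also have "\<dots> = (l2norm J (\<lambda>j. u j + s * v j))\<^sup>2 + (cmod s)\<^sup>2 * t"
      unfolding l2norm_add_power2 l2norm_scale by (simp add: power_mult_distrib)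
    also have "(\<lambda>j. u j + s * v j) = x" by (simp add: u_def)
    also have "(l2norm J x)\<^sup>2 + (cmod s)\<^sup>2 * t \<le> (l2norm (insert j0 J) x)\<^sup>2"
      unfolding l2norm_insert_power2[OF fin(2) new(2)] s_def[symmetric]
      using t1 mult_left_mono[of t 1 "(cmod s)\<^sup>2"] by simp
    finally have "l2norm (insert i0 I) ?y \<le> l2norm (insert j0 J) x"
      by (rule power2_le_imp_le) simp
    then show "l2norm (insert i0 I) ?y \<le> 1 * l2norm (insert j0 J) x" by simp
  qed (use fin in auto)
  then show ?thesis by (rule that)
qed

lemma parrott_finite:
  assumes fin: "finite I" "finite J" and new: "i0 \<notin> I" "j0 \<notin> J" and r: "r < C"
    and row: "form_bounded I (insert j0 J) a r" and col: "form_bounded (insert i0 I) J a r"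
  obtains z where "form_bounded (insert i0 I) (insert j0 J) (set_entry a i0 j0 z) C"
proof -
  have C: "C > 0" using form_bounded_nonneg[OF row] r by simp
  let ?c = "complex_of_real (1 / C)"
  have c: "cmod ?c * r = r / C" using C by (simp add: norm_divide)
  obtain z where z: "form_bounded (insert i0 I) (insert j0 J) (set_entry (\<lambda>i j. ?c * a i j) i0 j0 z) 1"
  proof (rule parrott_strict_contraction[OF fin new])
    show "r / C < 1" using r C by simp
    show "form_bounded I (insert j0 J) (\<lambda>i j. ?c * a i j) (r / C)"
      using form_bounded_scale[OF row, of ?c] unfolding c .
    show "form_bounded (insert i0 I) J (\<lambda>i j. ?c * a i j) (r / C)"
      using form_bounded_scale[OF col, of ?c] unfolding c .
  qed
  have "form_bounded (insert i0 I) (insert j0 J)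
      (\<lambda>i j. of_real C * set_entry (\<lambda>i j. ?c * a i j) i0 j0 z i j) (cmod (of_real C) * 1)"
    by (rule form_bounded_scale[OF z])
  moreover have "(\<lambda>i j. of_real C * set_entry (\<lambda>i j. ?c * a i j) i0 j0 z i j) = set_entry a i0 j0 (of_real C * z)"
    using C by (auto simp: set_entry_def fun_eq_iff)
  ultimately show ?thesis using that[of "of_real C * z"] C by simp
qed

text \<open>For finite sections and bounds larger than \<open>C\<close> the admissible corners form nonempty compact sets,
  any finitely many of which contain a common one. So all of them intersect.\<close>

theorem parrott:
  assumes new: "i0 \<notin> I" "j0 \<notin> J"
    and row: "form_bounded I (insert j0 J) a C" and col: "form_bounded (insert i0 I) J a C"
  obtains z where "form_bounded (insert i0 I) (insert j0 J) (set_entry a i0 j0 z) C"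
proof -
  \<comment> \<open>The slack \<open>1 / (n + 1)\<close> makes the strict version applicable.\<close>
  define T where "T = (\<lambda>(I', J', n). {z. form_bounded (insert i0 I') (insert j0 J') (set_entry a i0 j0 z) (C + 1 / real (Suc n))})"
  define X where "X = {(I', J', n :: nat). finite I' \<and> finite J' \<and> I' \<subseteq> I \<and> J' \<subseteq> J}"
  have C: "C \<ge> 0" using form_bounded_nonneg[OF row] .
  have bd: "z \<in> cball 0 (C + 1)" if "z \<in> T (I', J', n)" for z I' J' n
  proof -
    have "cmod z \<le> C + 1 / real (Suc n)"
      using form_bounded_entry[of "insert i0 I'" "insert j0 J'" "set_entry a i0 j0 z" _ i0 j0] that
      by (simp add: T_def set_entry_def)
    also have "\<dots> \<le> C + 1" by simp
    finally show ?thesis by simp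
  qed
  have ne: "T (I', J', n) \<noteq> {}" if *: "finite I'" "finite J'" "I' \<subseteq> I" "J' \<subseteq> J" for I' J' n
  proof -
    obtain z where "form_bounded (insert i0 I') (insert j0 J') (set_entry a i0 j0 z) (C + 1 / real (Suc n))"
    proof (rule parrott_finite)
      show "form_bounded I' (insert j0 J') a C" by (rule form_bounded_subset[OF row]) (use * in auto)
      show "form_bounded (insert i0 I') J' a C" by (rule form_bounded_subset[OF col]) (use * in auto)
    qed (use * new in auto)
    then show ?thesis by (auto simp: T_def)
  qed
  have "cball 0 (C + 1) \<inter> \<Inter>(T ` X) \<noteq> {}"
  proof (rule compact_imp_fip_image)
    show "closed (T x)" for x
    proof -
      obtain I' J' n where x: "x = (I', J', n)" by (cases x) auto
      show ?thesis unfolding closed_sequential_limits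
      proof (intro allI impI, elim conjE)
        fix z l assume z: "\<forall>n. z n \<in> T x" "z \<longlonglongrightarrow> l"
        have "((\<lambda>n. set_entry a i0 j0 (z n) i j) \<longlonglongrightarrow> set_entry a i0 j0 l i j)" for i j
          using z(2) by (cases "i = i0 \<and> j = j0") (auto simp: set_entry_def)
        then show "l \<in> T x" using z(1) unfolding x T_def
          by (auto intro!: form_bounded_tendsto[where F = sequentially and a = "\<lambda>k. set_entry a i0 j0 (z k)" and C = "\<lambda>_. C + 1 / real (Suc n)"])
      qed
    qed
    fix X' assume X': "finite X'" "X' \<subseteq> X"
    define I1 where "I1 = (\<Union>x\<in>X'. fst x)"
    define J1 where "J1 = (\<Union>x\<in>X'. fst (snd x))"
    define m where "m = (\<Sum>x\<in>X'. snd (snd x))"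
    obtain z where z: "z \<in> T (I1, J1, m)"
      using ne[of I1 J1 m] X' by (fastforce simp: I1_def J1_def X_def)
    have "z \<in> T x" if "x \<in> X'" for x
    proof -
      obtain I' J' n where x: "x = (I', J', n)" by (cases x) auto
      have "I' \<subseteq> I1" "J' \<subseteq> J1" "n \<le> m"
        using that X'(1) member_le_sum[of x X' "\<lambda>x. snd (snd x)"] by (force simp: I1_def J1_def m_def x)+
      then have "form_bounded (insert i0 I') (insert j0 J') (set_entry a i0 j0 z) (C + 1 / real (Suc m))"
        using z by (auto simp: T_def intro: form_bounded_subset)
      moreover have "C + 1 / real (Suc m) \<le> C + 1 / real (Suc n)" using \<open>n \<le> m\<close> by (simp add: frac_le)
      ultimately show ?thesis unfolding x T_def using form_bounded_mono by blast
    qed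
    then show "cball 0 (C + 1) \<inter> \<Inter>(T ` X') \<noteq> {}" using bd[OF z] by blast
  qed simp
  then obtain z where z: "\<And>x. x \<in> X \<Longrightarrow> z \<in> T x" by blast
  have "form_bounded (insert i0 I) (insert j0 J) (set_entry a i0 j0 z) C"
  proof (rule form_bounded_eps)
    fix e :: real assume "e > 0"
    then obtain n where n: "1 / real (Suc n) < e" using nat_approx_posE by blast
    show "form_bounded (insert i0 I) (insert j0 J) (set_entry a i0 j0 z) (C + e)"
      unfolding form_bounded_def
    proof (intro conjI allI impI)
      fix I' J' and y x :: "_ \<Rightarrow> complex"
      assume *: "finite I'" "finite J'" "I' \<subseteq> insert i0 I" "J' \<subseteq> insert j0 J"
      have "z \<in> T (I' - {i0}, J' - {j0}, n)" by (rule z) (use * in \<open>auto simp: X_def\<close>)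
      then have "form_bounded (insert i0 I') (insert j0 J') (set_entry a i0 j0 z) (C + e)"
        using n by (auto simp: T_def intro: form_bounded_mono)
      then show "cmod (kernel_form I' J' (set_entry a i0 j0 z) y x) \<le> (C + e) * l2norm I' y * l2norm J' x"
        by (rule form_boundedD) (use * in auto)
    qed (use C \<open>e > 0\<close> in auto)
  qed
  then show ?thesis by (rule that)
qed

lemma parrott_row:
  assumes "finite V" "u \<notin> I" "J \<inter> V = {}"
    and "form_bounded I (J \<union> V) a C" "form_bounded (insert u I) J a C"
  shows "\<exists>a'. (\<forall>i j. \<not> (i = u \<and> j \<in> V) \<longrightarrow> a' i j = a i j) \<and> form_bounded (insert u I) (J \<union> V) a' C"
  using assms
proof (induction V rule: finite_induct)
  case empty
  then show ?case by auto
next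
  case (insert v V)
  have "form_bounded I (J \<union> V) a C" using insert by (auto intro: form_bounded_subset)
  then obtain a' where a': "\<And>i j. \<not> (i = u \<and> j \<in> V) \<Longrightarrow> a' i j = a i j" "form_bounded (insert u I) (J \<union> V) a' C"
    using insert by auto
  have "form_bounded I (insert v (J \<union> V)) a C" using insert by simp
  then have "form_bounded I (insert v (J \<union> V)) a' C"
    using insert.prems(1) by (subst form_bounded_cong[where b = a]) (auto intro!: a'(1))
  then obtain z where "form_bounded (insert u I) (insert v (J \<union> V)) (set_entry a' u v z) C"
    using parrott[of u I v "J \<union> V" a' C] a'(2) insert by auto
  then show ?case using a'(1) by (intro exI[of _ "set_entry a' u v z"]) (auto simp: set_entry_def)
qed

text \<open>A finite corner is filled entry by entry: at each entry the row and the column in question are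
  already known up to that entry.\<close>

lemma parrott_block:
  assumes "finite U" "finite V" "I \<inter> U = {}" "J \<inter> V = {}"
    and "form_bounded I (J \<union> V) a C" "form_bounded (I \<union> U) J a C"
  shows "\<exists>a'. (\<forall>i j. \<not> (i \<in> U \<and> j \<in> V) \<longrightarrow> a' i j = a i j) \<and> form_bounded (I \<union> U) (J \<union> V) a' C"
  using assms
proof (induction U rule: finite_induct)
  case empty
  then show ?case by auto
next
  case (insert u U)
  have "form_bounded (I \<union> U) J a C" using insert by (auto intro: form_bounded_subset)
  then obtain a' where a': "\<And>i j. \<not> (i \<in> U \<and> j \<in> V) \<Longrightarrow> a' i j = a i j" "form_bounded (I \<union> U) (J \<union> V) a' C"
    using insert by auto
  have "form_bounded (insert u (I \<union> U)) J a C" using insert by simp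
  then have "form_bounded (insert u (I \<union> U)) J a' C"
    using insert.prems by (subst form_bounded_cong[where b = a]) (auto intro!: a'(1))
  then obtain a'' where a'': "\<And>i j. \<not> (i = u \<and> j \<in> V) \<Longrightarrow> a'' i j = a' i j"
      "form_bounded (insert u (I \<union> U)) (J \<union> V) a'' C"
    using parrott_row[of V u "I \<union> U" J a' C] insert a'(2) by auto
  show ?case using a'(1) a'' by (intro exI[of _ a'']) auto
qed

definition hankel :: "(nat \<Rightarrow> 'a \<Rightarrow> 'b \<Rightarrow> complex) \<Rightarrow> nat \<times> 'a \<Rightarrow> nat \<times> 'b \<Rightarrow> complex" where
  "hankel f = (\<lambda>(p, \<alpha>) (q, \<beta>). f (p + q) \<alpha> \<beta>)"

text \<open>In the Hankel kernel of the sequence with the new first term \<open>X\<close>, the term \<open>X\<close> occurs only at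
  \<open>p = q = 0\<close>, while the rows \<open>p \<ge> 1\<close> and the columns \<open>q \<ge> 1\<close> form the old kernel.\<close>

lemma hankel_extend_left:
  assumes D: "finite D" and f: "form_bounded_on (UNIV \<times> D) (hankel f) C"
  shows "\<exists>X. form_bounded_on (UNIV \<times> D) (hankel (case_nat X f)) C"
proof -
  define a0 where "a0 = hankel (case_nat (\<lambda>_ _. 0) f)"
  let ?I = "{1..} \<times> D" and ?U = "{0::nat} \<times> D"
  have U: "UNIV \<times> D = ?I \<union> ?U" by (auto simp: not_less_eq_eq)
  have 1: "form_bounded ?I (UNIV \<times> D) (\<lambda>i j. hankel f (fst i - 1, snd i) j) C"
    using form_bounded_compress[OF f, of "\<lambda>i. (fst i - 1, snd i)" ?I "\<lambda>j. j" "UNIV \<times> D"]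
    by (force simp: inj_on_def)
  have 2: "form_bounded (UNIV \<times> D) ?I (\<lambda>i j. hankel f i (fst j - 1, snd j)) C"
    using form_bounded_compress[OF f, of "\<lambda>j. j" "UNIV \<times> D" "\<lambda>i. (fst i - 1, snd i)" ?I]
    by (force simp: inj_on_def)
  have "form_bounded ?I (?I \<union> ?U) a0 C"
    using 1 unfolding U[symmetric]
    by (subst form_bounded_cong[where b = "\<lambda>i j. hankel f (fst i - 1, snd i) j"])
      (auto simp: a0_def hankel_def split: nat.split)
  moreover have "form_bounded (?I \<union> ?U) ?I a0 C"
    using 2 unfolding U[symmetric]
    by (subst form_bounded_cong[where b = "\<lambda>i j. hankel f i (fst j - 1, snd j)"])
      (auto simp: a0_def hankel_def split: nat.split)
  ultimately have "\<exists>a'. (\<forall>i j. \<not> (i \<in> ?U \<and> j \<in> ?U) \<longrightarrow> a' i j = a0 i j) \<and>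
      form_bounded_on (?I \<union> ?U) a' C"
    using D by (intro parrott_block) auto
  then obtain a' where a': "\<And>i j. \<not> (i \<in> ?U \<and> j \<in> ?U) \<Longrightarrow> a' i j = a0 i j"
      "form_bounded_on (?I \<union> ?U) a' C" by blast
  have "hankel (case_nat (\<lambda>\<alpha> \<beta>. a' (0, \<alpha>) (0, \<beta>)) f) i j = a' i j" if "i \<in> UNIV \<times> D" "j \<in> UNIV \<times> D" for i j
  proof (cases "fst i = 0 \<and> fst j = 0")
    case True then show ?thesis by (cases i; cases j) (auto simp: hankel_def)
  next
    case False
    then have "a' i j = a0 i j" by (intro a'(1)) (cases i; cases j; auto)
    then show ?thesis using False by (cases i; cases j) (auto simp: hankel_def a0_def split: nat.split)
  qed
  then have "form_bounded_on (UNIV \<times> D) (hankel (case_nat (\<lambda>\<alpha> \<beta>. a' (0, \<alpha>) (0, \<beta>)) f)) C"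
    using a'(2) unfolding U[symmetric] by (subst form_bounded_cong[where b = a']) auto
  then show ?thesis by (rule exI[of _ "\<lambda>\<alpha> \<beta>. a' (0, \<alpha>) (0, \<beta>)"])
qed

text \<open>The two-sided sequence is bounded as a Hankel kernel however far it is shifted to the left.\<close>

theorem hankel_extension:
  assumes D: "finite D" and f: "form_bounded_on (UNIV \<times> D) (hankel f) C"
  obtains \<phi> :: "int \<Rightarrow> 'a \<Rightarrow> 'a \<Rightarrow> complex"
  where "\<And>n. \<phi> (int n) = f n"
    and "\<And>N. form_bounded_on (UNIV \<times> D) (hankel (\<lambda>n. \<phi> (int n - int N))) C"
proof -
  have "\<exists>F. (\<forall>n. form_bounded_on (UNIV \<times> D) (hankel (F n)) C \<and> (n = 0 \<longrightarrow> F n = f)) \<and>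
     (\<forall>n k. F (Suc n) (Suc k) = F n k)"
  proof -
    have "\<exists>F. \<forall>n. (form_bounded_on (UNIV \<times> D) (hankel (F n)) C \<and> (n = 0 \<longrightarrow> F n = f)) \<and>
       (\<forall>k. F (Suc n) (Suc k) = F n k)"
    proof (rule dependent_nat_choice)
      fix g and n :: nat assume "form_bounded_on (UNIV \<times> D) (hankel g) C \<and> (n = 0 \<longrightarrow> g = f)"
      then obtain X where "form_bounded_on (UNIV \<times> D) (hankel (case_nat X g)) C"
        using hankel_extend_left[OF D] by blast
      then show "\<exists>h. (form_bounded_on (UNIV \<times> D) (hankel h) C \<and> (Suc n = 0 \<longrightarrow> h = f)) \<and> (\<forall>k. h (Suc k) = g k)"
        by (intro exI[of _ "case_nat X g"]) auto
    qed (use f in auto)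
    then show ?thesis by blast
  qed
  then obtain F where F: "\<And>n. form_bounded_on (UNIV \<times> D) (hankel (F n)) C" "F 0 = f"
      "\<And>n k. F (Suc n) (Suc k) = F n k" by blast
  have shift: "F (n + i) (k + i) = F n k" for n i k by (induction i) (simp_all add: F(3))
  define \<phi> where "\<phi> k = (if k \<ge> 0 then f (nat k) else F (nat (- k)) 0)" for k :: int
  have "\<phi> (int k - int n) = F n k" for n k
  proof (cases "k \<ge> n")
    case True
    then show ?thesis using shift[of 0 n "k - n"] by (simp add: \<phi>_def F(2) nat_diff_distrib)
  next
    case False
    then show ?thesis using shift[of "n - k" k 0] by (simp add: \<phi>_def nat_diff_distrib)
  qed
  then have "hankel (\<lambda>k. \<phi> (int k - int n)) = hankel (F n)" for n by simp
  with F(1) show ?thesis by (intro that[of \<phi>]) (simp_all add: \<phi>_def)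
qed

section \<open>Characters and Fourier coefficients on the circle\<close>

lemma space_circle [simp]: "space circle = sphere 0 1"
  by (simp add: circle_def space_restrict_space)

lemma sets_circle [measurable_cong]: "sets circle = sets (restrict_space borel (sphere 0 1))"
  by (simp add: circle_def)

lemma measurable_cis [measurable]:
  "cis \<in> measurable (uniform_measure lborel {0..2 * pi}) (restrict_space borel (sphere 0 1))"
proof (rule measurable_restrict_space2)
  have "cis \<in> borel_measurable borel"
    by (intro borel_measurable_continuous_onI continuous_on_cis continuous_on_id)
  then show "cis \<in> borel_measurable (uniform_measure lborel {0..2 * pi})" by simp
qed (simp add: Pi_I)

lemma integral_circle:
  fixes f :: "complex \<Rightarrow> complex"
  assumes "f \<in> borel_measurable circle"
  shows "(LINT z|circle. f z) = (LINT t|lborel. indicator {0..2 * pi} t *\<^sub>R (f (cis t) / (2 * pi)))"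
proof -
  have f: "f \<in> borel_measurable (restrict_space borel (sphere 0 1))"
    using assms by (simp cong: measurable_cong_sets add: sets_circle)
  have "(LINT z|circle. f z) = (LINT t|uniform_measure lborel {0..2 * pi}. f (cis t))"
    unfolding circle_def by (rule integral_distr[OF measurable_cis f])
  also have "uniform_measure lborel {0..2 * pi} = density lborel (\<lambda>t. ennreal (indicator {0..2 * pi} t / (2 * pi)))"
    unfolding uniform_measure_def
    by (rule arg_cong[where f = "density lborel"])
       (auto simp: fun_eq_iff indicator_def divide_ennreal ennreal_1[symmetric] simp del: ennreal_1)
  also have "(LINT t|\<dots>. f (cis t)) = (LINT t|lborel. (indicator {0..2 * pi} t / (2 * pi)) *\<^sub>R f (cis t))"
  proof (rule integral_density)
    have "(\<lambda>t. f (cis t)) \<in> borel_measurable (uniform_measure lborel {0..2 * pi})"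
      using measurable_compose[OF measurable_cis f] .
    then show "(\<lambda>t. f (cis t)) \<in> borel_measurable lborel" by simp
  qed (auto simp: indicator_def)
  also have "\<dots> = (LINT t|lborel. indicator {0..2 * pi} t *\<^sub>R (f (cis t) / (2 * pi)))"
    by (intro Bochner_Integration.integral_cong refl) (auto simp: indicator_def scaleR_conv_of_real)
  finally show ?thesis .
qed

lemma emeasure_circle: "emeasure circle (space circle) = 1"
proof -
  let ?M = "uniform_measure lborel {0..2 * pi}"
  have "sphere 0 1 \<in> sets (restrict_space borel (sphere (0::complex) 1))"
    using sets.top[of "restrict_space borel (sphere (0::complex) 1)"] by (simp add: space_restrict_space)
  then have "emeasure circle (space circle) = emeasure ?M (cis -` sphere 0 1 \<inter> space ?M)"
    unfolding space_circle unfolding circle_def by (rule emeasure_distr[OF measurable_cis])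
  also have "cis -` sphere 0 1 \<inter> space ?M = UNIV" by auto
  also have "emeasure ?M UNIV = 1" by (simp add: emeasure_uniform_measure divide_ennreal)
  finally show ?thesis .
qed

interpretation circle: finite_measure circle
  by standard (simp add: emeasure_circle[simplified])

lemma measure_circle [simp]: "measure circle (sphere 0 1) = 1"
  using emeasure_circle by (simp add: measure_def)

lemma borel_measurable_powi_circle [measurable]: "(\<lambda>z. z powi n) \<in> borel_measurable circle"
proof -
  have "continuous_on (sphere 0 1) (\<lambda>z::complex. z powi n)" by (intro continuous_intros) auto
  then show ?thesis
    using borel_measurable_continuous_on_restrict by (simp cong: measurable_cong_sets add: sets_circle)
qed

lemma norm_powi_circle [simp]: "cmod z = 1 \<Longrightarrow> cmod (z powi n) = 1"
  by (simp add: norm_power_int)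

lemma powi_add_circle: "cmod z = 1 \<Longrightarrow> z powi (m + n) = z powi m * z powi n"
  by (subst power_int_add) auto

lemma cnj_powi_circle: "cmod z = 1 \<Longrightarrow> cnj (z powi n) = z powi (- n)"
proof -
  assume "cmod z = 1"
  then have "z * cnj z = 1" using complex_norm_square[of z] by simp
  then have "cnj z = inverse z" by (metis inverse_unique)
  then show ?thesis by (simp add: power_int_minus power_int_inverse)
qed

lemma integral_powi_circle: "(LINT z|circle. z powi n) = (if n = 0 then 1 else 0)"
proof (cases "n = 0")
  case False
  define F where "F = (\<lambda>t. cis (of_int n * t) / (\<i> * of_int n * (2 * pi)))"
  have "(LINT z|circle. z powi n) = (LINT t|lborel. indicator {0..2 * pi} t *\<^sub>R (cis t powi n / (2 * pi)))"
    by (rule integral_circle) simp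
  also have "\<dots> = F (2 * pi) - F 0"
  proof (rule integral_FTC_Icc)
    show "continuous_on {0..2 * pi} (\<lambda>t. cis t powi n / (2 * pi))"
      unfolding cis_power_int by (intro continuous_intros) auto
    fix t :: real
    have "((\<lambda>z. exp (\<i> * of_int n * z) / (\<i> * of_int n * (2 * pi))) has_field_derivative
        exp (\<i> * of_int n * of_real t) / (2 * pi)) (at (of_real t))"
      using False by (auto intro!: derivative_eq_intros)
    from has_vector_derivative_real_field[OF this]
    have "(F has_vector_derivative (exp (\<i> * of_int n * of_real t) / (2 * pi))) (at t within {0..2 * pi})"
      by (simp add: F_def cis_conv_exp mult.assoc)
    then show "(F has_vector_derivative (cis t powi n / (2 * pi))) (at t within {0..2 * pi})"
      unfolding cis_power_int by (simp add: cis_conv_exp mult.assoc)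
  qed simp
  also have "F (2 * pi) = F 0"
    using cis_multiple_2pi[of "of_int n"] by (simp add: F_def mult.commute mult.left_commute)
  finally show ?thesis using False by simp
qed simp

lemma integrable_powi_mult_iff:
  "f \<in> borel_measurable circle \<Longrightarrow> integrable circle (\<lambda>z. f z * z powi n) \<longleftrightarrow> integrable circle f"
proof -
  assume [measurable]: "f \<in> borel_measurable circle"
  have "integrable circle (\<lambda>z. f z * z powi n) \<longleftrightarrow> integrable circle (\<lambda>z. cmod (f z * z powi n))"
    by (rule integrable_norm_iff[symmetric]) measurable
  also have "\<dots> \<longleftrightarrow> integrable circle (\<lambda>z. cmod (f z))"
    by (intro Bochner_Integration.integrable_cong) (auto simp: norm_mult)
  also have "\<dots> \<longleftrightarrow> integrable circle f"
    by (rule integrable_norm_iff) measurable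
  finally show ?thesis .
qed

lemma integrable_powi_mult [intro]:
  "integrable circle f \<Longrightarrow> integrable circle (\<lambda>z. f z * z powi n)"
  by (subst integrable_powi_mult_iff) auto

lemma integrable_powi [intro, simp]: "integrable circle (\<lambda>z. z powi n)"
  using integrable_powi_mult[of "\<lambda>_. 1" n] by simp

lemma fourier_cong:
  "(\<And>z. cmod z = 1 \<Longrightarrow> f z = g z) \<Longrightarrow> fourier f n = fourier g n"
  unfolding fourier_def by (intro Bochner_Integration.integral_cong) auto

lemma fourier_add: "integrable circle f \<Longrightarrow> integrable circle g \<Longrightarrow>
    fourier (\<lambda>z. f z + g z) n = fourier f n + fourier g n"
  unfolding fourier_def distrib_right by (intro Bochner_Integration.integral_add integrable_powi_mult)

lemma fourier_diff: "integrable circle f \<Longrightarrow> integrable circle g \<Longrightarrow>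
    fourier (\<lambda>z. f z - g z) n = fourier f n - fourier g n"
  unfolding fourier_def left_diff_distrib by (intro Bochner_Integration.integral_diff integrable_powi_mult)

lemma fourier_cmult: "fourier (\<lambda>z. c * f z) n = c * fourier f n"
  unfolding fourier_def by (simp add: mult.assoc)

lemma fourier_sum: "(\<And>s. s \<in> S \<Longrightarrow> integrable circle (f s)) \<Longrightarrow>
    fourier (\<lambda>z. \<Sum>s\<in>S. f s z) n = (\<Sum>s\<in>S. fourier (f s) n)"
  unfolding fourier_def sum_distrib_right by (intro Bochner_Integration.integral_sum integrable_powi_mult)

lemma fourier_powi_mult: "fourier (\<lambda>z. f z * z powi k) n = fourier f (n - k)"
  unfolding fourier_def
proof (intro Bochner_Integration.integral_cong refl)
  fix z assume "z \<in> space circle"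
  then have "z powi (- (n - k)) = z powi k * z powi (- n)"
    using powi_add_circle[of z k "- n"] by simp
  then show "f z * z powi k * z powi (- n) = f z * z powi (- (n - k))" by simp
qed

lemma fourier_powi: "fourier (\<lambda>z. z powi k) n = (if k = n then 1 else 0)"
  using fourier_powi_mult[of "\<lambda>_. 1" k n] integral_powi_circle[of "k - n"] by (simp add: fourier_def)

lemma fourier_trig: "finite S \<Longrightarrow> inj_on u S \<Longrightarrow>
    fourier (\<lambda>z. \<Sum>s\<in>S. c s * z powi u s) n = (\<Sum>s\<in>S. if u s = n then c s else 0)"
  by (subst fourier_sum) (auto simp: fourier_cmult fourier_powi intro!: sum.cong)

section \<open>Uniqueness of Fourier coefficients\<close>

definition fourier_null :: "(complex \<Rightarrow> complex) \<Rightarrow> bool" where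
  "fourier_null f \<longleftrightarrow> integrable circle f \<and> (\<forall>n. fourier f n = 0)"

lemma fourier_null_cong: "(\<And>z. cmod z = 1 \<Longrightarrow> f z = g z) \<Longrightarrow> fourier_null f \<longleftrightarrow> fourier_null g"
  unfolding fourier_null_def using fourier_cong[of f g] Bochner_Integration.integrable_cong[of circle circle f g] by auto

text \<open>Multiplication by \<open>z\<close> and by its conjugate only shifts Fourier coefficients, so the functions with
  vanishing coefficients are closed under multiplication by polynomials in the real and imaginary
  part.\<close>

lemma fourier_null_polynomial:
  assumes "real_polynomial_function p" "fourier_null f"
  shows "fourier_null (\<lambda>z. of_real (p z) * f z)"
  using assms
proof (induction arbitrary: f rule: real_polynomial_function.induct)
  case (linear h)
  interpret bounded_linear h by fact
  \<comment> \<open>On the circle \<open>Re z\<close> and \<open>Im z\<close> are combinations of \<open>z\<close> and \<open>1/z\<close>.\<close>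
  define a where "a = (of_real (h 1) - \<i> * of_real (h \<i>)) / (2 :: complex)"
  have h: "of_real (h z) = a * z powi 1 + cnj a * z powi (- 1)" if "cmod z = 1" for z
  proof -
    have "h z = h (Re z *\<^sub>R 1 + Im z *\<^sub>R \<i>)" by (rule arg_cong[where f = h]) (simp add: complex_eq_iff)
    also have "\<dots> = Re z * h 1 + Im z * h \<i>" by (simp only: add scaleR real_scaleR_def)
    finally have "h z = Re z * h 1 + Im z * h \<i>" .
    moreover have "z powi (- 1) = cnj z" using cnj_powi_circle[OF that, of 1] by simp
    ultimately show ?thesis by (simp add: a_def complex_eq_iff) (simp add: field_simps)
  qed
  have "fourier_null (\<lambda>z. a * (f z * z powi 1) + cnj a * (f z * z powi (- 1)))"
    using linear.prems integrable_powi_mult[of f 1] integrable_powi_mult[of f "-1"]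
      fourier_powi_mult[of f 1] fourier_powi_mult[of f "-1"]
    unfolding fourier_null_def by (auto simp: fourier_add fourier_cmult)
  then show ?case
    by (rule iffD2[OF fourier_null_cong, rotated]) (simp only: h, simp add: algebra_simps)
next
  case (const c)
  then show ?case by (auto simp: fourier_null_def fourier_cmult)
next
  case (add p q)
  then show ?case by (auto simp: fourier_null_def fourier_add distrib_right)
next
  case (mult p q)
  show ?case using mult.IH(1)[OF mult.IH(2)[OF mult.prems]] by (simp add: mult.assoc)
qed

lemma integrable_mult_bounded_circle:
  fixes f g :: "complex \<Rightarrow> complex"
  assumes "integrable circle f" "g \<in> borel_measurable circle" "AE z in circle. cmod (g z) \<le> C"
  shows "integrable circle (\<lambda>z. g z * f z)"
proof (rule Bochner_Integration.integrable_bound)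
  show "integrable circle (\<lambda>z. C * cmod (f z))" using assms by auto
  show "(\<lambda>z. g z * f z) \<in> borel_measurable circle" using assms by measurable
  show "AE z in circle. cmod (g z * f z) \<le> norm (C * cmod (f z))"
    using assms(3) by eventually_elim (auto simp: norm_mult abs_mult intro!: mult_right_mono)
qed

lemma borel_measurable_circle_continuous:
  fixes g :: "complex \<Rightarrow> 'a :: topological_space"
  shows "continuous_on (sphere 0 1) g \<Longrightarrow> g \<in> borel_measurable circle"
  using borel_measurable_continuous_on_restrict[of "sphere 0 1" g]
  by (simp cong: measurable_cong_sets add: sets_circle)

text \<open>By the theorem of Stone and Weierstrass.\<close>

lemma fourier_null_continuous:
  fixes g :: "complex \<Rightarrow> real"
  assumes f: "fourier_null f" and g: "continuous_on (sphere 0 1) g"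
  shows "(LINT z|circle. of_real (g z) * f z) = 0"
proof -
  have int: "integrable circle f" using f by (simp add: fourier_null_def)
  have int_g: "integrable circle (\<lambda>z. of_real (g z) * f z)" if g: "continuous_on (sphere 0 1) g" for g :: "complex \<Rightarrow> real"
  proof -
    have "bounded (g ` sphere 0 1)" by (intro compact_imp_bounded compact_continuous_image g) simp
    then obtain C where "\<forall>z\<in>sphere 0 1. \<bar>g z\<bar> \<le> C" unfolding bounded_iff by auto
    then show ?thesis using g
      by (intro integrable_mult_bounded_circle[OF int, of _ C]) 
         (auto intro!: borel_measurable_circle_continuous continuous_intros AE_I2)
  qed
  have "cmod (LINT z|circle. of_real (g z) * f z) \<le> e * (LINT z|circle. cmod (f z))" if e: "e > 0" for e
  proof -
    obtain p where p: "real_polynomial_function p" "\<And>z. z \<in> sphere 0 1 \<Longrightarrow> \<bar>g z - p z\<bar> < e"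
      using Stone_Weierstrass_polynomial_function[OF compact_sphere g e]
      by (auto simp: real_polynomial_function_eq)
    have pc: "continuous_on (sphere 0 1) p"
      using p(1) by (intro continuous_on_polymonial_function) (simp add: real_polynomial_function_eq)
    have "fourier_null (\<lambda>z. of_real (p z) * f z)" using fourier_null_polynomial[OF p(1) f] .
    then have "(LINT z|circle. of_real (p z) * f z) = 0"
      unfolding fourier_null_def fourier_def by (auto dest: spec[of _ 0])
    then have "(LINT z|circle. of_real (g z) * f z) = (LINT z|circle. of_real (g z) * f z - of_real (p z) * f z)"
      by (subst Bochner_Integration.integral_diff) (use int_g[OF g] int_g[OF pc] in auto)
    also have "cmod \<dots> \<le> (LINT z|circle. cmod (of_real (g z) * f z - of_real (p z) * f z))"
      by (rule integral_norm_bound)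
    also have "\<dots> \<le> (LINT z|circle. e * cmod (f z))"
    proof (rule integral_mono)
      fix z assume "z \<in> space circle"
      then have "\<bar>g z - p z\<bar> \<le> e" using p(2)[of z] by simp
      then have "cmod (of_real (g z - p z) * f z) \<le> e * cmod (f z)"
        unfolding norm_mult norm_of_real by (rule mult_right_mono) simp
      then show "cmod (of_real (g z) * f z - of_real (p z) * f z) \<le> e * cmod (f z)"
        by (simp add: left_diff_distrib)
    qed (use int_g[OF g] int_g[OF pc] int in auto)
    finally show ?thesis by simp
  qed
  then have *: "cmod (LINT z|circle. of_real (g z) * f z) \<le> e" if "e > 0" for e
  proof -
    define I where "I = (LINT z|circle. cmod (f z))"
    have I: "I \<ge> 0" by (simp add: I_def)
    have "cmod (LINT z|circle. of_real (g z) * f z) \<le> (e / (I + 1)) * I"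
      unfolding I_def using that I by (intro \<open>\<And>e. e > 0 \<Longrightarrow> _\<close>) (auto simp: I_def intro!: divide_pos_pos add_nonneg_pos)
    also have "\<dots> \<le> e" using I that by (simp add: field_simps)
    finally show ?thesis .
  qed
  have "cmod (LINT z|circle. of_real (g z) * f z) \<le> 0" by (rule field_le_epsilon) (use * in simp)
  then show ?thesis by simp
qed

lemma borel_measurable_indicator_circle:
  assumes "B \<in> sets borel"
  shows "(\<lambda>z. complex_of_real (indicator B z)) \<in> borel_measurable circle"
proof -
  have "indicator B \<in> borel_measurable (restrict_space borel (sphere 0 1))"
    using assms by (intro measurable_restrict_space1) simp
  then have "(indicator B :: complex \<Rightarrow> real) \<in> borel_measurable circle"
    by (simp cong: measurable_cong_sets add: sets_circle)
  then show ?thesis by measurable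
qed

lemma integrable_indicator_mult:
  fixes f :: "complex \<Rightarrow> complex"
  shows "integrable circle f \<Longrightarrow> B \<in> sets borel \<Longrightarrow> integrable circle (\<lambda>z. of_real (indicator B z) * f z)"
  by (intro integrable_mult_bounded_circle[where C = 1] borel_measurable_indicator_circle)
    (auto simp: indicator_def)

lemma fourier_null_open:
  assumes f: "fourier_null f" and U: "open U"
  shows "(LINT z|circle. of_real (indicator U z) * f z) = 0"
proof (cases "U = UNIV")
  case True
  then show ?thesis using fourier_null_continuous[OF f, of "\<lambda>_. 1"] by simp
next
  case False
  have int: "integrable circle f" using f by (simp add: fourier_null_def)
  then have [measurable]: "f \<in> borel_measurable circle" by simp
  define g where "g n z = min 1 (real n * infdist z (- U))" for n z
  have g: "continuous_on (sphere 0 1) (g n)" for n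
    unfolding g_def by (intro continuous_intros)
  have lim: "(\<lambda>n. g n z) \<longlonglongrightarrow> indicator U z" for z
  proof (cases "z \<in> U")
    case True
    have "closed (- U)" "- U \<noteq> {}" using U False by auto
    then have "infdist z (- U) \<noteq> 0" using True in_closed_iff_infdist_zero[of "- U" z] by auto
    then have pos: "infdist z (- U) > 0" using infdist_nonneg[of z "- U"] by linarith
    obtain N where N: "real N * infdist z (- U) > 1" using ex_less_of_nat_mult[OF pos] by auto
    have "\<forall>\<^sub>F n in sequentially. g n z = 1"
      using eventually_ge_at_top[of N]
    proof eventually_elim
      case (elim n)
      have "real N * infdist z (- U) \<le> real n * infdist z (- U)" using elim pos by (intro mult_right_mono) auto
      then show ?case using N by (simp add: g_def)
    qed
    then show ?thesis using True by (simp add: tendsto_eventually)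
  qed (simp add: g_def)
  have "(\<lambda>n. LINT z|circle. of_real (g n z) * f z) \<longlonglongrightarrow> (LINT z|circle. of_real (indicator U z) * f z)"
  proof (rule integral_dominated_convergence[where w = "\<lambda>z. cmod (f z)"])
    show "(\<lambda>z. of_real (g n z) * f z) \<in> borel_measurable circle" for n
      using borel_measurable_circle_continuous[OF g[of n]] by measurable
    show "(\<lambda>z. of_real (indicator U z) * f z) \<in> borel_measurable circle"
      using borel_measurable_indicator_circle[OF borel_open[OF U]] by measurable
    show "AE z in circle. (\<lambda>n. of_real (g n z) * f z) \<longlonglongrightarrow> of_real (indicator U z) * f z"
      by (intro AE_I2 tendsto_intros lim)
    show "AE z in circle. cmod (of_real (g n z) * f z) \<le> cmod (f z)" for n
      by (intro AE_I2) (simp add: norm_mult g_def mult_left_le_one_le infdist_nonneg)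
  qed (use int in auto)
  moreover have "(LINT z|circle. of_real (g n z) * f z) = 0" for n by (rule fourier_null_continuous[OF f g])
  ultimately show ?thesis by (simp add: LIMSEQ_const_iff)
qed

lemma fourier_null_borel:
  assumes f: "fourier_null f" and B: "B \<in> sets borel"
  shows "(LINT z|circle. of_real (indicator B z) * f z) = 0"
proof -
  have int: "integrable circle f" using f by (simp add: fourier_null_def)
  then have fm [measurable]: "f \<in> borel_measurable circle" by simp
  note ind = borel_measurable_indicator_circle and int_ind = integrable_indicator_mult[OF int]
  have "Int_stable {S :: complex set. open S}" by (auto simp: Int_stable_def)
  moreover have "{S :: complex set. open S} \<subseteq> Pow UNIV" by simp
  moreover have "B \<in> sigma_sets UNIV {S. open S}" using B by (simp add: sets_borel)
  ultimately show ?thesis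
  proof (induction rule: sigma_sets_induct_disjoint)
    case (basic A)
    then show ?case using fourier_null_open[OF f] by simp
  next
    case empty
    then show ?case by simp
  next
    case (compl A)
    then have A: "A \<in> sets borel" by (simp add: sets_borel)
    have "(LINT z|circle. of_real (indicator (UNIV - A) z) * f z)
        = (LINT z|circle. of_real (indicator UNIV z) * f z - of_real (indicator A z) * f z)"
      by (intro Bochner_Integration.integral_cong) (auto simp: indicator_def)
    also have "\<dots> = 0"
      using compl fourier_null_open[OF f, of UNIV] int_ind[OF A] int
      by (subst Bochner_Integration.integral_diff) auto
    finally show ?case .
  next
    case (union A)
    then have A: "A i \<in> sets borel" for i by (auto simp: sets_borel)
    have "(\<lambda>n. LINT z|circle. of_real (indicator (\<Union>i<n. A i) z) * f z) \<longlonglongrightarrow>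
        (LINT z|circle. of_real (indicator (\<Union>i. A i) z) * f z)"
    proof (rule integral_dominated_convergence[where w = "\<lambda>z. cmod (f z)"])
      show "(\<lambda>z. of_real (indicator (\<Union>i. A i) z) * f z) \<in> borel_measurable circle"
        using ind[of "\<Union>i. A i"] A by measurable
      show "(\<lambda>z. of_real (indicator (\<Union>i<n. A i) z) * f z) \<in> borel_measurable circle" for n
        using ind[of "\<Union>i<n. A i"] A by measurable
      show "AE z in circle. (\<lambda>n. of_real (indicator (\<Union>i<n. A i) z) * f z) \<longlonglongrightarrow> of_real (indicator (\<Union>i. A i) z) * f z"
        by (intro AE_I2 tendsto_intros LIMSEQ_indicator_UN)
    qed (use int in \<open>auto simp: norm_mult indicator_def\<close>)
    moreover have "(LINT z|circle. of_real (indicator (\<Union>i<n. A i) z) * f z) = 0" for n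
    proof -
      have "(LINT z|circle. of_real (indicator (\<Union>i<n. A i) z) * f z)
          = (LINT z|circle. (\<Sum>i<n. of_real (indicator (A i) z) * f z))"
        using union.hyps(1)
        by (simp add: indicator_UN_disjoint disjoint_family_on_def sum_distrib_right)
      also have "\<dots> = 0" using union.IH int_ind[OF A] by (subst Bochner_Integration.integral_sum) auto
      finally show ?thesis .
    qed
    ultimately show ?case by (simp add: LIMSEQ_const_iff)
  qed
qed

lemma AE_nonpos_if_integral_zero:
  fixes r :: "complex \<Rightarrow> real"
  assumes int: "integrable circle r" and z: "\<And>B. B \<in> sets borel \<Longrightarrow> (LINT z|circle. indicator B z * r z) = 0"
  shows "AE z in circle. r z \<le> 0"
proof -
  have rm [measurable]: "r \<in> borel_measurable circle" using int by simp
  have "{z \<in> space circle. r z > 0} \<in> sets circle" by measurable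
  then have "{z \<in> space circle. r z > 0} \<in> (\<inter>) (sphere 0 1) ` sets borel"
    unfolding sets_circle sets_restrict_space .
  then obtain B where B: "{z \<in> space circle. r z > 0} = sphere 0 1 \<inter> B" "B \<in> sets borel" by (rule imageE)
  have eq: "indicator B z * r z = max 0 (r z)" if z: "z \<in> space circle" for z
  proof -
    have "z \<in> {z \<in> space circle. r z > 0} \<longleftrightarrow> z \<in> B" unfolding B(1) using z by simp
    then have "r z > 0 \<longleftrightarrow> z \<in> B" using z by simp
    then show ?thesis by (auto simp: indicator_def max_def)
  qed
  have "(LINT z|circle. max 0 (r z)) = (LINT z|circle. indicator B z * r z)"
    by (intro Bochner_Integration.integral_cong) (use eq in auto)
  then have "(LINT z|circle. max 0 (r z)) = 0" using z[OF B(2)] by simp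
  moreover have "integrable circle (\<lambda>z. max 0 (r z))"
    by (rule Bochner_Integration.integrable_bound[OF int]) auto
  ultimately have "AE z in circle. max 0 (r z) = 0"
    by (subst integral_nonneg_eq_0_iff_AE[symmetric]) auto
  then show ?thesis by eventually_elim (simp add: max_def split: if_splits)
qed

text \<open>Integrals against continuous functions vanish, hence those over open sets and over Borel sets,
  in particular over the sets where the real or the imaginary part has a fixed sign.\<close>

theorem fourier_null_AE_zero:
  assumes f: "fourier_null f"
  shows "AE z in circle. f z = 0"
proof -
  have int: "integrable circle f" using f by (simp add: fourier_null_def)
  then have fm [measurable]: "f \<in> borel_measurable circle" by simp
  have nonpos: "AE z in circle. Re (c * f z) \<le> 0" for c
  proof (rule AE_nonpos_if_integral_zero)
    show "integrable circle (\<lambda>z. Re (c * f z))" using int by auto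
    fix B :: "complex set" assume B: "B \<in> sets borel"
    have "(LINT z|circle. c * (of_real (indicator B z) * f z)) = 0" using fourier_null_borel[OF f B] by simp
    moreover have "integrable circle (\<lambda>z. c * (of_real (indicator B z) * f z))"
      using integrable_indicator_mult[OF int B] by (rule integrable_mult_right)
    ultimately have "(LINT z|circle. Re (c * (of_real (indicator B z) * f z))) = 0"
      by (subst integral_Re) auto
    also have "(\<lambda>z. Re (c * (of_real (indicator B z) * f z))) = (\<lambda>z. indicator B z * Re (c * f z))"
      by (auto simp: fun_eq_iff indicator_def)
    finally show "(LINT z|circle. indicator B z * Re (c * f z)) = 0" .
  qed
  show ?thesis
    using nonpos[of 1] nonpos[of "-1"] nonpos[of \<i>] nonpos[of "-\<i>"]
    by eventually_elim (simp add: complex_eq_iff)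
qed

section \<open>Square integrable functions on the circle\<close>

lemma Lp_1_iff: "f \<in> Lp 1 \<longleftrightarrow> integrable circle f"
  unfolding Lp_def by (auto simp: integrable_norm_iff)

lemma Lp_2_iff: "f \<in> Lp 2 \<longleftrightarrow> f \<in> borel_measurable circle \<and> integrable circle (\<lambda>z. (cmod (f z))\<^sup>2)"
  unfolding Lp_def by (simp add: powr_numeral)

lemma Lp_2_measurable: "f \<in> Lp 2 \<Longrightarrow> f \<in> borel_measurable circle"
  by (simp add: Lp_2_iff)

lemma integrable_Lp_2_mult:
  assumes "f \<in> Lp 2" "g \<in> Lp 2"
  shows "integrable circle (\<lambda>z. f z * g z)"
proof (rule Bochner_Integration.integrable_bound)
  show "integrable circle (\<lambda>z. (cmod (f z))\<^sup>2 + (cmod (g z))\<^sup>2)" using assms by (simp add: Lp_2_iff)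
  show "(\<lambda>z. f z * g z) \<in> borel_measurable circle"
    using assms by (intro borel_measurable_times Lp_2_measurable)
  show "AE z in circle. norm (f z * g z) \<le> norm ((cmod (f z))\<^sup>2 + (cmod (g z))\<^sup>2)"
  proof (rule AE_I2)
    fix z
    have "2 * (cmod (f z) * cmod (g z)) \<le> (cmod (f z))\<^sup>2 + (cmod (g z))\<^sup>2"
      using sum_squares_bound[of "cmod (f z)" "cmod (g z)"] by (simp add: mult.assoc)
    moreover have "0 \<le> cmod (f z) * cmod (g z)" by simp
    ultimately show "norm (f z * g z) \<le> norm ((cmod (f z))\<^sup>2 + (cmod (g z))\<^sup>2)"
      unfolding norm_mult real_norm_def by linarith
  qed
qed

lemma borel_measurable_cnj: "f \<in> borel_measurable M \<Longrightarrow> (\<lambda>z. cnj (f z)) \<in> borel_measurable M"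
  by (erule measurable_compose) (intro borel_measurable_continuous_onI continuous_intros)

lemma Lp_2_cnj: "f \<in> Lp 2 \<Longrightarrow> (\<lambda>z. cnj (f z)) \<in> Lp 2"
  by (simp add: Lp_2_iff borel_measurable_cnj)

lemma Lp_2_scale: "f \<in> Lp 2 \<Longrightarrow> (\<lambda>z. c * f z) \<in> Lp 2"
  by (simp add: Lp_2_iff norm_mult power_mult_distrib borel_measurable_times)

lemma cmod_add_power2: "(cmod (x + y))\<^sup>2 = (cmod x)\<^sup>2 + 2 * Re (x * cnj y) + (cmod y)\<^sup>2"
  by (simp only: cmod_power2, simp add: power2_eq_square algebra_simps)

lemma Lp_2_add:
  assumes "f \<in> Lp 2" "g \<in> Lp 2"
  shows "(\<lambda>z. f z + g z) \<in> Lp 2"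
proof -
  have "integrable circle (\<lambda>z. (cmod (f z))\<^sup>2 + 2 * Re (f z * cnj (g z)) + (cmod (g z))\<^sup>2)"
    using assms integrable_Lp_2_mult[OF assms(1) Lp_2_cnj[OF assms(2)]]
    by (intro Bochner_Integration.integrable_add integrable_mult_right integrable_Re) (auto simp: Lp_2_iff)
  moreover have "(\<lambda>z. f z + g z) \<in> borel_measurable circle"
    using assms by (intro borel_measurable_add Lp_2_measurable)
  ultimately show ?thesis unfolding Lp_2_iff cmod_add_power2 by simp
qed

lemma Lp_2_diff: "f \<in> Lp 2 \<Longrightarrow> g \<in> Lp 2 \<Longrightarrow> (\<lambda>z. f z - g z) \<in> Lp 2"
  using Lp_2_add[of f "\<lambda>z. (-1) * g z"] Lp_2_scale[of g "-1"] by simp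

lemma Lp_2_bounded:
  assumes "f \<in> borel_measurable circle" "AE z in circle. cmod (f z) \<le> C"
  shows "f \<in> Lp 2"
proof -
  have "integrable circle (\<lambda>z. (cmod (f z))\<^sup>2)"
  proof (rule Bochner_Integration.integrable_bound)
    show "integrable circle (\<lambda>_. C\<^sup>2)" by simp
    show "(\<lambda>z. (cmod (f z))\<^sup>2) \<in> borel_measurable circle" using assms(1) by measurable
    show "AE z in circle. norm ((cmod (f z))\<^sup>2) \<le> norm (C\<^sup>2)"
      using assms(2) by eventually_elim (simp add: power_mono)
  qed
  then show ?thesis using assms(1) by (simp add: Lp_2_iff)
qed

lemma Lp_2_powi [simp]: "(\<lambda>z. z powi n) \<in> Lp 2"
  by (rule Lp_2_bounded[where C = 1]) (auto intro!: AE_I2)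

lemma Lp_2_sum: "(\<And>s. s \<in> S \<Longrightarrow> f s \<in> Lp 2) \<Longrightarrow> (\<lambda>z. \<Sum>s\<in>S. f s z) \<in> Lp 2"
proof (induction S rule: infinite_finite_induct)
  case (insert s S)
  then show ?case using Lp_2_add[of "f s" "\<lambda>z. \<Sum>s\<in>S. f s z"] by simp
qed (simp_all add: Lp_2_iff)

lemma Lp_2_integrable: "f \<in> Lp 2 \<Longrightarrow> integrable circle f"
  using integrable_Lp_2_mult[of f "\<lambda>z. z powi 0"] Lp_2_powi[of 0] by simp

definition l2int :: "(complex \<Rightarrow> complex) \<Rightarrow> real" where
  "l2int f = (LINT z|circle. (cmod (f z))\<^sup>2)"

lemma l2int_nonneg [simp]: "0 \<le> l2int f"
  by (simp add: l2int_def)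

lemma l2int_add:
  assumes "f \<in> Lp 2" "g \<in> Lp 2"
  shows "l2int (\<lambda>z. f z + g z) = l2int f + 2 * Re (LINT z|circle. f z * cnj (g z)) + l2int g"
proof -
  have i: "integrable circle (\<lambda>z. f z * cnj (g z))"
    by (rule integrable_Lp_2_mult[OF assms(1) Lp_2_cnj[OF assms(2)]])
  then have "integrable circle (\<lambda>z. Re (f z * cnj (g z)))" by (rule integrable_Re)
  then have "l2int (\<lambda>z. f z + g z) = l2int f + (LINT z|circle. 2 * Re (f z * cnj (g z))) + l2int g"
    unfolding l2int_def cmod_add_power2 using assms
    by (simp only: Bochner_Integration.integral_add Bochner_Integration.integrable_add integrable_mult_right
        integrable_Re Lp_2_iff)
  also have "(LINT z|circle. 2 * Re (f z * cnj (g z))) = 2 * Re (LINT z|circle. f z * cnj (g z))"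
    unfolding integral_Re[OF i, symmetric] by (rule integral_mult_right_zero)
  finally show ?thesis .
qed

lemma l2int_eq: "of_real (l2int f) = (LINT z|circle. f z * cnj (f z))"
  unfolding l2int_def complex_norm_square[symmetric]
  by (simp flip: of_real_power)

lemma integral_mult_cnj_trig:
  assumes "integrable circle f" "finite S"
  shows "(LINT z|circle. f z * cnj (\<Sum>s\<in>S. c s * z powi u s)) = (\<Sum>s\<in>S. cnj (c s) * fourier f (u s))"
proof -
  have "(LINT z|circle. f z * cnj (\<Sum>s\<in>S. c s * z powi u s))
      = (LINT z|circle. (\<Sum>s\<in>S. cnj (c s) * (f z * z powi (- u s))))"
  proof (intro Bochner_Integration.integral_cong refl)
    fix z assume "z \<in> space circle"
    then have "cmod z = 1" by simp
    then show "f z * cnj (\<Sum>s\<in>S. c s * z powi u s) = (\<Sum>s\<in>S. cnj (c s) * (f z * z powi (- u s)))"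
      using cnj_powi_circle[of z]
      by (simp add: sum_distrib_left mult.left_commute del: complex_cnj_power_int)
  qed
  also have "\<dots> = (\<Sum>s\<in>S. cnj (c s) * fourier f (u s))"
    unfolding fourier_def using integrable_powi_mult[OF assms(1)]
    by (subst Bochner_Integration.integral_sum) auto
  finally show ?thesis .
qed

lemma Lp_2_trig: "(\<lambda>z. \<Sum>s\<in>S. c s * z powi u s) \<in> Lp 2"
  by (intro Lp_2_sum Lp_2_scale Lp_2_powi)

lemma fourier_trig_at: "finite S \<Longrightarrow> inj_on u S \<Longrightarrow> s \<in> S \<Longrightarrow>
    fourier (\<lambda>z. \<Sum>s\<in>S. c s * z powi u s) (u s) = c s"
  by (subst fourier_trig) (auto simp: inj_on_eq_iff sum.delta cong: sum.cong if_cong)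

lemma l2int_trig:
  assumes "finite S" "inj_on u S"
  shows "l2int (\<lambda>z. \<Sum>s\<in>S. c s * z powi u s) = (\<Sum>s\<in>S. (cmod (c s))\<^sup>2)"
proof -
  have "complex_of_real (l2int (\<lambda>z. \<Sum>s\<in>S. c s * z powi u s)) = (\<Sum>s\<in>S. cnj (c s) * c s)"
    unfolding l2int_eq
    by (subst integral_mult_cnj_trig[OF Lp_2_integrable[OF Lp_2_trig] assms(1)])
       (intro sum.cong refl, simp only: fourier_trig_at[OF assms])
  also have "\<dots> = of_real (\<Sum>s\<in>S. (cmod (c s))\<^sup>2)"
    unfolding of_real_sum by (intro sum.cong refl) (subst mult.commute, simp add: complex_norm_square[symmetric])
  finally show ?thesis by (simp only: of_real_eq_iff)
qed

lemma bessel_identity: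
  assumes f: "f \<in> Lp 2" and S: "finite S" "inj_on u S"
  shows "l2int (\<lambda>z. f z - (\<Sum>s\<in>S. fourier f (u s) * z powi u s)) = l2int f - (\<Sum>s\<in>S. (cmod (fourier f (u s)))\<^sup>2)"
proof -
  let ?c = "\<lambda>s. fourier f (u s)"
  have "l2int (\<lambda>z. f z - (\<Sum>s\<in>S. ?c s * z powi u s)) = l2int (\<lambda>z. f z + (\<Sum>s\<in>S. (- ?c s) * z powi u s))"
    by (simp add: sum_negf)
  also have "\<dots> = l2int f + 2 * Re (\<Sum>s\<in>S. cnj (- ?c s) * ?c s) + (\<Sum>s\<in>S. (cmod (- ?c s))\<^sup>2)"
    by (subst l2int_add[OF f Lp_2_trig], subst integral_mult_cnj_trig[OF Lp_2_integrable[OF f] S(1)],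
        subst l2int_trig[OF S]) (rule refl)
  also have "(\<Sum>s\<in>S. cnj (- ?c s) * ?c s) = - of_real (\<Sum>s\<in>S. (cmod (?c s))\<^sup>2)"
    unfolding of_real_sum sum_negf[symmetric]
    by (intro sum.cong refl) (subst mult.commute, simp add: complex_norm_square[symmetric])
  finally show ?thesis by simp
qed

text \<open>The circle has measure \<open>1\<close>, so the variance of the modulus is nonnegative.\<close>

lemma integral_norm_le_l2int:
  assumes "f \<in> Lp 2"
  shows "(LINT z|circle. cmod (f z)) \<le> sqrt (l2int f)"
proof (rule real_le_rsqrt)
  define m where "m = (LINT z|circle. cmod (f z))"
  have i: "integrable circle (\<lambda>z. cmod (f z))" using Lp_2_integrable[OF assms] by simp
  have "0 \<le> (LINT z|circle. (cmod (f z) - m)\<^sup>2)" by simp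
  also have "(\<lambda>z. (cmod (f z) - m)\<^sup>2) = (\<lambda>z. (cmod (f z))\<^sup>2 - 2 * m * cmod (f z) + m\<^sup>2)"
    by (simp add: fun_eq_iff power2_eq_square algebra_simps)
  also have "(LINT z|circle. \<dots> z) = l2int f - 2 * m * m + m\<^sup>2"
    unfolding l2int_def m_def using assms i
    by (subst Bochner_Integration.integral_add, simp_all add: Lp_2_iff)
  finally show "(LINT z|circle. cmod (f z))\<^sup>2 \<le> l2int f"
    unfolding m_def[symmetric] by (simp add: power2_eq_square)
qed

text \<open>Partial sums along a sequence of indices with geometrically decreasing tails converge absolutely
  almost everywhere and in mean, which identifies the coefficients of the limit; the bound for its
  norm is the lemma of Fatou.\<close>

theorem riesz_fischer:
  fixes u :: "nat \<Rightarrow> int" and c :: "nat \<Rightarrow> complex"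
  assumes u: "inj u" and c: "summable (\<lambda>k. (cmod (c k))\<^sup>2)"
  shows "\<exists>g. g \<in> Lp 2 \<and> (\<forall>k. fourier g (u k) = c k) \<and> (\<forall>n. n \<notin> range u \<longrightarrow> fourier g n = 0) \<and>
    l2int g \<le> (\<Sum>k. (cmod (c k))\<^sup>2)"
proof -
  have inj: "inj_on u A" for A using u by (rule inj_on_subset) simp
  define S where "S N z = (\<Sum>k<N. c k * z powi u k)" for N z
  have "\<exists>R. \<forall>M\<ge>R. \<forall>N. (\<Sum>k\<in>{M..<N}. (cmod (c k))\<^sup>2) \<le> (1 / 4) ^ m" for m :: nat
  proof -
    have "\<exists>R. \<forall>M\<ge>R. \<forall>N. norm (\<Sum>k\<in>{M..<N}. (cmod (c k))\<^sup>2) < (1 / 4) ^ m"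
      using c unfolding summable_Cauchy by (meson zero_less_divide_1_iff zero_less_numeral zero_less_power)
    then show ?thesis by (auto simp: sum_nonneg intro: less_imp_le)
  qed
  then obtain R where R: "\<And>m M N. M \<ge> R m \<Longrightarrow> (\<Sum>k\<in>{M..<N}. (cmod (c k))\<^sup>2) \<le> (1 / 4) ^ m" by metis
  \<comment> \<open>A monotone choice of indices with \<open>r m \<ge> R m\<close>.\<close>
  define r where "r m = m + (\<Sum>i\<le>m. R i)" for m
  have r: "R m \<le> r m" "m \<le> r m" "r m \<le> r (Suc m)" for m
    using member_le_sum[of m "{..m}" R] by (auto simp: r_def)
  define h where "h m z = (\<Sum>k\<in>{r m..<r (Suc m)}. c k * z powi u k)" for m z
  have Sh: "S (r 0) z + (\<Sum>m<M. h m z) = S (r M) z" for M z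
  proof (induction M)
    case (Suc M)
    have "S (r (Suc M)) z = S (r M) z + h M z"
      unfolding S_def h_def lessThan_atLeast0 by (rule sum.atLeastLessThan_concat[symmetric]) (use r in auto)
    with Suc show ?case by simp
  qed simp
  have h2: "h m \<in> Lp 2" for m unfolding h_def by (rule Lp_2_trig)
  have S2: "S N \<in> Lp 2" for N unfolding S_def by (rule Lp_2_trig)
  have hm [measurable]: "h m \<in> borel_measurable circle" for m using h2 by (rule Lp_2_measurable)
  have Sm [measurable]: "S N \<in> borel_measurable circle" for N using S2 by (rule Lp_2_measurable)
  have hint: "(LINT z|circle. cmod (h m z)) \<le> (1 / 2) ^ m" for m
  proof -
    have "(LINT z|circle. cmod (h m z)) \<le> sqrt (l2int (h m))" by (rule integral_norm_le_l2int[OF h2])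
    also have "l2int (h m) = (\<Sum>k\<in>{r m..<r (Suc m)}. (cmod (c k))\<^sup>2)"
      unfolding h_def by (rule l2int_trig) (auto intro: inj)
    also have "sqrt \<dots> \<le> sqrt ((1 / 4) ^ m)" using R[OF r(1)] by (rule real_sqrt_le_mono)
    also have "(1 / 4 :: real) ^ m = ((1 / 2) ^ m)\<^sup>2" by (simp add: power2_eq_square flip: power_mult_distrib)
    finally show ?thesis by simp
  qed
  have hsum: "summable (\<lambda>m. LINT z|circle. cmod (h m z))"
    by (rule summable_comparison_test'[of "\<lambda>m. (1 / 2) ^ m" 0]) (use hint in \<open>auto simp: summable_geometric\<close>)
  have AEsum: "AE z in circle. summable (\<lambda>m. cmod (h m z))"
  proof -
    have "(\<integral>\<^sup>+z. (\<Sum>m. ennreal (cmod (h m z))) \<partial>circle) = (\<Sum>m. \<integral>\<^sup>+z. ennreal (cmod (h m z)) \<partial>circle)"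
      by (rule nn_integral_suminf) measurable
    also have "\<dots> = (\<Sum>m. ennreal (LINT z|circle. cmod (h m z)))"
      using Lp_2_integrable[OF h2] by (intro suminf_cong nn_integral_eq_integral) auto
    also have "\<dots> \<noteq> \<infinity>" unfolding infinity_ennreal_def using hsum by (intro ennreal_suminf_neq_top) auto
    finally have "AE z in circle. (\<Sum>m. ennreal (cmod (h m z))) \<noteq> \<infinity>"
      by (intro nn_integral_PInf_AE) measurable
    then show ?thesis unfolding infinity_ennreal_def by eventually_elim (auto intro: summable_suminf_not_top)
  qed
  define g where "g z = S (r 0) z + (\<Sum>m. h m z)" for z
  have gm [measurable]: "g \<in> borel_measurable circle" unfolding g_def by measurable
  have lim: "AE z in circle. (\<lambda>M. S (r M) z) \<longlonglongrightarrow> g z"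
    using AEsum
  proof eventually_elim
    case (elim z)
    then have "(\<lambda>m. h m z) sums (\<Sum>m. h m z)" by (rule summable_sums[OF summable_norm_cancel])
    then have "(\<lambda>M. S (r 0) z + (\<Sum>m<M. h m z)) \<longlonglongrightarrow> g z"
      unfolding g_def sums_def by (intro tendsto_intros)
    then show ?case unfolding Sh .
  qed
  have cut: "(\<Sum>k<N. (cmod (c k))\<^sup>2) \<le> (\<Sum>k. (cmod (c k))\<^sup>2)" for N
    by (rule sum_le_suminf[OF c]) auto
  have "(\<integral>\<^sup>+z. ennreal ((cmod (g z))\<^sup>2) \<partial>circle) \<le> (\<integral>\<^sup>+z. liminf (\<lambda>M. ennreal ((cmod (S (r M) z))\<^sup>2)) \<partial>circle)"
  proof (rule nn_integral_mono_AE)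
    show "AE z in circle. ennreal ((cmod (g z))\<^sup>2) \<le> liminf (\<lambda>M. ennreal ((cmod (S (r M) z))\<^sup>2))"
      using lim
    proof eventually_elim
      case (elim z)
      then have "(\<lambda>M. ennreal ((cmod (S (r M) z))\<^sup>2)) \<longlonglongrightarrow> ennreal ((cmod (g z))\<^sup>2)"
        by (intro tendsto_ennrealI tendsto_intros)
      from lim_imp_Liminf[OF sequentially_bot this] show ?case by (simp only: order_refl)
    qed
  qed
  also have "\<dots> \<le> liminf (\<lambda>M. \<integral>\<^sup>+z. ennreal ((cmod (S (r M) z))\<^sup>2) \<partial>circle)"
    by (rule nn_integral_liminf) measurable
  also have "\<dots> \<le> liminf (\<lambda>M. ennreal (\<Sum>k. (cmod (c k))\<^sup>2))"
  proof (intro Liminf_mono always_eventually allI)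
    fix M
    have "(\<integral>\<^sup>+z. ennreal ((cmod (S (r M) z))\<^sup>2) \<partial>circle) = ennreal (l2int (S (r M)))"
      unfolding l2int_def using S2[of "r M"] by (intro nn_integral_eq_integral) (auto simp: Lp_2_iff)
    also have "l2int (S (r M)) = (\<Sum>k<r M. (cmod (c k))\<^sup>2)" unfolding S_def by (rule l2int_trig) (auto intro: inj)
    finally show "(\<integral>\<^sup>+z. ennreal ((cmod (S (r M) z))\<^sup>2) \<partial>circle) \<le> ennreal (\<Sum>k. (cmod (c k))\<^sup>2)"
      using cut by (simp add: ennreal_leI)
  qed
  also have "\<dots> = ennreal (\<Sum>k. (cmod (c k))\<^sup>2)" by (simp add: Liminf_const)
  finally have fatou: "(\<integral>\<^sup>+z. ennreal ((cmod (g z))\<^sup>2) \<partial>circle) \<le> ennreal (\<Sum>k. (cmod (c k))\<^sup>2)" .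
  then have gi: "integrable circle (\<lambda>z. (cmod (g z))\<^sup>2)"
    by (intro integrableI_bounded) (auto simp: le_less_trans[OF _ ennreal_less_top])
  then have g2: "g \<in> Lp 2" by (simp add: Lp_2_iff)
  have "ennreal (l2int g) \<le> ennreal (\<Sum>k. (cmod (c k))\<^sup>2)"
    using fatou unfolding l2int_def by (subst nn_integral_eq_integral[symmetric]) (use gi in auto)
  then have gle: "l2int g \<le> (\<Sum>k. (cmod (c k))\<^sup>2)" by (simp add: suminf_nonneg[OF c])
  have four: "(\<lambda>M. fourier (S (r M)) n) \<longlonglongrightarrow> fourier g n" for n
  proof -
    have sums: "(\<lambda>m. LINT z|circle. h m z * z powi (- n)) sums (LINT z|circle. (\<Sum>m. h m z * z powi (- n)))"
    proof (rule sums_integral)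
      show "integrable circle (\<lambda>z. h m z * z powi (- n))" for m
        using Lp_2_integrable[OF h2] by (rule integrable_powi_mult)
      have eq: "cmod (h m z * z powi (- n)) = cmod (h m z)" if "z \<in> space circle" for m z
        using that by (simp add: norm_mult)
      show "AE z in circle. summable (\<lambda>m. cmod (h m z * z powi (- n)))"
        using AEsum AE_space by eventually_elim (simp only: eq)
      have "(LINT z|circle. cmod (h m z * z powi (- n))) = (LINT z|circle. cmod (h m z))" for m
        using eq by (rule Bochner_Integration.integral_cong[OF refl])
      then show "summable (\<lambda>m. LINT z|circle. cmod (h m z * z powi (- n)))" using hsum by simp
    qed
    have hi: "integrable circle (\<lambda>z. \<Sum>m. h m z)"
      using integrable_suminf[OF Lp_2_integrable[OF h2] AEsum hsum] .
    have "(LINT z|circle. (\<Sum>m. h m z * z powi (- n))) = fourier (\<lambda>z. \<Sum>m. h m z) n"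
      unfolding fourier_def
    proof (rule integral_cong_AE)
      show "AE z in circle. (\<Sum>m. h m z * z powi (- n)) = (\<Sum>m. h m z) * z powi (- n)"
        using AEsum by eventually_elim (simp add: suminf_mult2[symmetric] summable_norm_cancel)
    qed measurable
    with sums have "(\<lambda>m. fourier (h m) n) sums fourier (\<lambda>z. \<Sum>m. h m z) n" by (simp add: fourier_def)
    then have "(\<lambda>M. fourier (S (r 0)) n + (\<Sum>m<M. fourier (h m) n)) \<longlonglongrightarrow> fourier (S (r 0)) n + fourier (\<lambda>z. \<Sum>m. h m z) n"
      unfolding sums_def by (intro tendsto_intros)
    also have "fourier (S (r 0)) n + fourier (\<lambda>z. \<Sum>m. h m z) n = fourier g n"
      unfolding g_def using Lp_2_integrable[OF S2] hi by (intro fourier_add[symmetric])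
    also have "(\<lambda>M. fourier (S (r 0)) n + (\<Sum>m<M. fourier (h m) n)) = (\<lambda>M. fourier (S (r M)) n)"
    proof
      fix M
      have "fourier (S (r 0)) n + (\<Sum>m<M. fourier (h m) n) = fourier (\<lambda>z. S (r 0) z + (\<Sum>m<M. h m z)) n"
        using Lp_2_integrable[OF S2] Lp_2_integrable[OF h2] by (subst fourier_add) (auto simp: fourier_sum)
      then show "fourier (S (r 0)) n + (\<Sum>m<M. fourier (h m) n) = fourier (S (r M)) n" unfolding Sh .
    qed
    finally show ?thesis .
  qed
  show ?thesis
  proof (intro exI[of _ g] conjI allI impI g2 gle)
    fix k
    have "fourier (S (r M)) (u k) = c k" if "M \<ge> Suc k" for M
      unfolding S_def using that r(2)[of M] by (intro fourier_trig_at inj) auto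
    then have "(\<lambda>M. fourier (S (r M)) (u k)) \<longlonglongrightarrow> c k"
      by (intro tendsto_eventually eventually_sequentiallyI[of "Suc k"])
    then show "fourier g (u k) = c k" using four LIMSEQ_unique by blast
  next
    fix n assume "n \<notin> range u"
    then have "fourier (S N) n = 0" for N
      unfolding S_def by (subst fourier_trig) (auto simp: inj intro!: sum.neutral)
    then show "fourier g n = 0" using four[of n] by (simp add: LIMSEQ_const_iff)
  qed
qed

lemma bessel_summable:
  assumes "f \<in> Lp 2" "inj u"
  shows "summable (\<lambda>k. (cmod (fourier f (u k)))\<^sup>2)" "(\<Sum>k. (cmod (fourier f (u k)))\<^sup>2) \<le> l2int f"
proof -
  have le: "(\<Sum>k<N. (cmod (fourier f (u k)))\<^sup>2) \<le> l2int f" for N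
    using bessel_identity[OF assms(1), of "{..<N}" u] inj_on_subset[OF assms(2)]
      l2int_nonneg[of "\<lambda>z. f z - (\<Sum>s<N. fourier f (u s) * z powi u s)"] by simp
  show "summable (\<lambda>k. (cmod (fourier f (u k)))\<^sup>2)"
    by (rule summableI_nonneg_bounded[OF _ le]) simp
  then show "(\<Sum>k. (cmod (fourier f (u k)))\<^sup>2) \<le> l2int f" by (rule suminf_le_const[OF _ le])
qed

text \<open>The function provided by the theorem of Riesz and Fischer has the same coefficients, so it is
  the given one.\<close>

theorem parseval:
  assumes f: "f \<in> Lp 2" and u: "inj u" and zero: "\<And>n. n \<notin> range u \<Longrightarrow> fourier f n = 0"
  shows "(\<lambda>k. (cmod (fourier f (u k)))\<^sup>2) sums l2int f"
proof -
  note s = bessel_summable[OF f u]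
  obtain g where g: "g \<in> Lp 2" "\<And>k. fourier g (u k) = fourier f (u k)"
      "\<And>n. n \<notin> range u \<Longrightarrow> fourier g n = 0" "l2int g \<le> (\<Sum>k. (cmod (fourier f (u k)))\<^sup>2)"
    using riesz_fischer[OF u s(1)] by blast
  have "fourier f n = fourier g n" for n
    using g zero by (cases "n \<in> range u") auto
  then have "fourier_null (\<lambda>z. f z - g z)"
    unfolding fourier_null_def using Lp_2_integrable[OF f] Lp_2_integrable[OF g(1)] by (simp add: fourier_diff)
  then have "AE z in circle. f z = g z"
    using fourier_null_AE_zero by fastforce
  then have "l2int f = l2int g"
    unfolding l2int_def using Lp_2_measurable[OF f] Lp_2_measurable[OF g(1)]
    by (intro integral_cong_AE) auto
  with g(4) s show ?thesis by (simp add: sums_iff)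
qed

text \<open>Polarisation: the real part is the Parseval equality for \<open>f + g\<close>, the imaginary part the one for
  \<open>f + \<i> g\<close>.\<close>

theorem parseval_inner:
  assumes f: "f \<in> Lp 2" "\<And>n. n \<notin> range u \<Longrightarrow> fourier f n = 0"
    and g: "g \<in> Lp 2" "\<And>n. n \<notin> range u \<Longrightarrow> fourier g n = 0" and u: "inj u"
  shows "(\<lambda>k. fourier f (u k) * cnj (fourier g (u k))) sums (LINT z|circle. f z * cnj (g z))"
proof -
  let ?f = "\<lambda>k. fourier f (u k)" and ?g = "\<lambda>k. fourier g (u k)"
  have fi: "integrable circle f" and gi: "integrable circle g" using f g Lp_2_integrable by auto
  have Re: "(\<lambda>k. Re (?f k * cnj (w * ?g k))) sums Re (LINT z|circle. f z * cnj (w * g z))" for w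
  proof -
    have wg: "(\<lambda>z. w * g z) \<in> Lp 2" using g by (intro Lp_2_scale)
    have four: "fourier (\<lambda>z. f z + w * g z) n = fourier f n + w * fourier g n" for n
      using fi gi by (subst fourier_add) (auto simp: fourier_cmult)
    have 1: "(\<lambda>k. (cmod (?f k + w * ?g k))\<^sup>2) sums l2int (\<lambda>z. f z + w * g z)"
      using parseval[OF Lp_2_add[OF f(1) wg] u] f(2) g(2) unfolding four by simp
    have 2: "(\<lambda>k. (cmod (?f k))\<^sup>2) sums l2int f" using parseval[OF f(1) u] f(2) .
    have 3: "(\<lambda>k. (cmod (w * ?g k))\<^sup>2) sums l2int (\<lambda>z. w * g z)"
      using parseval[OF wg u] g(2) unfolding fourier_cmult by simp
    have "(\<lambda>k. ((cmod (?f k + w * ?g k))\<^sup>2 - (cmod (?f k))\<^sup>2 - (cmod (w * ?g k))\<^sup>2) / 2)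
        sums ((l2int (\<lambda>z. f z + w * g z) - l2int f - l2int (\<lambda>z. w * g z)) / 2)"
      by (intro sums_divide sums_diff 1 2 3)
    moreover have half: "(a + 2 * b + c - a - c) / 2 = b" for a b c :: real by simp
    have "((cmod (x + y))\<^sup>2 - (cmod x)\<^sup>2 - (cmod y)\<^sup>2) / 2 = Re (x * cnj y)" for x y
      unfolding cmod_add_power2 by (rule half)
    moreover have "(l2int (\<lambda>z. f z + w * g z) - l2int f - l2int (\<lambda>z. w * g z)) / 2
        = Re (LINT z|circle. f z * cnj (w * g z))"
      unfolding l2int_add[OF f(1) wg] by (rule half)
    ultimately show ?thesis by (simp only:)
  qed
  have "(LINT z|circle. f z * cnj (\<i> * g z)) = (LINT z|circle. (- \<i>) * (f z * cnj (g z)))"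
    by (intro Bochner_Integration.integral_cong) auto
  also have "\<dots> = (- \<i>) * (LINT z|circle. f z * cnj (g z))" by simp
  finally have "Re (LINT z|circle. f z * cnj (\<i> * g z)) = Im (LINT z|circle. f z * cnj (g z))" by simp
  with Re[of 1] Re[of \<i>] show ?thesis by (simp add: sums_complex_iff)
qed

section \<open>Operator norms as bounds of kernels\<close>

abbreviation entries :: "complex mat \<Rightarrow> nat \<Rightarrow> nat \<Rightarrow> complex" where
  "entries A \<equiv> (\<lambda>i j. A $$ (i, j))"

lemma vec_l2norm_eq: "vec_l2norm v = l2norm {..<dim_vec v} (\<lambda>i. v $ i)"
  by (simp add: vec_l2norm_def l2norm_def)

lemma vec_l2norm_mult:
  assumes "A \<in> carrier_mat n m" "v \<in> carrier_vec m"
  shows "vec_l2norm (A *\<^sub>v v) = l2norm {..<n} (\<lambda>i. \<Sum>j<m. A $$ (i, j) * v $ j)"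
  unfolding vec_l2norm_eq using assms
  by (intro l2norm_cong) (auto simp: scalar_prod_def lessThan_atLeast0)

lemma vec_l2norm_mult_le:
  assumes A: "A \<in> carrier_mat n m" and C: "form_bounded {..<n} {..<m} (entries A) C"
    and v: "v \<in> carrier_vec m" "vec_l2norm v \<le> 1"
  shows "vec_l2norm (A *\<^sub>v v) \<le> C"
proof -
  have "vec_l2norm (A *\<^sub>v v) \<le> C * l2norm {..<m} (\<lambda>j. v $ j)"
    unfolding vec_l2norm_mult[OF A v(1)] by (rule form_bounded_apply[OF C]) auto
  also have "\<dots> \<le> C * 1"
    using v form_bounded_nonneg[OF C] by (intro mult_left_mono) (auto simp: vec_l2norm_eq)
  finally show ?thesis by simp
qed

lemma opnorm_le:
  assumes A: "A \<in> carrier_mat n m" and C: "form_bounded {..<n} {..<m} (entries A) C"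
  shows "opnorm A \<le> C"
  unfolding opnorm_def
proof (rule cSup_least)
  have "0\<^sub>v m \<in> carrier_vec (dim_col A)" "vec_l2norm (0\<^sub>v m) \<le> 1"
    using A by (auto simp: vec_l2norm_eq l2norm_def L2_set_0')
  then show "{vec_l2norm (A *\<^sub>v v) |v. v \<in> carrier_vec (dim_col A) \<and> vec_l2norm v \<le> 1} \<noteq> {}" by blast
  fix r assume "r \<in> {vec_l2norm (A *\<^sub>v v) |v. v \<in> carrier_vec (dim_col A) \<and> vec_l2norm v \<le> 1}"
  then obtain v where v: "r = vec_l2norm (A *\<^sub>v v)" "v \<in> carrier_vec m" "vec_l2norm v \<le> 1" using A by auto
  show "r \<le> C" unfolding v(1) by (rule vec_l2norm_mult_le[OF A C v(2,3)])
qed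

lemma member_le_sum2:
  fixes f :: "'i \<Rightarrow> 'j \<Rightarrow> real"
  assumes "finite I" "finite J" "i \<in> I" "j \<in> J" "\<And>i j. 0 \<le> f i j"
  shows "f i j \<le> (\<Sum>i\<in>I. \<Sum>j\<in>J. f i j)"
proof -
  have "f i j \<le> (\<Sum>j\<in>J. f i j)" using assms by (intro member_le_sum) auto
  also have "\<dots> \<le> (\<Sum>i\<in>I. \<Sum>j\<in>J. f i j)"
    using assms by (intro member_le_sum[of i I "\<lambda>i. \<Sum>j\<in>J. f i j"]) (auto intro: sum_nonneg)
  finally show ?thesis .
qed

lemma form_bounded_exists: "finite I \<Longrightarrow> finite J \<Longrightarrow> \<exists>C. form_bounded I J a C"
proof -
  assume fin: "finite I" "finite J"
  have "cmod (a i j) \<le> (\<Sum>i\<in>I. \<Sum>j\<in>J. cmod (a i j))" if "i \<in> I" "j \<in> J" for i j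
    using that fin by (intro member_le_sum2) auto
  then have "form_bounded I J a (real (card I) * real (card J) * (\<Sum>i\<in>I. \<Sum>j\<in>J. cmod (a i j)))"
    using fin by (intro form_bounded_entriesI sum_nonneg) auto
  then show ?thesis by (rule exI)
qed

lemma form_bounded_opnorm:
  assumes A: "A \<in> carrier_mat n m"
  shows "form_bounded {..<n} {..<m} (entries A) (opnorm A)"
proof -
  let ?S = "{vec_l2norm (A *\<^sub>v v) |v. v \<in> carrier_vec (dim_col A) \<and> vec_l2norm v \<le> 1}"
  obtain C where C: "form_bounded {..<n} {..<m} (entries A) C" using form_bounded_exists by blast
  have bdd: "bdd_above ?S"
  proof (rule bdd_aboveI)
    fix r assume "r \<in> ?S"
    then obtain v where v: "r = vec_l2norm (A *\<^sub>v v)" "v \<in> carrier_vec m" "vec_l2norm v \<le> 1" using A by auto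
    show "r \<le> C" unfolding v(1) by (rule vec_l2norm_mult_le[OF A C v(2,3)])
  qed
  have up: "vec_l2norm (A *\<^sub>v v) \<le> opnorm A" if "v \<in> carrier_vec m" "vec_l2norm v \<le> 1" for v
    unfolding opnorm_def using that A by (intro cSup_upper[OF _ bdd]) auto
  have "vec_l2norm (A *\<^sub>v 0\<^sub>v m) \<le> opnorm A"
    by (rule up) (auto simp: vec_l2norm_eq l2norm_def L2_set_0')
  moreover have "0 \<le> vec_l2norm (A *\<^sub>v 0\<^sub>v m)" by (simp add: vec_l2norm_eq)
  ultimately have nn: "0 \<le> opnorm A" by linarith
  show ?thesis
  proof (rule form_bounded_applyI[OF _ _ nn])
    fix x :: "nat \<Rightarrow> complex"
    let ?X = "l2norm {..<m} x"
    show "l2norm {..<n} (\<lambda>i. \<Sum>j<m. A $$ (i, j) * x j) \<le> opnorm A * ?X"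
    proof (cases "?X = 0")
      case True
      then have "x j = 0" if "j < m" for j using that l2norm_zero_iff[of "{..<m}" x] by auto
      then have "(\<Sum>j<m. A $$ (i, j) * x j) = 0" for i by simp
      then show ?thesis using True by (simp add: l2norm_def L2_set_0')
    next
      case False
      then have X: "?X > 0" using l2norm_nonneg[of "{..<m}" x] by linarith
      let ?c = "complex_of_real (1 / ?X)"
      let ?v = "vec m (\<lambda>j. ?c * x j)"
      have "vec_l2norm ?v = l2norm {..<m} (\<lambda>j. ?c * x j)"
        unfolding vec_l2norm_eq by (intro l2norm_cong) auto
      also have "\<dots> = 1" unfolding l2norm_scale using X by (simp add: norm_divide)
      finally have "vec_l2norm (A *\<^sub>v ?v) \<le> opnorm A" by (intro up) auto
      also have "vec_l2norm (A *\<^sub>v ?v) = l2norm {..<n} (\<lambda>i. ?c * (\<Sum>j<m. A $$ (i, j) * x j))"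
        unfolding vec_l2norm_mult[OF A vec_carrier]
        by (intro l2norm_cong refl) (simp add: sum_distrib_left mult.left_commute)
      also have "\<dots> = l2norm {..<n} (\<lambda>i. \<Sum>j<m. A $$ (i, j) * x j) / ?X"
        unfolding l2norm_scale using X by (simp add: norm_divide)
      finally show ?thesis using X by (simp add: field_simps)
    qed
  qed auto
qed

text \<open>The supremum that defines the operator norm is the least bound of the kernel of entries.\<close>

lemma opnorm_le_iff: "A \<in> carrier_mat n m \<Longrightarrow> 0 \<le> C \<Longrightarrow>
    opnorm A \<le> C \<longleftrightarrow> form_bounded {..<n} {..<m} (entries A) C"
  using opnorm_le form_bounded_opnorm form_bounded_mono by blast

lemma opnorm_nonneg: "A \<in> carrier_mat n m \<Longrightarrow> 0 \<le> opnorm A"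
  using form_bounded_opnorm form_bounded_nonneg by blast

lemma bij_betw_div_mod: "bij_betw (\<lambda>r. (r div d, r mod d)) {..<k * d} ({..<k} \<times> {..<d :: nat})"
proof (rule bij_betwI[where g = "\<lambda>(p, q). p * d + q"])
  show "(\<lambda>r. (r div d, r mod d)) \<in> {..<k * d} \<rightarrow> {..<k} \<times> {..<d}"
  proof
    fix r assume r: "r \<in> {..<k * d}"
    then have "d > 0" by (cases d) auto
    with r show "(r div d, r mod d) \<in> {..<k} \<times> {..<d}" by (auto simp: less_mult_imp_div_less)
  qed
  show "(\<lambda>(p, q). p * d + q) \<in> {..<k} \<times> {..<d} \<rightarrow> {..<k * d}"
  proof (clarsimp)
    fix p q assume pq: "p < k" "q < d"
    have "p * d + q < Suc p * d" using pq by simp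
    also have "\<dots> \<le> k * d" using pq by (intro mult_le_mono1) simp
    finally show "p * d + q < k * d" .
  qed
qed auto

text \<open>Matrices of size \<open>k d\<close> as matrices on pairs of indices, the block index first.\<close>

lemma form_bounded_flat:
  fixes k d :: nat
  shows "form_bounded {..<k * d} {..<k * d} (\<lambda>r c. \<kappa> (r div d, r mod d) (c div d, c mod d)) C
    \<longleftrightarrow> form_bounded_on ({..<k} \<times> {..<d}) \<kappa> C"
  using form_bounded_reindex[OF bij_betw_div_mod[of d k] bij_betw_div_mod[of d k], of \<kappa> C] by simp

lemma div_less_of_mult: "r < k * d \<Longrightarrow> r div d < (k :: nat)"
  by (rule less_mult_imp_div_less)

lemma mod_less_of_mult: "r < k * d \<Longrightarrow> r mod d < (d :: nat)"
  by (cases d) auto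

section \<open>Bounded matrix functions\<close>

lemma matrices_over_carrier: "F \<in> matrices_over S d \<Longrightarrow> F x \<in> carrier_mat d d"
  by (simp add: matrices_over_def)

lemma matrices_over_entry: "F \<in> matrices_over S d \<Longrightarrow> i < d \<Longrightarrow> j < d \<Longrightarrow> (\<lambda>x. F x $$ (i, j)) \<in> S"
  by (simp add: matrices_over_def)

lemma Linf_D: "f \<in> Linf \<Longrightarrow> f \<in> borel_measurable circle" "f \<in> Linf \<Longrightarrow> \<exists>C. AE z in circle. cmod (f z) \<le> C"
  by (auto simp: Linf_def)

lemma Linf_I: "f \<in> borel_measurable circle \<Longrightarrow> AE z in circle. cmod (f z) \<le> C \<Longrightarrow> f \<in> Linf"
  by (auto simp: Linf_def)

lemma Linf_Lp_2: "f \<in> Linf \<Longrightarrow> f \<in> Lp 2"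
  using Lp_2_bounded Linf_D by blast

lemma Linf_integrable: "f \<in> Linf \<Longrightarrow> integrable circle f"
  by (intro Lp_2_integrable Linf_Lp_2)

lemma Linf_scale: "f \<in> Linf \<Longrightarrow> (\<lambda>z. c * f z) \<in> Linf"
proof -
  assume f: "f \<in> Linf"
  then obtain C where C: "AE z in circle. cmod (f z) \<le> C" using Linf_D by blast
  show ?thesis
  proof (rule Linf_I)
    show "AE z in circle. cmod (c * f z) \<le> cmod c * C"
      using C by eventually_elim (simp add: norm_mult mult_left_mono)
  qed (rule borel_measurable_times[OF borel_measurable_const Linf_D(1)[OF f]])
qed

lemma Linf_add: "f \<in> Linf \<Longrightarrow> g \<in> Linf \<Longrightarrow> (\<lambda>z. f z + g z) \<in> Linf"
proof -
  assume fg: "f \<in> Linf" "g \<in> Linf"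
  then obtain C D where C: "AE z in circle. cmod (f z) \<le> C" "AE z in circle. cmod (g z) \<le> D" using Linf_D by metis
  show ?thesis
  proof (rule Linf_I)
    show "AE z in circle. cmod (f z + g z) \<le> C + D"
      using C by eventually_elim (meson add_mono norm_triangle_ineq order_trans)
  qed (rule borel_measurable_add[OF Linf_D(1)[OF fg(1)] Linf_D(1)[OF fg(2)]])
qed

lemma Linf_diff: "f \<in> Linf \<Longrightarrow> g \<in> Linf \<Longrightarrow> (\<lambda>z. f z - g z) \<in> Linf"
  using Linf_add[of f "\<lambda>z. (-1) * g z"] Linf_scale[of g "-1"] by simp

lemma Linf_powi [simp]: "(\<lambda>z. z powi n) \<in> Linf"
  by (rule Linf_I[where C = 1]) (auto intro!: AE_I2)

lemma Linf_sum: "finite S \<Longrightarrow> (\<And>s. s \<in> S \<Longrightarrow> f s \<in> Linf) \<Longrightarrow> (\<lambda>z. \<Sum>s\<in>S. f s z) \<in> Linf"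
proof (induction S rule: finite_induct)
  case empty
  show ?case by (rule Linf_I[where C = 0]) auto
next
  case (insert s S)
  then show ?case using Linf_add[of "f s" "\<lambda>z. \<Sum>s\<in>S. f s z"] by simp
qed

lemma Linf_cnj: "f \<in> Linf \<Longrightarrow> (\<lambda>z. cnj (f z)) \<in> Linf"
  by (auto simp: Linf_def borel_measurable_cnj)

lemma Linf_mnorm_le:
  assumes F: "F \<in> matrices_over Linf d" and C: "AE z in circle. form_bounded_on {..<d} (entries (F z)) C" "0 \<le> C"
  shows "Linf_mnorm d F \<le> C"
  unfolding Linf_mnorm_def
proof (rule cInf_lower)
  have "AE z in circle. opnorm (F z) \<le> C"
    using C(1) by eventually_elim (rule opnorm_le[OF matrices_over_carrier[OF F]])
  then show "C \<in> {C. 0 \<le> C \<and> (AE z in circle. opnorm (F z) \<le> C)}" using C by simp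
qed (auto intro: bdd_belowI[of _ 0])

text \<open>The infimum that defines the essential norm is attained: it is a countable intersection of sets
  of full measure.\<close>

lemma AE_Linf_mnorm:
  assumes F: "F \<in> matrices_over Linf d"
  shows "AE z in circle. form_bounded_on {..<d} (entries (F z)) (Linf_mnorm d F)" and "0 \<le> Linf_mnorm d F"
proof -
  let ?S = "{C. 0 \<le> C \<and> (AE z in circle. opnorm (F z) \<le> C)}"
  have "\<forall>i<d. \<forall>j<d. \<exists>C. AE z in circle. cmod (F z $$ (i, j)) \<le> C"
    using matrices_over_entry[OF F] Linf_D(2) by blast
  then obtain c where c: "\<And>i j. i < d \<Longrightarrow> j < d \<Longrightarrow> AE z in circle. cmod (F z $$ (i, j)) \<le> c i j" by metis
  define K where "K = (\<Sum>i<d. \<Sum>j<d. \<bar>c i j\<bar>)"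
  have cK: "c i j \<le> K" if "i < d" "j < d" for i j
    using member_le_sum2[of "{..<d}" "{..<d}" i j "\<lambda>i j. \<bar>c i j\<bar>"] that by (auto simp: K_def)
  have K0: "0 \<le> K" by (auto simp: K_def intro!: sum_nonneg)
  have "AE z in circle. \<forall>i\<in>{..<d}. \<forall>j\<in>{..<d}. cmod (F z $$ (i, j)) \<le> c i j"
    using c by (auto intro!: AE_finite_allI)
  then have "AE z in circle. opnorm (F z) \<le> real (card {..<d}) * real (card {..<d}) * K"
  proof eventually_elim
    case (elim z)
    then have "cmod (F z $$ (i, j)) \<le> K" if "i < d" "j < d" for i j
      using that cK[OF that] by (meson lessThan_iff order_trans)
    then show ?case using K0
      by (intro opnorm_le[OF matrices_over_carrier[OF F]] form_bounded_entriesI) auto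
  qed
  then have ne: "?S \<noteq> {}" using K0 by (auto intro!: exI[of _ "real d * real d * K"])
  show nn: "0 \<le> Linf_mnorm d F"
    unfolding Linf_mnorm_def by (rule cInf_greatest[OF ne]) auto
  have "AE z in circle. opnorm (F z) \<le> Linf_mnorm d F + 1 / real (Suc n)" for n
  proof -
    have "Inf ?S < Linf_mnorm d F + 1 / real (Suc n)" by (simp add: Linf_mnorm_def)
    from cInf_lessD[OF ne this] obtain C where C: "AE z in circle. opnorm (F z) \<le> C" "C < Linf_mnorm d F + 1 / real (Suc n)"
      by auto
    from C(1) show ?thesis by eventually_elim (use C(2) in linarith)
  qed
  then have "AE z in circle. \<forall>n. opnorm (F z) \<le> Linf_mnorm d F + 1 / real (Suc n)" by (simp add: AE_all_countable)
  then show "AE z in circle. form_bounded_on {..<d} (entries (F z)) (Linf_mnorm d F)"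
  proof eventually_elim
    case (elim z)
    have "opnorm (F z) \<le> Linf_mnorm d F"
    proof (rule field_le_epsilon)
      fix e :: real assume "e > 0"
      then obtain n where "1 / real (Suc n) < e" using nat_approx_posE by blast
      with elim[rule_format, of n] show "opnorm (F z) \<le> Linf_mnorm d F + e" by linarith
    qed
    then show ?case using opnorm_le_iff[OF matrices_over_carrier[OF F] nn] by blast
  qed
qed

section \<open>Integrals of kernels\<close>

lemma kernel_form_integral:
  assumes fin: "finite I" "finite J" and int: "\<And>i j. i \<in> I \<Longrightarrow> j \<in> J \<Longrightarrow> integrable circle (\<lambda>w. a w i j)"
  shows "kernel_form I J (\<lambda>i j. LINT w|circle. a w i j) y x = (LINT w|circle. kernel_form I J (a w) y x)"
    and "integrable circle (\<lambda>w. kernel_form I J (a w) y x)"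
proof -
  have i: "integrable circle (\<lambda>w. y i * a w i j * x j)" if "i \<in> I" "j \<in> J" for i j
    using int[OF that] by auto
  then show "integrable circle (\<lambda>w. kernel_form I J (a w) y x)"
    unfolding kernel_form_def by (intro Bochner_Integration.integrable_sum) auto
  have "(LINT w|circle. kernel_form I J (a w) y x) = (\<Sum>i\<in>I. \<Sum>j\<in>J. LINT w|circle. y i * a w i j * x j)"
    unfolding kernel_form_def using i
    by (subst Bochner_Integration.integral_sum; (intro Bochner_Integration.integrable_sum sum.cong refl)?)
       (auto simp: Bochner_Integration.integral_sum)
  then show "kernel_form I J (\<lambda>i j. LINT w|circle. a w i j) y x = (LINT w|circle. kernel_form I J (a w) y x)"
    by (simp add: kernel_form_def)
qed

text \<open>Multiplication by a bounded matrix function is bounded on square integrable vector functions. The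
  vectors here are trigonometric polynomials with coefficients \<open>y(p, i)\<close> and \<open>x(q, j)\<close>, whose norms are
  those of the coefficients as \<open>u\<close> and \<open>v\<close> are injective. The kernel is thus made of Fourier
  coefficients of \<open>G\<close>, and Hankel and Toeplitz matrices are special cases.\<close>

theorem form_bounded_integral_powi:
  assumes fin: "finite P" "finite Q" "finite I" "finite J"
    and G: "\<And>p q. p \<in> P \<Longrightarrow> q \<in> Q \<Longrightarrow> (\<lambda>w. G w p q) \<in> Linf"
    and C: "AE w in circle. form_bounded P Q (G w) C" "0 \<le> C"
    and inj: "inj_on u I" "inj_on v J"
  shows "form_bounded (P \<times> I) (Q \<times> J) (\<lambda>(p, i) (q, j). LINT w|circle. G w p q * w powi (u i + v j)) C"
proof (rule form_boundedI_squares)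
  fix y :: "'a \<times> 'c \<Rightarrow> complex" and x :: "'b \<times> 'd \<Rightarrow> complex"
  define Y where "Y w p = (\<Sum>i\<in>I. y (p, i) * w powi u i)" for w p
  define X where "X w q = (\<Sum>j\<in>J. x (q, j) * w powi v j)" for w q
  define a where "a w = (\<lambda>(p, i) (q, j). G w p q * w powi (u i + v j))" for w
  let ?a = "\<lambda>(p, i) (q, j). LINT w|circle. G w p q * w powi (u i + v j)"
  have int: "integrable circle (\<lambda>w. a w s t)" if st: "s \<in> P \<times> I" "t \<in> Q \<times> J" for s t
  proof -
    obtain p i q j where "s = (p, i)" "t = (q, j)" "p \<in> P" "q \<in> Q" using st by auto
    then show ?thesis using integrable_powi_mult[OF Linf_integrable[OF G]] by (simp add: a_def)
  qed
  have a_eq: "?a = (\<lambda>s t. LINT w|circle. a w s t)" by (auto simp: a_def fun_eq_iff)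
  have fin': "finite (P \<times> I)" "finite (Q \<times> J)" using fin by auto
  have form: "kernel_form (P \<times> I) (Q \<times> J) (a w) y x = kernel_form P Q (G w) (Y w) (X w)"
    if "w \<in> space circle" for w
  proof -
    have "kernel_form (P \<times> I) (Q \<times> J) (a w) y x
      = (\<Sum>p\<in>P. \<Sum>i\<in>I. \<Sum>q\<in>Q. \<Sum>j\<in>J. (y (p, i) * w powi u i) * G w p q * (x (q, j) * w powi v j))"
      using that by (simp add: kernel_form_def sum_Times a_def powi_add_circle mult_ac)
    also have "\<dots> = (\<Sum>p\<in>P. \<Sum>q\<in>Q. \<Sum>i\<in>I. \<Sum>j\<in>J. (y (p, i) * w powi u i) * G w p q * (x (q, j) * w powi v j))"
      by (intro sum.cong refl sum.swap)
    also have "\<dots> = (\<Sum>p\<in>P. \<Sum>q\<in>Q. \<Sum>j\<in>J. \<Sum>i\<in>I. (y (p, i) * w powi u i) * G w p q * (x (q, j) * w powi v j))"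
      by (intro sum.cong refl sum.swap)
    also have "\<dots> = kernel_form P Q (G w) (Y w) (X w)"
      by (simp add: kernel_form_def Y_def X_def sum_distrib_left sum_distrib_right) 
    finally show ?thesis .
  qed
  have Y2: "(\<lambda>w. Y w p) \<in> Lp 2" and X2: "(\<lambda>w. X w q) \<in> Lp 2" for p q
    unfolding Y_def X_def by (rule Lp_2_trig)+
  have iY: "integrable circle (\<lambda>w. (l2norm P (Y w))\<^sup>2)" and iX: "integrable circle (\<lambda>w. (l2norm Q (X w))\<^sup>2)"
    unfolding l2norm_power2 using Y2 X2 by (auto simp: Lp_2_iff)
  have LY: "(LINT w|circle. (l2norm P (Y w))\<^sup>2) = (l2norm (P \<times> I) y)\<^sup>2"
  proof -
    have "(LINT w|circle. (l2norm P (Y w))\<^sup>2) = (\<Sum>p\<in>P. l2int (\<lambda>w. Y w p))"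
      unfolding l2norm_power2 l2int_def using Y2 by (subst Bochner_Integration.integral_sum) (auto simp: Lp_2_iff)
    also have "\<dots> = (l2norm (P \<times> I) y)\<^sup>2"
      unfolding l2norm_power2 sum_Times Y_def using fin inj by (intro sum.cong refl l2int_trig)
    finally show ?thesis .
  qed
  have LX: "(LINT w|circle. (l2norm Q (X w))\<^sup>2) = (l2norm (Q \<times> J) x)\<^sup>2"
  proof -
    have "(LINT w|circle. (l2norm Q (X w))\<^sup>2) = (\<Sum>p\<in>Q. l2int (\<lambda>w. X w p))"
      unfolding l2norm_power2 l2int_def using X2 by (subst Bochner_Integration.integral_sum) (auto simp: Lp_2_iff)
    also have "\<dots> = (l2norm (Q \<times> J) x)\<^sup>2"
      unfolding l2norm_power2 sum_Times X_def using fin inj by (intro sum.cong refl l2int_trig)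
    finally show ?thesis .
  qed
  have "cmod (kernel_form (P \<times> I) (Q \<times> J) ?a y x) = cmod (LINT w|circle. kernel_form (P \<times> I) (Q \<times> J) (a w) y x)"
    unfolding a_eq by (subst kernel_form_integral(1)[OF fin' int]) auto
  also have "\<dots> \<le> (LINT w|circle. cmod (kernel_form (P \<times> I) (Q \<times> J) (a w) y x))"
    by (rule integral_norm_bound)
  also have "\<dots> \<le> (LINT w|circle. C * ((l2norm P (Y w))\<^sup>2 + (l2norm Q (X w))\<^sup>2) / 2)"
  proof (rule integral_mono_AE)
    show "integrable circle (\<lambda>w. cmod (kernel_form (P \<times> I) (Q \<times> J) (a w) y x))"
      by (intro integrable_norm kernel_form_integral(2)[OF fin' int])
    show "integrable circle (\<lambda>w. C * ((l2norm P (Y w))\<^sup>2 + (l2norm Q (X w))\<^sup>2) / 2)" using iX iY by auto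
    show "AE w in circle. cmod (kernel_form (P \<times> I) (Q \<times> J) (a w) y x) \<le> C * ((l2norm P (Y w))\<^sup>2 + (l2norm Q (X w))\<^sup>2) / 2"
      using C(1) AE_space
    proof eventually_elim
      case (elim w)
      have "cmod (kernel_form P Q (G w) (Y w) (X w)) \<le> C * l2norm P (Y w) * l2norm Q (X w)"
        by (rule form_boundedD[OF elim(1)]) (use fin in auto)
      also have "\<dots> = C * (l2norm P (Y w) * l2norm Q (X w))" by simp
      also have "\<dots> \<le> C * (((l2norm P (Y w))\<^sup>2 + (l2norm Q (X w))\<^sup>2) / 2)"
        using sum_squares_bound[of "l2norm P (Y w)" "l2norm Q (X w)"] C(2) by (intro mult_left_mono) auto
      finally show ?case unfolding form[OF elim(2)] by simp
    qed
  qed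
  also have "\<dots> = C * ((l2norm (P \<times> I) y)\<^sup>2 + (l2norm (Q \<times> J) x)\<^sup>2) / 2"
    unfolding LX[symmetric] LY[symmetric] using iX iY by simp
  finally show "cmod (kernel_form (P \<times> I) (Q \<times> J) ?a y x) \<le> C * ((l2norm (P \<times> I) y)\<^sup>2 + (l2norm (Q \<times> J) x)\<^sup>2) / 2" .
qed (use fin C in auto)

lemma form_bounded_integral_weight:
  assumes fin: "finite P" "finite Q"
    and G: "\<And>p q. p \<in> P \<Longrightarrow> q \<in> Q \<Longrightarrow> (\<lambda>w. G w p q) \<in> Linf"
    and C: "AE w in circle. form_bounded P Q (G w) C" "0 \<le> C" and f: "integrable circle f"
  shows "form_bounded P Q (\<lambda>p q. LINT w|circle. G w p q * f w) (C * (LINT w|circle. cmod (f w)))"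
proof (rule form_bounded_finiteI[OF fin])
  show "0 \<le> C * (LINT w|circle. cmod (f w))" using C by simp
  fix y x
  have int: "integrable circle (\<lambda>w. G w p q * f w)" if pq: "p \<in> P" "q \<in> Q" for p q
  proof -
    obtain c where "AE w in circle. cmod (G w p q) \<le> c" using Linf_D(2)[OF G[OF pq]] by blast
    then show ?thesis using Linf_D(1)[OF G[OF pq]] f integrable_mult_bounded_circle by blast
  qed
  have "cmod (kernel_form P Q (\<lambda>p q. LINT w|circle. G w p q * f w) y x)
      = cmod (LINT w|circle. kernel_form P Q (\<lambda>p q. G w p q * f w) y x)"
    by (subst kernel_form_integral(1)[OF fin int]) auto
  also have "\<dots> \<le> (LINT w|circle. cmod (kernel_form P Q (\<lambda>p q. G w p q * f w) y x))"
    by (rule integral_norm_bound)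
  also have "\<dots> \<le> (LINT w|circle. (C * l2norm P y * l2norm Q x) * cmod (f w))"
  proof (rule integral_mono_AE)
    show "integrable circle (\<lambda>w. cmod (kernel_form P Q (\<lambda>p q. G w p q * f w) y x))"
      by (intro integrable_norm kernel_form_integral(2)[OF fin int])
    show "AE w in circle. cmod (kernel_form P Q (\<lambda>p q. G w p q * f w) y x) \<le> (C * l2norm P y * l2norm Q x) * cmod (f w)"
      using C(1)
    proof eventually_elim
      case (elim w)
      have "kernel_form P Q (\<lambda>p q. G w p q * f w) y x = kernel_form P Q (G w) y x * f w"
        by (simp add: kernel_form_def sum_distrib_left sum_distrib_right mult_ac)
      then show ?case using form_boundedD[OF elim fin subset_refl subset_refl, of y x]
        by (simp add: norm_mult mult_right_mono)
    qed
  qed (use f in auto)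
  also have "\<dots> = C * (LINT w|circle. cmod (f w)) * l2norm P y * l2norm Q x" by simp
  finally show "cmod (kernel_form P Q (\<lambda>p q. LINT w|circle. G w p q * f w) y x)
      \<le> C * (LINT w|circle. cmod (f w)) * l2norm P y * l2norm Q x" .
qed

section \<open>The norm of matrices over the predual\<close>

text \<open>The matrix \<open>\<integral> G \<otimes> F\<close>.\<close>

definition pairing :: "(complex \<Rightarrow> 'p \<Rightarrow> 'p \<Rightarrow> complex) \<Rightarrow> (complex \<Rightarrow> complex mat) \<Rightarrow> 'p \<times> nat \<Rightarrow> 'p \<times> nat \<Rightarrow> complex" where
  "pairing G F = (\<lambda>(p, i) (q, j). LINT z|circle. G z p q * F z $$ (i, j))"

lemma amplify_mat_integral:
  assumes F: "F \<in> matrices_over S d"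
  shows "amplify k d (\<lambda>g _. mat_integral d (\<lambda>z. g z \<cdot>\<^sub>m F z)) G ()
    = mat (k * d) (k * d) (\<lambda>(r, c). pairing (\<lambda>z. entries (G z)) F (r div d, r mod d) (c div d, c mod d))"
  unfolding amplify_def
proof (intro eq_matI, goal_cases)
  case (1 r c)
  then have "r mod d < d" "c mod d < d" by (auto intro: mod_less_of_mult)
  moreover from this have "(G z $$ (r div d, c div d) \<cdot>\<^sub>m F z) $$ (r mod d, c mod d)
      = G z $$ (r div d, c div d) * F z $$ (r mod d, c mod d)" for z
    using matrices_over_carrier[OF F, of z] by simp
  ultimately show ?case using 1 by (simp add: mat_integral_def pairing_def)
qed auto

lemma opnorm_amplify_le_iff:
  assumes F: "F \<in> matrices_over S d" and "0 \<le> C"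
  shows "opnorm (amplify k d (\<lambda>g _. mat_integral d (\<lambda>z. g z \<cdot>\<^sub>m F z)) G ()) \<le> C
    \<longleftrightarrow> form_bounded_on ({..<k} \<times> {..<d}) (pairing (\<lambda>z. entries (G z)) F) C"
proof -
  let ?M = "mat (k * d) (k * d) (\<lambda>(r, c). pairing (\<lambda>z. entries (G z)) F (r div d, r mod d) (c div d, c mod d))"
  have "opnorm ?M \<le> C \<longleftrightarrow> form_bounded {..<k * d} {..<k * d} (entries ?M) C"
    using assms(2) by (intro opnorm_le_iff) auto
  also have "\<dots> \<longleftrightarrow> form_bounded {..<k * d} {..<k * d}
      (\<lambda>r c. pairing (\<lambda>z. entries (G z)) F (r div d, r mod d) (c div d, c mod d)) C"
    by (intro form_bounded_cong) auto
  also have "\<dots> \<longleftrightarrow> form_bounded_on ({..<k} \<times> {..<d}) (pairing (\<lambda>z. entries (G z)) F) C"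
    by (rule form_bounded_flat)
  finally show ?thesis unfolding amplify_mat_integral[OF F] .
qed

text \<open>The supremum that defines the norm over \<open>L\<^sup>1\<close> is finite.\<close>

lemma pairing_crude_bound:
  assumes F: "F \<in> matrices_over (Lp 1) d" and P: "finite P"
    and G: "\<And>p q. p \<in> P \<Longrightarrow> q \<in> P \<Longrightarrow> (\<lambda>w. G w p q) \<in> Linf"
    and C: "AE w in circle. form_bounded_on P (G w) C" "0 \<le> C"
  shows "form_bounded_on (P \<times> {..<d}) (pairing G F)
           (\<Sum>i<d. \<Sum>j<d. C * (LINT z|circle. cmod (F z $$ (i, j))))"
proof -
  have "form_bounded_on (P \<times> {..<d})
      (\<lambda>(p, i) (q, j). LINT z|circle. G z p q * F z $$ (i, j))
      (\<Sum>i<d. \<Sum>j<d. C * (LINT z|circle. cmod (F z $$ (i, j))))"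
    using matrices_over_entry[OF F]
    by (intro form_bounded_blocks[where a = "\<lambda>i j p q. LINT z|circle. G z p q * F z $$ (i, j)"]
        form_bounded_integral_weight[OF P P G C]) (auto simp: Lp_1_iff)
  then show ?thesis unfolding pairing_def .
qed

lemma zero_matrix_Linf:
  "(\<lambda>_. 0\<^sub>m 1 1) \<in> matrices_over Linf 1"
  "AE z in circle. form_bounded_on {..<1} (entries (0\<^sub>m 1 1)) 1"
proof -
  show "(\<lambda>_. 0\<^sub>m 1 1) \<in> matrices_over Linf 1" by (auto simp: matrices_over_def Linf_def)
  have "form_bounded_on {..<1} (\<lambda>i j. (0 :: complex)) 1" by simp
  then have "form_bounded_on {..<1} (entries (0\<^sub>m 1 1)) 1" by (rule iffD1[OF form_bounded_cong, rotated]) simp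
  then show "AE z in circle. form_bounded_on {..<1} (entries (0\<^sub>m 1 1)) 1" by simp
qed

lemma L1_mnorm_sup:
  assumes F: "F \<in> matrices_over (Lp 1) d"
  defines "S \<equiv> {mnorm scalar_field (k * d) (amplify k d (\<lambda>g _. mat_integral d (\<lambda>z. g z \<cdot>\<^sub>m F z)) G) | k G.
      1 \<le> k \<and> G \<in> mcarr Linf_space k \<and> mnorm Linf_space k G \<le> 1}"
  shows "bdd_above S" "S \<noteq> {}" "L1_mnorm d F = Sup S"
proof -
  show "L1_mnorm d F = Sup S" by (simp add: L1_mnorm_def cb_norm_def S_def)
  show "bdd_above S"
  proof (rule bdd_aboveI)
    fix r assume "r \<in> S"
    then obtain k G where r: "r = mnorm scalar_field (k * d) (amplify k d (\<lambda>g _. mat_integral d (\<lambda>z. g z \<cdot>\<^sub>m F z)) G)"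
      and G: "G \<in> matrices_over Linf k" "Linf_mnorm k G \<le> 1" unfolding S_def Linf_space_def by auto
    have "AE z in circle. form_bounded_on {..<k} (entries (G z)) 1"
      using AE_Linf_mnorm(1)[OF G(1)] by eventually_elim (rule form_bounded_mono[OF _ G(2)])
    then have fb: "form_bounded_on ({..<k} \<times> {..<d}) (pairing (\<lambda>z. entries (G z)) F)
           (\<Sum>i<d. \<Sum>j<d. 1 * (LINT z|circle. cmod (F z $$ (i, j))))"
      by (intro pairing_crude_bound[OF F] matrices_over_entry[OF G(1)]) auto
    show "r \<le> (\<Sum>i<d. \<Sum>j<d. LINT z|circle. cmod (F z $$ (i, j)))"
      unfolding r scalar_field_def
      using iffD2[OF opnorm_amplify_le_iff[OF F form_bounded_nonneg[OF fb]] fb] by simp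
  qed
  note zero_matrix_Linf(1)
  moreover have "Linf_mnorm 1 (\<lambda>_. 0\<^sub>m 1 1) \<le> 1"
    by (rule Linf_mnorm_le[OF zero_matrix_Linf]) simp
  ultimately show "S \<noteq> {}" unfolding S_def Linf_space_def by (auto intro!: exI[of _ "1::nat"])
qed

lemma L1_mnorm_le:
  assumes F: "F \<in> matrices_over (Lp 1) d" and D: "0 \<le> D"
    and G: "\<And>k G. G \<in> matrices_over Linf k \<Longrightarrow> AE z in circle. form_bounded_on {..<k} (entries (G z)) 1 \<Longrightarrow>
      form_bounded_on ({..<k} \<times> {..<d}) (pairing (\<lambda>z. entries (G z)) F) D"
  shows "L1_mnorm d F \<le> D"
  unfolding L1_mnorm_sup(3)[OF F]
proof (rule cSup_least[OF L1_mnorm_sup(2)[OF F]])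
  fix r assume "r \<in> {mnorm scalar_field (k * d) (amplify k d (\<lambda>g _. mat_integral d (\<lambda>z. g z \<cdot>\<^sub>m F z)) G) | k G.
      1 \<le> k \<and> G \<in> mcarr Linf_space k \<and> mnorm Linf_space k G \<le> 1}"
  then obtain k G where r: "r = mnorm scalar_field (k * d) (amplify k d (\<lambda>g _. mat_integral d (\<lambda>z. g z \<cdot>\<^sub>m F z)) G)"
    and G1: "G \<in> matrices_over Linf k" "Linf_mnorm k G \<le> 1" unfolding Linf_space_def by auto
  have "AE z in circle. form_bounded_on {..<k} (entries (G z)) 1"
    using AE_Linf_mnorm(1)[OF G1(1)] by eventually_elim (rule form_bounded_mono[OF _ G1(2)])
  from G[OF G1(1) this] show "r \<le> D"
    unfolding r scalar_field_def using opnorm_amplify_le_iff[OF F D] by simp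
qed

lemma pairing_bound_nat:
  assumes F: "F \<in> matrices_over (Lp 1) d"
    and G: "G \<in> matrices_over Linf k" "1 \<le> k" "AE z in circle. form_bounded_on {..<k} (entries (G z)) 1"
  shows "form_bounded_on ({..<k} \<times> {..<d}) (pairing (\<lambda>z. entries (G z)) F) (L1_mnorm d F)"
    and "0 \<le> L1_mnorm d F"
proof -
  let ?A = "amplify k d (\<lambda>g _. mat_integral d (\<lambda>z. g z \<cdot>\<^sub>m F z)) G ()"
  have "opnorm ?A \<le> L1_mnorm d F"
    unfolding L1_mnorm_sup(3)[OF F]
    by (rule cSup_upper[OF _ L1_mnorm_sup(1)[OF F]])
      (use G Linf_mnorm_le[OF G(1) G(3)] in \<open>auto simp: Linf_space_def scalar_field_def intro!: exI[of _ k] exI[of _ G]\<close>)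
  moreover have "0 \<le> opnorm ?A" by (rule opnorm_nonneg[of _ "k * d" "k * d"]) (simp add: amplify_def)
  ultimately show nn: "0 \<le> L1_mnorm d F" by linarith
  with \<open>opnorm ?A \<le> L1_mnorm d F\<close>
  show "form_bounded_on ({..<k} \<times> {..<d}) (pairing (\<lambda>z. entries (G z)) F) (L1_mnorm d F)"
    using opnorm_amplify_le_iff[OF F nn] by simp
qed

lemma L1_mnorm_nonneg:
  assumes F: "F \<in> matrices_over (Lp 1) d" shows "0 \<le> L1_mnorm d F"
  by (rule pairing_bound_nat(2)[OF F zero_matrix_Linf(1) _ zero_matrix_Linf(2)]) simp

text \<open>The norm over \<open>L\<^sup>1\<close> controls the pairing with bounded matrix functions on any finite index set; in
  applications that set is itself a product.\<close>

theorem pairing_bound: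
  fixes P :: "'p set"
  assumes F: "F \<in> matrices_over (Lp 1) d" and P: "finite P"
    and G: "\<And>p q. p \<in> P \<Longrightarrow> q \<in> P \<Longrightarrow> (\<lambda>w. G w p q) \<in> Linf"
    and C: "AE w in circle. form_bounded_on P (G w) C" "0 \<le> C"
  shows "form_bounded_on (P \<times> {..<d}) (pairing G F) (C * L1_mnorm d F)"
proof (cases "P = {}")
  case True
  then show ?thesis using C(2) L1_mnorm_nonneg[OF F]
    by (intro form_bounded_finiteI) (auto simp: kernel_form_def l2norm_def)
next
  case False
  define k where "k = card P"
  have k: "1 \<le> k" using False P by (simp add: k_def Suc_le_eq card_gt_0_iff)
  obtain h where h: "bij_betw h {..<k} P"
    using ex_bij_betw_nat_finite[OF P] unfolding k_def atLeast0LessThan by auto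
  have hP: "h i \<in> P" if "i < k" for i using that bij_betwE[OF h] by auto
  have main: "form_bounded_on (P \<times> {..<d}) (pairing G F) ((C + e) * L1_mnorm d F)" if e: "e > 0" for e
  proof -
    have Ce: "C + e > 0" using e C by simp
    let ?c = "complex_of_real (1 / (C + e))"
    define H where "H z = mat k k (\<lambda>(i, j). ?c * G z (h i) (h j))" for z
    have H: "H \<in> matrices_over Linf k"
      unfolding matrices_over_def H_def using G hP by (auto intro!: Linf_scale simp del: of_real_divide of_real_add)
    have "AE z in circle. form_bounded_on {..<k} (entries (H z)) 1"
      using C(1)
    proof eventually_elim
      case (elim z)
      have "form_bounded_on {..<k} (\<lambda>i j. G z (h i) (h j)) C"
        by (rule form_bounded_compress[OF elim]) (use h in \<open>auto simp: bij_betw_def\<close>)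
      from form_bounded_scale[OF this, of ?c]
      have "form_bounded_on {..<k} (\<lambda>i j. ?c * G z (h i) (h j)) (cmod ?c * C)" .
      moreover have "cmod ?c * C \<le> 1" using Ce C(2) e by (simp add: norm_divide del: of_real_add)
      ultimately have "form_bounded_on {..<k} (\<lambda>i j. ?c * G z (h i) (h j)) 1" by (rule form_bounded_mono)
      then show ?case by (rule iffD1[OF form_bounded_cong, rotated]) (simp add: H_def)
    qed
    from pairing_bound_nat(1)[OF F H k this]
    have 1: "form_bounded_on ({..<k} \<times> {..<d}) (\<lambda>x y. of_real (C + e) * pairing (\<lambda>z. entries (H z)) F x y)
        (cmod (of_real (C + e)) * L1_mnorm d F)" by (rule form_bounded_scale)
    have 2: "of_real (C + e) * pairing (\<lambda>z. entries (H z)) F x y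
        = pairing G F (h (fst x), snd x) (h (fst y), snd y)"
      if xy: "x \<in> {..<k} \<times> {..<d}" "y \<in> {..<k} \<times> {..<d}" for x y
    proof -
      obtain p i q j where eq: "x = (p, i)" "y = (q, j)" "p < k" "q < k" using xy by auto
      have "of_real (C + e) * pairing (\<lambda>z. entries (H z)) F x y
        = of_real (C + e) * (LINT z|circle. ?c * (G z (h p) (h q) * F z $$ (i, j)))"
        using eq by (simp add: pairing_def H_def mult.assoc)
      also have "\<dots> = of_real (C + e) * (?c * (LINT z|circle. G z (h p) (h q) * F z $$ (i, j)))"
        by (simp only: integral_mult_right_zero)
      also have "\<dots> = (LINT z|circle. G z (h p) (h q) * F z $$ (i, j))"
        using Ce by (simp flip: of_real_mult add: mult.assoc[symmetric] del: of_real_add)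
      finally show ?thesis by (simp add: eq pairing_def)
    qed
    have 3: "cmod (of_real (C + e)) = C + e" using Ce by (simp del: of_real_add)
    have *: "form_bounded_on ({..<k} \<times> {..<d})
        (\<lambda>x y. pairing G F (h (fst x), snd x) (h (fst y), snd y)) ((C + e) * L1_mnorm d F)"
      using 1 unfolding 3 by (simp only: 2 cong: form_bounded_cong)
    have b: "bij_betw (\<lambda>x. (h (fst x), snd x)) ({..<k} \<times> {..<d}) (P \<times> {..<d})"
      using h by (auto simp: bij_betw_def inj_on_def image_iff intro!: bexI)
    show ?thesis using * unfolding form_bounded_reindex[OF b b] .
  qed
  show ?thesis
  proof (rule form_bounded_tendsto[where F = sequentially])
    show "\<forall>\<^sub>F n in sequentially. form_bounded_on (P \<times> {..<d}) (pairing G F) ((C + 1 / real (Suc n)) * L1_mnorm d F)"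
      by (intro always_eventually allI main) auto
    have "(\<lambda>n. C + 1 / real (Suc n)) \<longlonglongrightarrow> C"
      using tendsto_add[OF tendsto_const LIMSEQ_Suc[OF lim_1_over_n], of C] by simp
    then show "(\<lambda>n. (C + 1 / real (Suc n)) * L1_mnorm d F) \<longlonglongrightarrow> C * L1_mnorm d F" by (intro tendsto_intros)
  qed auto
qed

lemma L1_mnorm_mono_AE:
  assumes F: "F \<in> matrices_over (Lp 1) d" "F' \<in> matrices_over (Lp 1) d"
    and eq: "\<And>i j. i < d \<Longrightarrow> j < d \<Longrightarrow> AE z in circle. F z $$ (i, j) = F' z $$ (i, j)"
  shows "L1_mnorm d F \<le> L1_mnorm d F'"
proof (rule L1_mnorm_le[OF F(1) L1_mnorm_nonneg[OF F(2)]])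
  fix k G assume G: "G \<in> matrices_over Linf k" "AE z in circle. form_bounded_on {..<k} (entries (G z)) 1"
  have "form_bounded_on ({..<k} \<times> {..<d}) (pairing (\<lambda>z. entries (G z)) F') (1 * L1_mnorm d F')"
    by (rule pairing_bound[OF F(2)]) (use G matrices_over_entry[OF G(1)] in auto)
  moreover have "pairing (\<lambda>z. entries (G z)) F x y = pairing (\<lambda>z. entries (G z)) F' x y"
    if xy: "x \<in> {..<k} \<times> {..<d}" "y \<in> {..<k} \<times> {..<d}" for x y
  proof -
    obtain p i q j where *: "x = (p, i)" "y = (q, j)" "p < k" "q < k" "i < d" "j < d" using xy by auto
    have m: "(\<lambda>z. F z $$ (i, j)) \<in> borel_measurable circle" "(\<lambda>z. F' z $$ (i, j)) \<in> borel_measurable circle"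
      "(\<lambda>z. G z $$ (p, q)) \<in> borel_measurable circle"
      using matrices_over_entry[OF F(1)] matrices_over_entry[OF F(2)] matrices_over_entry[OF G(1)] *
      by (auto simp: Lp_def Linf_def)
    show ?thesis unfolding *(1,2) pairing_def prod.case
    proof (rule integral_cong_AE)
      show "AE z in circle. G z $$ (p, q) * F z $$ (i, j) = G z $$ (p, q) * F' z $$ (i, j)"
        using eq[OF *(5,6)] by eventually_elim simp
    qed (use m in \<open>auto intro!: borel_measurable_times\<close>)
  qed
  ultimately show "form_bounded_on ({..<k} \<times> {..<d}) (pairing (\<lambda>z. entries (G z)) F) (L1_mnorm d F')"
    by (subst form_bounded_cong[where b = "pairing (\<lambda>z. entries (G z)) F'"]) auto
qed

section \<open>Spaces of series and the Hardy space of integrable functions\<close>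

lemma coeffs_carrier [simp]: "coeffs d F n \<in> carrier_mat d d"
  by (simp add: coeffs_def)

lemma coeffs_entry: "i < d \<Longrightarrow> j < d \<Longrightarrow> coeffs d F n $$ (i, j) = fourier (\<lambda>z. F z $$ (i, j)) (int n)"
  by (simp add: coeffs_def)

text \<open>The definite description in the norm of a series denotes the norm of any representing function
  as soon as all of them have the same norm.\<close>

lemma mnorm_series_space:
  assumes "F \<in> mcarr X d" "\<And>F'. F' \<in> mcarr X d \<Longrightarrow> coeffs d F' = coeffs d F \<Longrightarrow> mnorm X d F' = mnorm X d F"
  shows "mnorm (series_space X) d (coeffs d F) = mnorm X d F"
proof -
  have "(THE r. \<exists>F'\<in>mcarr X d. coeffs d F' = coeffs d F \<and> r = mnorm X d F') = mnorm X d F"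
  proof (rule the_equality)
    show "\<exists>F'\<in>mcarr X d. coeffs d F' = coeffs d F \<and> mnorm X d F = mnorm X d F'" using assms(1) by blast
    fix r assume "\<exists>F'\<in>mcarr X d. coeffs d F' = coeffs d F \<and> r = mnorm X d F'"
    then show "r = mnorm X d F" using assms(2) by blast
  qed
  then show ?thesis by (simp add: series_space_def)
qed

lemma mcarr_series_space: "mcarr (series_space X) d = coeffs d ` mcarr X d"
  by (simp add: series_space_def)

lemma Hp_1_integrable: "f \<in> Hp 1 \<Longrightarrow> integrable circle f"
  by (simp add: Hp_def Lp_1_iff)

lemma Hp_neg: "f \<in> Hp p \<Longrightarrow> n < 0 \<Longrightarrow> fourier f n = 0"
  by (simp add: Hp_def)

lemma matrices_over_mono: "S \<subseteq> T \<Longrightarrow> F \<in> matrices_over S d \<Longrightarrow> F \<in> matrices_over T d"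
  by (auto simp: matrices_over_def)

lemma Hp_Lp: "F \<in> matrices_over (Hp p) d \<Longrightarrow> F \<in> matrices_over (Lp p) d"
  by (rule matrices_over_mono) (auto simp: Hp_def)

lemma fourier_eq_AE:
  assumes "integrable circle f" "integrable circle g" "\<And>n. fourier f n = fourier g n"
  shows "AE z in circle. f z = g z"
proof -
  have "fourier_null (\<lambda>z. f z - g z)"
    unfolding fourier_null_def using assms by (auto simp: fourier_diff)
  from fourier_null_AE_zero[OF this] show ?thesis by eventually_elim simp
qed

lemma H1_mcarr: "mcarr H1 d = coeffs d ` matrices_over (Hp 1) d"
  by (simp add: H1_def mcarr_series_space)

text \<open>Functions in \<open>H\<^sup>1\<close> with the same coefficients agree almost everywhere, so the norm of a series is
  well defined.\<close>

lemma H1_mnorm: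
  assumes F: "F \<in> matrices_over (Hp 1) d"
  shows "mnorm H1 d (coeffs d F) = L1_mnorm d F"
proof -
  have le: "L1_mnorm d F \<le> L1_mnorm d F'"
    if F: "F \<in> matrices_over (Hp 1) d" "F' \<in> matrices_over (Hp 1) d" and eq: "coeffs d F' = coeffs d F" for F F'
  proof (rule L1_mnorm_mono_AE[OF Hp_Lp[OF F(1)] Hp_Lp[OF F(2)]])
    fix i j assume ij: "i < d" "j < d"
    note H = matrices_over_entry[OF F(1) ij] matrices_over_entry[OF F(2) ij]
    show "AE z in circle. F z $$ (i, j) = F' z $$ (i, j)"
    proof (rule fourier_eq_AE)
      fix n
      show "fourier (\<lambda>z. F z $$ (i, j)) n = fourier (\<lambda>z. F' z $$ (i, j)) n"
      proof (cases "n < 0")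
        case True then show ?thesis using Hp_neg[OF H(1)] Hp_neg[OF H(2)] by simp
      next
        case False
        then have "coeffs d F (nat n) $$ (i, j) = coeffs d F' (nat n) $$ (i, j)" using eq by simp
        then show ?thesis using False ij by (simp add: coeffs_entry)
      qed
    qed (use H Hp_1_integrable in auto)
  qed
  show ?thesis
    unfolding H1_def by (subst mnorm_series_space) (use F le in \<open>auto intro!: antisym\<close>)
qed

section \<open>Hankel kernels, Fejer means and Nehari's theorem\<close>

lemma form_bounded_UNIV_nat:
  assumes "0 \<le> C" "\<And>N. form_bounded ({..<N} \<times> D) ({..<N} \<times> E) a C"
  shows "form_bounded (UNIV \<times> D) ((UNIV :: nat set) \<times> E) a C"
  unfolding form_bounded_def
proof (intro conjI allI impI)
  fix I' J' and y x :: "_ \<Rightarrow> complex"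
  assume *: "finite I'" "finite J'" "I' \<subseteq> (UNIV :: nat set) \<times> D" "J' \<subseteq> (UNIV :: nat set) \<times> E"
  obtain N where N: "fst ` I' \<union> fst ` J' \<subseteq> {..<N}" using * finite_nat_iff_bounded by (metis finite_UnI finite_imageI)
  have "I' \<subseteq> {..<N} \<times> D" "J' \<subseteq> {..<N} \<times> E" using N *(3,4) by force+
  then show "cmod (kernel_form I' J' a y x) \<le> C * l2norm I' y * l2norm J' x"
    by (intro form_boundedD[OF assms(2)] *(1,2))
qed (rule assms(1))

definition hankel_bounded :: "nat \<Rightarrow> (nat \<Rightarrow> complex mat) \<Rightarrow> real \<Rightarrow> bool" where
  "hankel_bounded d a C \<longleftrightarrow>
     form_bounded_on (UNIV \<times> {..<d}) (hankel (\<lambda>n. entries (a n))) C"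

lemma inj_on_uminus_int: "inj_on (\<lambda>i. - int i) A"
  by (simp add: inj_on_def)

text \<open>The easy half of Nehari's theorem: a Hankel matrix of Fourier coefficients compresses the
  multiplication by the function.\<close>

lemma hankel_bounded_coeffs:
  assumes F: "F \<in> matrices_over Linf d" and C: "AE z in circle. form_bounded_on {..<d} (entries (F z)) C" "0 \<le> C"
  shows "hankel_bounded d (coeffs d F) C"
  unfolding hankel_bounded_def
proof (rule form_bounded_UNIV_nat[OF C(2)])
  fix N
  let ?a = "\<lambda>(\<alpha>, p) (\<beta>, q). LINT z|circle. F z $$ (\<alpha>, \<beta>) * z powi (- int p + - int q)"
  have "form_bounded_on ({..<d} \<times> {..<N}) ?a C"
    by (rule form_bounded_integral_powi)
      (use matrices_over_entry[OF F] C in \<open>auto simp: inj_on_uminus_int\<close>)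
  then show "form_bounded_on ({..<N} \<times> {..<d}) (hankel (\<lambda>n. entries (coeffs d F n))) C"
    by (rule form_bounded_transfer[where f = "\<lambda>(p, \<alpha>). (\<alpha>, p)"])
       (auto simp: inj_on_def hankel_def coeffs_entry fourier_def)
qed

text \<open>The Fejer weight \<open>1 - |k| / (M + 1)\<close>, cut off at zero.\<close>

definition fejer_weight :: "nat \<Rightarrow> int \<Rightarrow> real" where
  "fejer_weight M k = real (nat (int (Suc M) - \<bar>k\<bar>)) / real (Suc M)"

lemma fejer_weight_bounds: "0 \<le> fejer_weight M k" "fejer_weight M k \<le> 1"
  by (auto simp: fejer_weight_def)

lemma fejer_weight_zero: "\<bar>k\<bar> > int M \<Longrightarrow> fejer_weight M k = 0"
  by (simp add: fejer_weight_def)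

lemma fejer_weight_tendsto: "(\<lambda>M. fejer_weight M k) \<longlonglongrightarrow> 1"
proof -
  have "(\<lambda>M. 1 - real_of_int \<bar>k\<bar> / real (Suc M)) \<longlonglongrightarrow> 1 - real_of_int \<bar>k\<bar> * 0"
    unfolding divide_inverse by (intro tendsto_intros LIMSEQ_inverse_real_of_nat)
  moreover have "\<forall>\<^sub>F M in sequentially. 1 - real_of_int \<bar>k\<bar> / real (Suc M) = fejer_weight M k"
    using eventually_ge_at_top[of "nat \<bar>k\<bar>"]
  proof eventually_elim
    case (elim M)
    then have "real (nat (int (Suc M) - \<bar>k\<bar>)) = real (Suc M) - real_of_int \<bar>k\<bar>" by (simp add: of_nat_diff)
    then show ?case by (simp add: fejer_weight_def diff_divide_distrib)
  qed
  ultimately show ?thesis by (simp add: tendsto_cong)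
qed

lemma card_diff_eq:
  "card {x \<in> {..M} \<times> {..M}. int (fst x) - int (snd x) = k} = nat (int (Suc M) - \<bar>k\<bar>)"
proof (cases "k \<ge> 0")
  case True
  have "{x \<in> {..M} \<times> {..M}. int (fst x) - int (snd x) = k} = (\<lambda>q. (q + nat k, q)) ` {..<Suc M - nat k}"
    using True by (auto simp: image_iff)
  then show ?thesis using True by (simp add: card_image inj_on_def)
next
  case False
  have "{x \<in> {..M} \<times> {..M}. int (fst x) - int (snd x) = k} = (\<lambda>q. (q, q + nat (- k))) ` {..<Suc M - nat (- k)}"
    using False by (auto simp: image_iff)
  then show ?thesis using False by (simp add: card_image inj_on_def)
qed

lemma sum_diff_fejer:
  fixes g :: "int \<Rightarrow> complex"
  shows "(\<Sum>p\<le>M. \<Sum>q\<le>M. g (int p - int q))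
    = of_nat (Suc M) * (\<Sum>k\<in>{- int M..int M}. of_real (fejer_weight M k) * g k)"
proof -
  let ?h = "\<lambda>x :: nat \<times> nat. int (fst x) - int (snd x)"
  have "(\<Sum>p\<le>M. \<Sum>q\<le>M. g (int p - int q)) = (\<Sum>x\<in>{..M}\<times>{..M}. g (?h x))" by (simp add: sum_Times)
  also have "\<dots> = (\<Sum>k\<in>{- int M..int M}. \<Sum>x\<in>{x \<in> {..M} \<times> {..M}. ?h x = k}. g (?h x))"
    by (rule sum.group[symmetric]) auto
  also have "\<dots> = (\<Sum>k\<in>{- int M..int M}. of_nat (nat (int (Suc M) - \<bar>k\<bar>)) * g k)"
    by (intro sum.cong refl) (simp add: card_diff_eq)
  also have "\<dots> = of_nat (Suc M) * (\<Sum>k\<in>{- int M..int M}. of_real (fejer_weight M k) * g k)"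
    unfolding sum_distrib_left fejer_weight_def by (intro sum.cong refl) (simp del: of_nat_Suc)
  finally show ?thesis .
qed

definition fejer_mean :: "(int \<Rightarrow> 'a \<Rightarrow> 'a \<Rightarrow> complex) \<Rightarrow> nat \<Rightarrow> complex \<Rightarrow> 'a \<Rightarrow> 'a \<Rightarrow> complex" where
  "fejer_mean \<phi> M z \<alpha> \<beta> = (\<Sum>k\<in>{- int M..int M}. of_real (fejer_weight M k) * \<phi> k \<alpha> \<beta> * z powi k)"

text \<open>At \<open>z\<close> the Fejer mean is the average over \<open>p, q \<le> M\<close> of \<open>\<phi>(p - q) z\<^sup>p\<^sup>-\<^sup>q\<close>. After reversing \<open>q\<close> it is the
  compression of a shifted Hankel section to the vectors \<open>(z\<^sup>p y)\<close> and \<open>(z\<^sup>-\<^sup>q x)\<close>, whose squared norms are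
  \<open>M + 1\<close> times those of \<open>y\<close> and \<open>x\<close>.\<close>

lemma fejer_mean_bounded:
  fixes \<phi> :: "int \<Rightarrow> 'a \<Rightarrow> 'a \<Rightarrow> complex"
  assumes D: "finite D" and z: "cmod z = 1"
    and \<phi>: "form_bounded_on (UNIV \<times> D) (hankel (\<lambda>n. \<phi> (int n - int M))) C"
  shows "form_bounded_on D (fejer_mean \<phi> M z) C"
proof (rule form_bounded_finiteI[OF D D form_bounded_nonneg[OF \<phi>]])
  fix y x :: "'a \<Rightarrow> complex"
  let ?I = "{..M} \<times> D"
  define Y where "Y = (\<lambda>(p :: nat, \<alpha>). z powi int p * y \<alpha>)"
  define X where "X = (\<lambda>(q :: nat, \<beta>). z powi (int q - int M) * x \<beta>)"
  have nY: "l2norm ?I Y = sqrt (Suc M) * l2norm D y"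
  proof -
    have "l2norm ?I Y = l2norm {..M} (\<lambda>p. z powi int p) * l2norm D y" unfolding Y_def by (rule l2norm_Times)
    also have "l2norm {..M} (\<lambda>p. z powi int p) = sqrt (Suc M)" using z by (simp add: l2norm_def L2_set_def norm_power)
    finally show ?thesis .
  qed
  have nX: "l2norm ?I X = sqrt (Suc M) * l2norm D x"
  proof -
    have "l2norm ?I X = l2norm {..M} (\<lambda>p. z powi (int p - int M)) * l2norm D x" unfolding X_def by (rule l2norm_Times)
    also have "l2norm {..M} (\<lambda>p. z powi (int p - int M)) = sqrt (Suc M)" using z by (simp add: l2norm_def L2_set_def norm_power)
    finally show ?thesis .
  qed
  define g where "g k = (\<Sum>\<alpha>\<in>D. \<Sum>\<beta>\<in>D. y \<alpha> * (\<phi> k \<alpha> \<beta> * z powi k) * x \<beta>)" for k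
  have "kernel_form ?I ?I (hankel (\<lambda>n. \<phi> (int n - int M))) Y X
    = (\<Sum>p\<le>M. \<Sum>\<alpha>\<in>D. \<Sum>q\<le>M. \<Sum>\<beta>\<in>D. y \<alpha> * (\<phi> (int p + int q - int M) \<alpha> \<beta> * z powi (int p + (int q - int M))) * x \<beta>)"
    unfolding kernel_form_def sum_Times
    by (intro sum.cong refl) (simp add: hankel_def Y_def X_def powi_add_circle[OF z])
  also have "\<dots> = (\<Sum>p\<le>M. \<Sum>q\<le>M. g (int p + int q - int M))"
    unfolding g_def by (intro sum.cong refl, subst sum.swap) (simp add: add_diff_eq)
  also have "\<dots> = (\<Sum>p\<le>M. \<Sum>q\<le>M. g (int p - int q))"
  proof (rule sum.cong[OF refl])
    fix p
    have "(\<Sum>q\<le>M. g (int p + int q - int M)) = (\<Sum>q\<le>M. g (int p + int (M - q) - int M))"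
      by (rule sum.reindex_bij_witness[where i = "\<lambda>q. M - q" and j = "\<lambda>q. M - q"]) auto
    also have "\<dots> = (\<Sum>q\<le>M. g (int p - int q))" by (intro sum.cong refl) (simp add: of_nat_diff)
    finally show "(\<Sum>q\<le>M. g (int p + int q - int M)) = (\<Sum>q\<le>M. g (int p - int q))" .
  qed
  also have "\<dots> = of_nat (Suc M) * (\<Sum>k\<in>{- int M..int M}. of_real (fejer_weight M k) * g k)" by (rule sum_diff_fejer)
  also have "(\<Sum>k\<in>{- int M..int M}. of_real (fejer_weight M k) * g k) = kernel_form D D (fejer_mean \<phi> M z) y x"
  proof -
    have "kernel_form D D (fejer_mean \<phi> M z) y x
      = (\<Sum>\<alpha>\<in>D. \<Sum>\<beta>\<in>D. \<Sum>k\<in>{- int M..int M}. of_real (fejer_weight M k) * (y \<alpha> * (\<phi> k \<alpha> \<beta> * z powi k) * x \<beta>))"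
      unfolding kernel_form_def fejer_mean_def by (simp add: sum_distrib_left sum_distrib_right mult_ac)
    also have "\<dots> = (\<Sum>k\<in>{- int M..int M}. \<Sum>\<alpha>\<in>D. \<Sum>\<beta>\<in>D. of_real (fejer_weight M k) * (y \<alpha> * (\<phi> k \<alpha> \<beta> * z powi k) * x \<beta>))"
      by (subst (2) sum.swap, subst sum.swap) simp
    finally show ?thesis by (simp add: g_def sum_distrib_left)
  qed
  finally have eq: "kernel_form ?I ?I (hankel (\<lambda>n. \<phi> (int n - int M))) Y X = of_nat (Suc M) * kernel_form D D (fejer_mean \<phi> M z) y x" .
  have "cmod (kernel_form ?I ?I (hankel (\<lambda>n. \<phi> (int n - int M))) Y X) \<le> C * l2norm ?I Y * l2norm ?I X"
    by (rule form_boundedD[OF \<phi>]) (use D in auto)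
  then have "real (Suc M) * cmod (kernel_form D D (fejer_mean \<phi> M z) y x) \<le> real (Suc M) * (C * l2norm D y * l2norm D x)"
    unfolding eq nX nY norm_mult norm_of_nat by (simp add: mult_ac flip: real_sqrt_mult)
  then show "cmod (kernel_form D D (fejer_mean \<phi> M z) y x) \<le> C * l2norm D y * l2norm D x" by simp
qed

lemma fourier_fejer_mean:
  "fourier (\<lambda>z. fejer_mean \<phi> M z \<alpha> \<beta>) n = of_real (fejer_weight M n) * \<phi> n \<alpha> \<beta>"
proof -
  have "fourier (\<lambda>z. fejer_mean \<phi> M z \<alpha> \<beta>) n
    = (\<Sum>k\<in>{- int M..int M}. if k = n then of_real (fejer_weight M k) * \<phi> k \<alpha> \<beta> else 0)"
    unfolding fejer_mean_def by (rule fourier_trig) auto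
  also have "\<dots> = of_real (fejer_weight M n) * \<phi> n \<alpha> \<beta>"
    using fejer_weight_zero[of M n] by auto
  finally show ?thesis .
qed

text \<open>The squared norms of the columns of a bounded kernel are bounded.\<close>

lemma hankel_column_summable:
  assumes \<phi>: "\<And>N. form_bounded_on (UNIV \<times> D) (hankel (\<lambda>n. \<phi> (int n - int N))) C"
    and ab: "\<alpha> \<in> D" "\<beta> \<in> D"
  shows "summable (\<lambda>j. (cmod (\<phi> (int_decode j) \<alpha> \<beta>))\<^sup>2)"
proof (rule summableI_nonneg_bounded)
  fix n
  obtain N where N: "int_decode ` {..<n} \<subseteq> {- int N..int N}"
  proof -
    define K where "K = (\<Sum>k\<in>int_decode ` {..<n}. \<bar>k\<bar>)"
    have "\<bar>k\<bar> \<le> K" if "k \<in> int_decode ` {..<n}" for k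
      unfolding K_def using that by (intro member_le_sum) auto
    then have "int_decode ` {..<n} \<subseteq> {- int (nat K)..int (nat K)}" by force
    then show ?thesis using that by blast
  qed
  have "(\<Sum>j<n. (cmod (\<phi> (int_decode j) \<alpha> \<beta>))\<^sup>2) = (\<Sum>k\<in>int_decode ` {..<n}. (cmod (\<phi> k \<alpha> \<beta>))\<^sup>2)"
    by (subst sum.reindex) (auto intro: inj_on_subset[OF inj_int_decode])
  also have "\<dots> \<le> (\<Sum>k\<in>{- int N..int N}. (cmod (\<phi> k \<alpha> \<beta>))\<^sup>2)"
    by (rule sum_mono2) (use N in auto)
  also have "\<dots> = (\<Sum>p\<in>{..2 * N}. (cmod (\<phi> (int p - int N) \<alpha> \<beta>))\<^sup>2)"
    by (rule sum.reindex_bij_witness[where i = "\<lambda>p. int p - int N" and j = "\<lambda>k. nat (k + int N)"]) auto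
  also have "\<dots> = (l2norm ({..2 * N} \<times> {\<alpha>}) (\<lambda>i. \<Sum>j\<in>{(0, \<beta>)}. hankel (\<lambda>n. \<phi> (int n - int N)) i j * 1))\<^sup>2"
    unfolding l2norm_power2 sum_Times by (simp add: hankel_def)
  also have "\<dots> \<le> (C * l2norm {(0 :: nat, \<beta>)} (\<lambda>_. 1))\<^sup>2"
    by (intro power_mono form_bounded_apply form_bounded_subset[OF \<phi>[of N]]) (use ab in auto)
  finally show "(\<Sum>j<n. (cmod (\<phi> (int_decode j) \<alpha> \<beta>))\<^sup>2) \<le> C\<^sup>2" by simp
qed simp

text \<open>The columns of the extended Hankel kernel are square summable, hence they are the coefficients
  of square integrable functions \<open>g\<close>. The Fejer means converge to \<open>g\<close> in mean square, so a subsequence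
  converges almost everywhere and carries the bound over to \<open>g\<close>.\<close>

theorem nehari:
  assumes a: "\<And>n. a n \<in> carrier_mat d d" and C: "hankel_bounded d a C"
  obtains F where "F \<in> matrices_over Linf d" "coeffs d F = a"
    "AE z in circle. form_bounded_on {..<d} (entries (F z)) C"
proof -
  let ?D = "{..<d}"
  obtain \<phi> where \<phi>: "\<And>n. \<phi> (int n) = entries (a n)"
    "\<And>N. form_bounded_on (UNIV \<times> ?D) (hankel (\<lambda>n. \<phi> (int n - int N))) C"
    using hankel_extension[OF _ C[unfolded hankel_bounded_def]] by blast
  have "\<exists>g. g \<in> Lp 2 \<and> (\<forall>n. fourier g n = \<phi> n \<alpha> \<beta>)" if "\<alpha> < d" "\<beta> < d" for \<alpha> \<beta>
  proof -
    have s: "summable (\<lambda>j. (cmod (\<phi> (int_decode j) \<alpha> \<beta>))\<^sup>2)"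
      by (rule hankel_column_summable[OF \<phi>(2)]) (use that in auto)
    obtain g where g: "g \<in> Lp 2" "\<And>j. fourier g (int_decode j) = \<phi> (int_decode j) \<alpha> \<beta>"
      using riesz_fischer[OF inj_int_decode s] by auto
    have "fourier g n = \<phi> n \<alpha> \<beta>" for n using g(2)[of "int_encode n"] by simp
    with g(1) show ?thesis by blast
  qed
  then obtain g where g: "\<And>\<alpha> \<beta>. \<alpha> < d \<Longrightarrow> \<beta> < d \<Longrightarrow> g \<alpha> \<beta> \<in> Lp 2"
    "\<And>\<alpha> \<beta> n. \<alpha> < d \<Longrightarrow> \<beta> < d \<Longrightarrow> fourier (g \<alpha> \<beta>) n = \<phi> n \<alpha> \<beta>" by metis
  define h where "h M \<alpha> \<beta> z = fejer_mean \<phi> M z \<alpha> \<beta> - g \<alpha> \<beta> z" for M \<alpha> \<beta> z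
  have mean2: "(\<lambda>z. fejer_mean \<phi> M z \<alpha> \<beta>) \<in> Lp 2" for M \<alpha> \<beta>
    unfolding fejer_mean_def by (rule Lp_2_trig)
  have h2: "h M \<alpha> \<beta> \<in> Lp 2" if "\<alpha> < d" "\<beta> < d" for M \<alpha> \<beta>
    unfolding h_def by (rule Lp_2_diff[OF mean2 g(1)[OF that]])
  have hlim: "(\<lambda>M. l2int (h M \<alpha> \<beta>)) \<longlonglongrightarrow> 0" if ab: "\<alpha> < d" "\<beta> < d" for \<alpha> \<beta>
  proof -
    let ?e = int_decode
    let ?t = "\<lambda>j M. (cmod ((of_real (fejer_weight M (?e j)) - 1) * \<phi> (?e j) \<alpha> \<beta>))\<^sup>2"
    have "(\<lambda>j. (cmod (fourier (h M \<alpha> \<beta>) (?e j)))\<^sup>2) sums l2int (h M \<alpha> \<beta>)" for M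
      by (rule parseval[OF h2[OF ab] inj_int_decode]) (simp add: surj_int_decode)
    moreover have "fourier (h M \<alpha> \<beta>) n = (of_real (fejer_weight M n) - 1) * \<phi> n \<alpha> \<beta>" for M n
      unfolding h_def using Lp_2_integrable[OF mean2] Lp_2_integrable[OF g(1)[OF ab]]
      by (simp add: fourier_diff fourier_fejer_mean g(2)[OF ab] algebra_simps)
    ultimately have eq: "l2int (h M \<alpha> \<beta>) = (\<Sum>j. ?t j M)" for M by (simp add: sums_iff)
    have s: "summable (\<lambda>j. (cmod (\<phi> (?e j) \<alpha> \<beta>))\<^sup>2)"
      by (rule hankel_column_summable[OF \<phi>(2)]) (use ab in auto)
    have "(\<lambda>M. \<Sum>j. ?t j M) \<longlonglongrightarrow> (\<Sum>j. 0)"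
    proof (rule tannerys_theorem[THEN conjunct2, THEN conjunct2])
      show "(\<lambda>M. ?t j M) \<longlonglongrightarrow> 0" for j
      proof -
        have "(\<lambda>M. ?t j M) \<longlonglongrightarrow> (cmod ((of_real 1 - 1) * \<phi> (?e j) \<alpha> \<beta>))\<^sup>2"
          by (intro tendsto_intros fejer_weight_tendsto)
        then show ?thesis by simp
      qed
      have "norm (?t j M) \<le> (cmod (\<phi> (?e j) \<alpha> \<beta>))\<^sup>2" for j M
      proof -
        have "cmod (of_real (fejer_weight M (?e j)) - 1) = \<bar>fejer_weight M (?e j) - 1\<bar>"
          by (metis norm_of_real of_real_1 of_real_diff)
        also have "\<dots> \<le> 1" using fejer_weight_bounds[of M "?e j"] by auto
        finally have "cmod ((of_real (fejer_weight M (?e j)) - 1) * \<phi> (?e j) \<alpha> \<beta>) \<le> cmod (\<phi> (?e j) \<alpha> \<beta>)"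
          unfolding norm_mult by (intro mult_left_le_one_le) auto
        then show ?thesis by (simp add: power_mono)
      qed
      then show "\<forall>\<^sub>F (j, M) in at_top \<times>\<^sub>F sequentially. norm (?t j M) \<le> (cmod (\<phi> (?e j) \<alpha> \<beta>))\<^sup>2"
        by (intro always_eventually) auto
    qed (use s in auto)
    then show ?thesis unfolding eq by simp
  qed
  define u where "u M z = (\<Sum>\<alpha><d. \<Sum>\<beta><d. cmod (h M \<alpha> \<beta> z))" for M z
  have hn: "integrable circle (\<lambda>z. cmod (h M \<alpha> \<beta> z))" if "\<alpha> < d" "\<beta> < d" for M \<alpha> \<beta>
    using Lp_2_integrable[OF h2[OF that]] by auto
  have ui: "integrable circle (u M)" for M
    unfolding u_def using hn by (intro Bochner_Integration.integrable_sum) auto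
  have u0: "u M z \<ge> 0" for M z unfolding u_def by (intro sum_nonneg) auto
  have "(\<lambda>M. LINT z|circle. norm (u M z)) \<longlonglongrightarrow> 0"
  proof (rule tendsto_sandwich[OF _ _ tendsto_const])
    show "\<forall>\<^sub>F M in sequentially. (LINT z|circle. norm (u M z)) \<le> (\<Sum>\<alpha><d. \<Sum>\<beta><d. sqrt (l2int (h M \<alpha> \<beta>)))"
    proof (intro always_eventually allI)
      fix M
      have "(LINT z|circle. norm (u M z)) = (\<Sum>\<alpha><d. \<Sum>\<beta><d. LINT z|circle. cmod (h M \<alpha> \<beta> z))"
      proof -
        have "(LINT z|circle. norm (u M z)) = (LINT z|circle. u M z)" using u0 by simp
        also have "\<dots> = (\<Sum>\<alpha><d. LINT z|circle. (\<Sum>\<beta><d. cmod (h M \<alpha> \<beta> z)))"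
          unfolding u_def using hn by (intro Bochner_Integration.integral_sum Bochner_Integration.integrable_sum) auto
        also have "\<dots> = (\<Sum>\<alpha><d. \<Sum>\<beta><d. LINT z|circle. cmod (h M \<alpha> \<beta> z))"
          using hn by (intro sum.cong refl Bochner_Integration.integral_sum) auto
        finally show ?thesis .
      qed
      also have "\<dots> \<le> (\<Sum>\<alpha><d. \<Sum>\<beta><d. sqrt (l2int (h M \<alpha> \<beta>)))"
        using integral_norm_le_l2int[OF h2] by (intro sum_mono) auto
      finally show "(LINT z|circle. norm (u M z)) \<le> (\<Sum>\<alpha><d. \<Sum>\<beta><d. sqrt (l2int (h M \<alpha> \<beta>)))" .
    qed
    have "(\<lambda>M. \<Sum>\<alpha><d. \<Sum>\<beta><d. sqrt (l2int (h M \<alpha> \<beta>))) \<longlonglongrightarrow> (\<Sum>\<alpha><d. \<Sum>\<beta><d. sqrt 0)"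
      using hlim by (intro tendsto_sum tendsto_real_sqrt) auto
    then show "(\<lambda>M. \<Sum>\<alpha><d. \<Sum>\<beta><d. sqrt (l2int (h M \<alpha> \<beta>))) \<longlonglongrightarrow> 0" by simp
  qed simp
  then obtain r where r: "AE z in circle. (\<lambda>n. u (r n) z) \<longlonglongrightarrow> 0"
    using tendsto_L1_AE_subseq[of circle u, OF ui] by blast
  have bdd: "AE z in circle. form_bounded_on ?D (\<lambda>\<alpha> \<beta>. g \<alpha> \<beta> z) C"
    using r AE_space
  proof eventually_elim
    case (elim z)
    then have z: "cmod z = 1" by simp
    show ?case
    proof (rule form_bounded_tendsto[where F = sequentially])
      show "\<forall>\<^sub>F n in sequentially. form_bounded_on ?D (fejer_mean \<phi> (r n) z) C"
        using fejer_mean_bounded[OF _ z \<phi>(2)] by (intro always_eventually) auto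
      fix \<alpha> \<beta> assume ab: "\<alpha> \<in> ?D" "\<beta> \<in> ?D"
      have "cmod (h M \<alpha> \<beta> z) \<le> u M z" for M
        unfolding u_def using ab by (intro member_le_sum2) auto
      then have "(\<lambda>n. h (r n) \<alpha> \<beta> z) \<longlonglongrightarrow> 0"
        by (intro Lim_null_comparison[OF _ elim(1)] always_eventually) auto
      from tendsto_add[OF this tendsto_const[of "g \<alpha> \<beta> z"]]
      show "(\<lambda>n. fejer_mean \<phi> (r n) z \<alpha> \<beta>) \<longlonglongrightarrow> g \<alpha> \<beta> z" by (simp add: h_def)
    qed auto
  qed
  define F where "F z = mat d d (\<lambda>(\<alpha>, \<beta>). g \<alpha> \<beta> z)" for z
  have "g \<alpha> \<beta> \<in> Linf" if "\<alpha> < d" "\<beta> < d" for \<alpha> \<beta>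
  proof (rule Linf_I)
    show "g \<alpha> \<beta> \<in> borel_measurable circle" using g(1)[OF that] by (rule Lp_2_measurable)
    show "AE z in circle. cmod (g \<alpha> \<beta> z) \<le> C"
      using bdd by eventually_elim (erule form_bounded_entry, use that in auto)
  qed
  then have F: "F \<in> matrices_over Linf d" by (auto simp: matrices_over_def F_def)
  moreover have "coeffs d F = a"
  proof
    fix n
    show "coeffs d F n = a n"
      by (rule eq_matI) (use a[of n] in \<open>auto simp: coeffs_def F_def g(2) \<phi>(1)\<close>)
  qed
  moreover have "AE z in circle. form_bounded_on ?D (entries (F z)) C"
    using bdd by eventually_elim (rule iffD1[OF form_bounded_cong, rotated], auto simp: F_def)
  ultimately show ?thesis by (rule that)
qed

section \<open>Norms over BMOA\<close>

lemma minus_mat_entry: "A \<in> carrier_mat n m \<Longrightarrow> B \<in> carrier_mat n m \<Longrightarrow> i < n \<Longrightarrow> j < m \<Longrightarrow>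
    (A - B) $$ (i, j) = A $$ (i, j) - (B $$ (i, j) :: complex)"
  by auto

lemma matrices_over_minus:
  assumes F: "F \<in> matrices_over S d" and G: "G \<in> matrices_over T d"
    and ST: "\<And>f g. f \<in> S \<Longrightarrow> g \<in> T \<Longrightarrow> (\<lambda>z. f z - g z) \<in> U"
  shows "(\<lambda>z. F z - G z) \<in> matrices_over U d"
  unfolding matrices_over_def
proof (intro CollectI conjI allI impI)
  show "F z - G z \<in> carrier_mat d d" for z
    using matrices_over_carrier[OF F, of z] matrices_over_carrier[OF G, of z] by auto
  fix i j assume ij: "i < d" "j < d"
  have "(\<lambda>z. (F z - G z) $$ (i, j)) = (\<lambda>z. F z $$ (i, j) - G z $$ (i, j))"
    using minus_mat_entry[OF matrices_over_carrier[OF F] matrices_over_carrier[OF G] ij] by (rule ext)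
  then show "(\<lambda>z. (F z - G z) $$ (i, j)) \<in> U"
    using ST matrices_over_entry[OF F ij] matrices_over_entry[OF G ij] by simp
qed

text \<open>Subtracting \<open>h\<close> does not change the coefficients that enter the Hankel kernel; conversely the
  function that Nehari's theorem provides for these coefficients differs from \<open>F\<close> by such an \<open>h\<close>.\<close>

lemma BMO_quotient_mnorm_le_iff:
  assumes F: "F \<in> matrices_over Linf d" and C: "0 \<le> C"
  shows "BMO_quotient_mnorm d F \<le> C \<longleftrightarrow> hankel_bounded d (coeffs d F) C"
    and "0 \<le> BMO_quotient_mnorm d F"
proof -
  let ?S = "{Linf_mnorm d (\<lambda>z. F z - h z) | h. h \<in> matrices_over conj_H0inf d}"
  have sub: "(\<lambda>z. F z - h z) \<in> matrices_over Linf d" if "h \<in> matrices_over conj_H0inf d" for h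
    by (rule matrices_over_minus[OF F that]) (auto simp: conj_H0inf_def Linf_diff)
  have "(\<lambda>_. 0\<^sub>m d d) \<in> matrices_over conj_H0inf d"
    by (auto simp: matrices_over_def conj_H0inf_def Linf_def fourier_def)
  then have ne: "?S \<noteq> {}" by blast
  have nn: "0 \<le> s" if "s \<in> ?S" for s using that AE_Linf_mnorm(2)[OF sub] by auto
  show q0: "0 \<le> BMO_quotient_mnorm d F"
    unfolding BMO_quotient_mnorm_def by (rule cInf_greatest[OF ne nn])
  have hb: "hankel_bounded d (coeffs d F) (Linf_mnorm d (\<lambda>z. F z - h z))" if h: "h \<in> matrices_over conj_H0inf d" for h
  proof -
    have "coeffs d (\<lambda>z. F z - h z) = coeffs d F"
    proof
      fix n
      show "coeffs d (\<lambda>z. F z - h z) n = coeffs d F n"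
      proof (rule eq_matI)
        fix i j assume "i < dim_row (coeffs d F n)" "j < dim_col (coeffs d F n)"
        then have ij: "i < d" "j < d" by (simp_all add: coeffs_def)
        have "(\<lambda>z. (F z - h z) $$ (i, j)) = (\<lambda>z. F z $$ (i, j) - h z $$ (i, j))"
          using minus_mat_entry[OF matrices_over_carrier[OF F] matrices_over_carrier[OF h] ij] by (rule ext)
        moreover have "fourier (\<lambda>z. h z $$ (i, j)) (int n) = 0" "(\<lambda>z. h z $$ (i, j)) \<in> Linf"
          using matrices_over_entry[OF h ij] by (auto simp: conj_H0inf_def)
        ultimately show "coeffs d (\<lambda>z. F z - h z) n $$ (i, j) = coeffs d F n $$ (i, j)"
          using ij matrices_over_entry[OF F ij] by (simp add: coeffs_entry fourier_diff Linf_integrable)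
      qed (simp_all add: coeffs_def)
    qed
    then show ?thesis using hankel_bounded_coeffs[OF sub[OF h] AE_Linf_mnorm[OF sub[OF h]]] by simp
  qed
  have "hankel_bounded d (coeffs d F) (BMO_quotient_mnorm d F)"
    unfolding hankel_bounded_def
  proof (rule form_bounded_eps)
    fix e :: real assume "e > 0"
    then have "Inf ?S < BMO_quotient_mnorm d F + e" by (simp add: BMO_quotient_mnorm_def)
    from cInf_lessD[OF ne this] obtain h where h: "h \<in> matrices_over conj_H0inf d"
      "Linf_mnorm d (\<lambda>z. F z - h z) < BMO_quotient_mnorm d F + e" by auto
    from hb[OF h(1)] show "form_bounded_on (UNIV \<times> {..<d}) (hankel (\<lambda>n. entries (coeffs d F n)))
        (BMO_quotient_mnorm d F + e)"
      unfolding hankel_bounded_def by (rule form_bounded_mono) (use h in simp)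
  qed
  moreover have "BMO_quotient_mnorm d F \<le> C" if hb_C: "hankel_bounded d (coeffs d F) C"
  proof -
    obtain G where G: "G \<in> matrices_over Linf d" "coeffs d G = coeffs d F"
      "AE z in circle. form_bounded_on {..<d} (entries (G z)) C"
      using nehari[OF coeffs_carrier hb_C] by blast
    define h where "h z = F z - G z" for z
    have hL: "h \<in> matrices_over Linf d" unfolding h_def by (rule matrices_over_minus[OF F G(1) Linf_diff])
    have "h \<in> matrices_over conj_H0inf d"
      unfolding matrices_over_def conj_H0inf_def
    proof (intro CollectI conjI allI impI matrices_over_carrier[OF hL] matrices_over_entry[OF hL])
      fix i j and n :: int assume ij: "i < d" "j < d" "n \<ge> 0"
      have "(\<lambda>z. h z $$ (i, j)) = (\<lambda>z. F z $$ (i, j) - G z $$ (i, j))"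
        unfolding h_def
        using minus_mat_entry[OF matrices_over_carrier[OF F] matrices_over_carrier[OF G(1)] ij(1,2)] by (rule ext)
      then have "fourier (\<lambda>z. h z $$ (i, j)) n = fourier (\<lambda>z. F z $$ (i, j)) n - fourier (\<lambda>z. G z $$ (i, j)) n"
        using matrices_over_entry[OF F ij(1,2)] matrices_over_entry[OF G(1) ij(1,2)]
        by (simp add: fourier_diff Linf_integrable)
      also have "\<dots> = coeffs d F (nat n) $$ (i, j) - coeffs d G (nat n) $$ (i, j)"
        using ij by (simp add: coeffs_entry)
      finally show "fourier (\<lambda>z. h z $$ (i, j)) n = 0" using G(2) by simp
    qed
    moreover have "(\<lambda>z. F z - h z) = G"
    proof
      fix z
      show "F z - h z = G z"
        using matrices_over_carrier[OF F, of z] matrices_over_carrier[OF G(1), of z]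
        by (intro eq_matI) (auto simp: h_def)
    qed
    ultimately have "Linf_mnorm d G \<in> ?S" by force
    then have "BMO_quotient_mnorm d F \<le> Linf_mnorm d G"
      unfolding BMO_quotient_mnorm_def by (rule cInf_lower) (use nn in \<open>auto intro!: bdd_belowI[of _ 0]\<close>)
    also have "\<dots> \<le> C" by (rule Linf_mnorm_le[OF G(1,3) C])
    finally show ?thesis .
  qed
  ultimately show "BMO_quotient_mnorm d F \<le> C \<longleftrightarrow> hankel_bounded d (coeffs d F) C"
    unfolding hankel_bounded_def using form_bounded_mono by blast
qed

lemma BMOA_mcarr_iff:
  "a \<in> mcarr BMOA d \<longleftrightarrow> (\<forall>n. a n \<in> carrier_mat d d) \<and> (\<exists>C. hankel_bounded d a C)"
proof
  assume "a \<in> mcarr BMOA d"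
  then obtain F where F: "F \<in> matrices_over Linf d" "a = coeffs d F" by (auto simp: BMOA_def mcarr_series_space)
  then show "(\<forall>n. a n \<in> carrier_mat d d) \<and> (\<exists>C. hankel_bounded d a C)"
    using hankel_bounded_coeffs[OF F(1) AE_Linf_mnorm[OF F(1)]] by auto
next
  assume "(\<forall>n. a n \<in> carrier_mat d d) \<and> (\<exists>C. hankel_bounded d a C)"
  then obtain F where "F \<in> matrices_over Linf d" "coeffs d F = a" using nehari by metis
  then show "a \<in> mcarr BMOA d" by (auto simp: BMOA_def mcarr_series_space)
qed

lemma BMOA_mnorm:
  assumes F: "F \<in> matrices_over Linf d"
  shows "mnorm BMOA d (coeffs d F) = BMO_quotient_mnorm d F"
proof -
  have "BMO_quotient_mnorm d F' \<le> BMO_quotient_mnorm d F''"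
    if "F' \<in> matrices_over Linf d" "F'' \<in> matrices_over Linf d" "coeffs d F' = coeffs d F''" for F' F''
    using that BMO_quotient_mnorm_le_iff by (metis order_refl)
  then show ?thesis
    unfolding BMOA_def by (subst mnorm_series_space) (use F in \<open>auto intro!: antisym\<close>)
qed

lemma BMOA_mnorm_le_iff:
  assumes "a \<in> mcarr BMOA d" "0 \<le> C"
  shows "mnorm BMOA d a \<le> C \<longleftrightarrow> hankel_bounded d a C" and "0 \<le> mnorm BMOA d a"
proof -
  obtain F where F: "F \<in> matrices_over Linf d" "a = coeffs d F" using assms by (auto simp: BMOA_def mcarr_series_space)
  show "mnorm BMOA d a \<le> C \<longleftrightarrow> hankel_bounded d a C" "0 \<le> mnorm BMOA d a"
    unfolding F(2) BMOA_mnorm[OF F(1)] using BMO_quotient_mnorm_le_iff[OF F(1)] assms(2) by auto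
qed

section \<open>Norms over the Hardy space of square integrable functions\<close>

text \<open>The matrix \<open>\<Sum> a\<^sub>n \<otimes> cnj a\<^sub>n\<close>.\<close>

definition gram_kernel :: "(nat \<Rightarrow> complex mat) \<Rightarrow> nat \<times> nat \<Rightarrow> nat \<times> nat \<Rightarrow> complex" where
  "gram_kernel a = (\<lambda>(i, i') (j, j'). \<Sum>n. a n $$ (i, j) * cnj (a n $$ (i', j')))"

lemma Hp_2_fourier_outside: "f \<in> Hp 2 \<Longrightarrow> n \<notin> range int \<Longrightarrow> fourier f n = 0"
  by (metis Hp_neg not_le rangeI zero_le_imp_eq_int)

lemma tensor_conj_entry:
  assumes "A \<in> carrier_mat d d" "r < d * d" "c < d * d"
  shows "tensor_conj A $$ (r, c) = A $$ (r div d, c div d) * cnj (A $$ (r mod d, c mod d))"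
  using assms by (auto simp: tensor_conj_def kron_def mod_less_of_mult)

lemma tensor_conj_carrier: "A \<in> carrier_mat d d \<Longrightarrow> tensor_conj A \<in> carrier_mat (d * d) (d * d)"
  by (auto simp: tensor_conj_def kron_def)

lemma OH_mnorm_eq:
  assumes F: "F \<in> matrices_over (Hp 2) d"
  shows "OH_mnorm d F = sqrt (opnorm (mat (d * d) (d * d)
    (\<lambda>(r, c). gram_kernel (coeffs d F) (r div d, r mod d) (c div d, c mod d))))"
proof -
  have "mat_integral (d * d) (\<lambda>z. tensor_conj (F z)) = mat (d * d) (d * d)
    (\<lambda>(r, c). gram_kernel (coeffs d F) (r div d, r mod d) (c div d, c mod d))"
    unfolding mat_integral_def
  proof (intro eq_matI, goal_cases)
    case (1 r c)
    then have rc: "r < d * d" "c < d * d" by auto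
    then have lt: "r div d < d" "c div d < d" "r mod d < d" "c mod d < d"
      by (auto intro: div_less_of_mult mod_less_of_mult)
    note f = matrices_over_entry[OF F lt(1,2)] and g = matrices_over_entry[OF F lt(3,4)]
    have f2: "(\<lambda>z. F z $$ (r div d, c div d)) \<in> Lp 2" and g2: "(\<lambda>z. F z $$ (r mod d, c mod d)) \<in> Lp 2"
      using f g by (auto simp: Hp_def)
    have "(\<lambda>n. fourier (\<lambda>z. F z $$ (r div d, c div d)) (int n) * cnj (fourier (\<lambda>z. F z $$ (r mod d, c mod d)) (int n)))
      sums (LINT z|circle. F z $$ (r div d, c div d) * cnj (F z $$ (r mod d, c mod d)))"
      by (rule parseval_inner[OF f2 Hp_2_fourier_outside[OF f] g2 Hp_2_fourier_outside[OF g]]) auto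
    then show ?case using rc lt
      by (simp add: tensor_conj_entry[OF matrices_over_carrier[OF F]] gram_kernel_def coeffs_entry sums_iff)
  qed auto
  then show ?thesis by (simp add: OH_mnorm_def)
qed

lemma H2_mcarr_iff:
  "a \<in> mcarr H2 d \<longleftrightarrow> (\<forall>n. a n \<in> carrier_mat d d) \<and>
    (\<forall>i<d. \<forall>j<d. summable (\<lambda>n. (cmod (a n $$ (i, j)))\<^sup>2))"
proof
  assume "a \<in> mcarr H2 d"
  then obtain F where F: "F \<in> matrices_over (Hp 2) d" "a = coeffs d F" by (auto simp: H2_def mcarr_series_space)
  have "summable (\<lambda>n. (cmod (a n $$ (i, j)))\<^sup>2)" if ij: "i < d" "j < d" for i j
  proof -
    have "(\<lambda>z. F z $$ (i, j)) \<in> Lp 2" using matrices_over_entry[OF F(1) ij] by (simp add: Hp_def)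
    from bessel_summable(1)[OF this, of int] show ?thesis using ij by (simp add: F(2) coeffs_entry)
  qed
  then show "(\<forall>n. a n \<in> carrier_mat d d) \<and> (\<forall>i<d. \<forall>j<d. summable (\<lambda>n. (cmod (a n $$ (i, j)))\<^sup>2))"
    using F by auto
next
  assume a: "(\<forall>n. a n \<in> carrier_mat d d) \<and> (\<forall>i<d. \<forall>j<d. summable (\<lambda>n. (cmod (a n $$ (i, j)))\<^sup>2))"
  have "\<exists>g. g \<in> Hp 2 \<and> (\<forall>n. fourier g (int n) = a n $$ (i, j))" if ij: "i < d" "j < d" for i j
  proof -
    have s: "summable (\<lambda>n. (cmod (a n $$ (i, j)))\<^sup>2)" using a ij by blast
    have inj: "inj int" by (simp add: inj_on_def)
    obtain g where "g \<in> Lp 2" "\<And>k. fourier g (int k) = a k $$ (i, j)" "\<And>n. n \<notin> range int \<Longrightarrow> fourier g n = 0"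
      using riesz_fischer[of int "\<lambda>n. a n $$ (i, j)", OF inj s] by auto
    moreover have "n \<notin> range int" if "n < 0" for n using that by auto
    ultimately show ?thesis by (auto simp: Hp_def)
  qed
  then obtain g where g: "\<And>i j. i < d \<Longrightarrow> j < d \<Longrightarrow> g i j \<in> Hp 2"
    "\<And>i j n. i < d \<Longrightarrow> j < d \<Longrightarrow> fourier (g i j) (int n) = a n $$ (i, j)" by metis
  define F where "F z = mat d d (\<lambda>(i, j). g i j z)" for z
  have "F \<in> matrices_over (Hp 2) d" using g(1) by (auto simp: matrices_over_def F_def)
  moreover have "coeffs d F = a"
  proof
    fix n
    have "a n \<in> carrier_mat d d" using a by blast
    then show "coeffs d F n = a n" by (intro eq_matI) (auto simp: coeffs_def F_def g(2))
  qed
  ultimately show "a \<in> mcarr H2 d" by (auto simp: H2_def mcarr_series_space)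
qed

lemma H2_mnorm:
  assumes "a \<in> mcarr H2 d"
  shows "mnorm H2 d a = sqrt (opnorm (mat (d * d) (d * d)
    (\<lambda>(r, c). gram_kernel a (r div d, r mod d) (c div d, c mod d))))"
proof -
  obtain F where F: "F \<in> matrices_over (Hp 2) d" "a = coeffs d F"
    using assms by (auto simp: H2_def mcarr_series_space)
  have "mnorm H2 d a = OH_mnorm d F"
    unfolding F(2) H2_def by (subst mnorm_series_space) (use F in \<open>auto simp: OH_mnorm_eq\<close>)
  then show ?thesis using OH_mnorm_eq[OF F(1)] F(2) by simp
qed

lemma sqrt_le_iff_power2: "0 \<le> C \<Longrightarrow> sqrt x \<le> C \<longleftrightarrow> x \<le> C\<^sup>2"
  using real_sqrt_le_iff[of x "C\<^sup>2"] by simp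

lemma H2_mnorm_le_iff:
  assumes "a \<in> mcarr H2 d" "0 \<le> C"
  shows "mnorm H2 d a \<le> C \<longleftrightarrow> form_bounded_on ({..<d} \<times> {..<d}) (gram_kernel a) (C\<^sup>2)"
    and "0 \<le> mnorm H2 d a"
proof -
  let ?M = "mat (d * d) (d * d) (\<lambda>(r, c). gram_kernel a (r div d, r mod d) (c div d, c mod d))"
  have M: "0 \<le> opnorm ?M" by (rule opnorm_nonneg[of _ "d * d" "d * d"]) simp
  then show "0 \<le> mnorm H2 d a" unfolding H2_mnorm[OF assms(1)] by simp
  have "mnorm H2 d a \<le> C \<longleftrightarrow> opnorm ?M \<le> C\<^sup>2"
    unfolding H2_mnorm[OF assms(1)] by (rule sqrt_le_iff_power2[OF assms(2)])
  also have "\<dots> \<longleftrightarrow> form_bounded {..<d * d} {..<d * d} (entries ?M) (C\<^sup>2)"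
    by (rule opnorm_le_iff) auto
  also have "\<dots> \<longleftrightarrow> form_bounded {..<d * d} {..<d * d} (\<lambda>r c. gram_kernel a (r div d, r mod d) (c div d, c mod d)) (C\<^sup>2)"
    by (intro form_bounded_cong) auto
  also have "\<dots> \<longleftrightarrow> form_bounded_on ({..<d} \<times> {..<d}) (gram_kernel a) (C\<^sup>2)"
    by (rule form_bounded_flat)
  finally show "mnorm H2 d a \<le> C \<longleftrightarrow> form_bounded_on ({..<d} \<times> {..<d}) (gram_kernel a) (C\<^sup>2)" .
qed

section \<open>Norms over the quadratic version of BMOA\<close>

text \<open>The matrices \<open>m\<^sub>n \<otimes> cnj m\<^sub>n\<close>, on pairs of indices.\<close>

definition square_symbol :: "(nat \<Rightarrow> complex mat) \<Rightarrow> nat \<Rightarrow> nat \<times> nat \<Rightarrow> nat \<times> nat \<Rightarrow> complex" where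
  "square_symbol m n = (\<lambda>(\<alpha>, \<alpha>') (\<beta>, \<beta>'). m n $$ (\<alpha>, \<beta>) * cnj (m n $$ (\<alpha>', \<beta>')))"

lemma hankel_bounded_flat:
  assumes "\<And>n r c. r < k * d \<Longrightarrow> c < k * d \<Longrightarrow> A n $$ (r, c) = f n (r div d, r mod d) (c div d, c mod d)"
  shows "hankel_bounded (k * d) A C \<longleftrightarrow>
    form_bounded_on (UNIV \<times> ({..<k} \<times> {..<d})) (hankel f) C"
proof -
  let ?g = "map_prod id (\<lambda>r. (r div d, r mod d)) :: nat \<times> nat \<Rightarrow> _"
  have b: "bij_betw ?g (UNIV \<times> {..<k * d}) (UNIV \<times> ({..<k} \<times> {..<d}))"
    using bij_betw_div_mod[of d k] unfolding bij_betw_def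
    by (auto simp: map_prod_surj_on intro!: map_prod_inj_on)
  have "hankel_bounded (k * d) A C \<longleftrightarrow>
      form_bounded_on (UNIV \<times> {..<k * d}) (\<lambda>i j. hankel f (?g i) (?g j)) C"
    unfolding hankel_bounded_def by (rule form_bounded_cong) (auto simp: hankel_def assms)
  also have "\<dots> \<longleftrightarrow> form_bounded_on (UNIV \<times> ({..<k} \<times> {..<d})) (hankel f) C"
    by (rule form_bounded_reindex[OF b b])
  finally show ?thesis .
qed

lemma form_bounded_dominated:
  assumes b: "form_bounded I J (\<lambda>i j. of_real (b i j)) C" and ab: "\<And>i j. i \<in> I \<Longrightarrow> j \<in> J \<Longrightarrow> cmod (a i j) \<le> b i j"
  shows "form_bounded I J a C"
  unfolding form_bounded_def
proof (intro conjI allI impI)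
  fix I' J' and y x :: "_ \<Rightarrow> complex" assume *: "finite I'" "finite J'" "I' \<subseteq> I" "J' \<subseteq> J"
  have "cmod (kernel_form I' J' a y x) \<le> (\<Sum>i\<in>I'. \<Sum>j\<in>J'. cmod (y i) * b i j * cmod (x j))"
    unfolding kernel_form_def
  proof (intro sum_norm_le)
    fix i j assume "i \<in> I'" "j \<in> J'"
    then have "cmod (a i j) \<le> b i j" using ab * by blast
    then show "cmod (y i * a i j * x j) \<le> cmod (y i) * b i j * cmod (x j)"
      by (simp add: norm_mult mult_left_mono mult_right_mono)
  qed
  also have "\<dots> \<le> cmod (\<Sum>i\<in>I'. \<Sum>j\<in>J'. of_real (cmod (y i)) * of_real (b i j) * of_real (cmod (x j)))"
    using complex_Re_le_cmod[of "\<Sum>i\<in>I'. \<Sum>j\<in>J'. of_real (cmod (y i)) * of_real (b i j) * of_real (cmod (x j))"] by simp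
  also have "\<dots> = cmod (kernel_form I' J' (\<lambda>i j. of_real (b i j)) (\<lambda>i. of_real (cmod (y i))) (\<lambda>j. of_real (cmod (x j))))"
    by (simp add: kernel_form_def)
  also have "\<dots> \<le> C * l2norm I' (\<lambda>i. of_real (cmod (y i))) * l2norm J' (\<lambda>j. of_real (cmod (x j)))"
    by (rule form_boundedD[OF b *])
  also have "\<dots> = C * l2norm I' y * l2norm J' x" by (simp add: l2norm_def)
  finally show "cmod (kernel_form I' J' a y x) \<le> C * l2norm I' y * l2norm J' x" .
qed (rule form_bounded_nonneg[OF b])

lemma hankel_bounded_scalar:
  "hankel_bounded 1 (\<lambda>n. mat 1 1 (\<lambda>_. f n)) C \<longleftrightarrow> form_bounded_on UNIV (\<lambda>p q. f (p + q)) C"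
proof -
  have b: "bij_betw (\<lambda>p. (p, 0)) (UNIV :: nat set) (UNIV \<times> {..<1 :: nat})"
    by (auto simp: bij_betw_def inj_on_def image_iff)
  have "form_bounded_on UNIV (\<lambda>p q. hankel (\<lambda>n. entries (mat 1 1 (\<lambda>_. f n))) (p, 0) (q, 0)) C \<longleftrightarrow>
    hankel_bounded 1 (\<lambda>n. mat 1 1 (\<lambda>_. f n)) C"
    unfolding hankel_bounded_def by (rule form_bounded_reindex[OF b b])
  then show ?thesis by (simp add: hankel_def)
qed

text \<open>Membership is required of the diagonal entries \<open>|m\<^sub>n(i, j)|\<^sup>2\<close> only; the other entries of
  \<open>m\<^sub>n \<otimes> cnj m\<^sub>n\<close> are dominated by the means of two of these.\<close>

lemma BMOA2_mcarr_iff: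
  "m \<in> mcarr BMOA2 d \<longleftrightarrow> (\<forall>n. m n \<in> carrier_mat d d) \<and>
    (\<exists>C. form_bounded_on (UNIV \<times> ({..<d} \<times> {..<d})) (hankel (square_symbol m)) C)"
  (is "_ \<longleftrightarrow> _ \<and> (\<exists>C. ?B C)")
proof
  assume m: "m \<in> mcarr BMOA2 d"
  have "\<forall>i<d. \<forall>j<d. \<exists>c. form_bounded_on UNIV (\<lambda>p q. of_real ((cmod (m (p + q) $$ (i, j)))\<^sup>2)) c"
  proof (intro allI impI)
    fix i j assume "i < d" "j < d"
    then have "(\<lambda>n. mat 1 1 (\<lambda>_. complex_of_real ((cmod (m n $$ (i, j)))\<^sup>2))) \<in> mcarr BMOA 1"
      using m by (simp add: BMOA2_def matrices_over_def scalars_def)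
    then obtain c where "hankel_bounded 1 (\<lambda>n. mat 1 1 (\<lambda>_. complex_of_real ((cmod (m n $$ (i, j)))\<^sup>2))) c"
      unfolding BMOA_mcarr_iff by blast
    then show "\<exists>c. form_bounded_on UNIV (\<lambda>p q. of_real ((cmod (m (p + q) $$ (i, j)))\<^sup>2)) c"
      unfolding hankel_bounded_scalar by blast
  qed
  then obtain c where c: "\<And>i j. i < d \<Longrightarrow> j < d \<Longrightarrow>
      form_bounded_on UNIV (\<lambda>p q. of_real ((cmod (m (p + q) $$ (i, j)))\<^sup>2)) (c i j)" by metis
  let ?D = "{..<d} \<times> {..<d}"
  have blk: "form_bounded_on UNIV (\<lambda>p q. square_symbol m (p + q) x y)
      ((c (fst x) (fst y) + c (snd x) (snd y)) / 2)" if xy: "x \<in> ?D" "y \<in> ?D" for x y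
  proof -
    obtain \<alpha> \<alpha>' \<beta> \<beta>' where e: "x = (\<alpha>, \<alpha>')" "y = (\<beta>, \<beta>')" "\<alpha> < d" "\<alpha>' < d" "\<beta> < d" "\<beta>' < d" using xy by auto
    let ?s = "\<lambda>p q. of_real ((cmod (m (p + q) $$ (\<alpha>, \<beta>)))\<^sup>2) + of_real ((cmod (m (p + q) $$ (\<alpha>', \<beta>')))\<^sup>2) :: complex"
    have "form_bounded_on UNIV (\<lambda>p q. (1 / 2) * ?s p q) (cmod (1 / 2) * (c \<alpha> \<beta> + c \<alpha>' \<beta>'))"
      by (intro form_bounded_scale form_bounded_add c e)
    then have b: "form_bounded_on UNIV
        (\<lambda>p q. complex_of_real (((cmod (m (p + q) $$ (\<alpha>, \<beta>)))\<^sup>2 + (cmod (m (p + q) $$ (\<alpha>', \<beta>')))\<^sup>2) / 2))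
        ((c \<alpha> \<beta> + c \<alpha>' \<beta>') / 2)" by simp
    show ?thesis unfolding e fst_conv snd_conv
    proof (rule form_bounded_dominated[OF b])
      fix p q
      show "cmod (square_symbol m (p + q) (\<alpha>, \<alpha>') (\<beta>, \<beta>'))
          \<le> ((cmod (m (p + q) $$ (\<alpha>, \<beta>)))\<^sup>2 + (cmod (m (p + q) $$ (\<alpha>', \<beta>')))\<^sup>2) / 2"
        using sum_squares_bound[of "cmod (m (p + q) $$ (\<alpha>, \<beta>))" "cmod (m (p + q) $$ (\<alpha>', \<beta>'))"]
        by (simp add: square_symbol_def norm_mult)
    qed
  qed
  have "form_bounded_on (UNIV \<times> ?D) (\<lambda>(p, x) (q, y). square_symbol m (p + q) x y)
      (\<Sum>x\<in>?D. \<Sum>y\<in>?D. (c (fst x) (fst y) + c (snd x) (snd y)) / 2)"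
    by (rule form_bounded_blocks[where a = "\<lambda>x y p q. square_symbol m (p + q) x y"]) (auto intro: blk)
  then show "(\<forall>n. m n \<in> carrier_mat d d) \<and> (\<exists>C. ?B C)"
    using m unfolding hankel_def by (auto simp: BMOA2_def matrices_over_def)
next
  assume m: "(\<forall>n. m n \<in> carrier_mat d d) \<and> (\<exists>C. ?B C)"
  then obtain C where C: "?B C" by blast
  have "(\<lambda>n. mat 1 1 (\<lambda>_. complex_of_real ((cmod (m n $$ (i, j)))\<^sup>2))) \<in> mcarr BMOA 1" if ij: "i < d" "j < d" for i j
  proof -
    have "form_bounded_on UNIV (\<lambda>p q. hankel (square_symbol m) (p, (i, i)) (q, (j, j))) C"
      by (rule form_bounded_compress[OF C]) (use ij in \<open>auto simp: inj_on_def\<close>)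
    moreover have "hankel (square_symbol m) (p, (i, i)) (q, (j, j)) = complex_of_real ((cmod (m (p + q) $$ (i, j)))\<^sup>2)" for p q
      by (simp add: hankel_def square_symbol_def complex_norm_square[symmetric])
    ultimately have "hankel_bounded 1 (\<lambda>n. mat 1 1 (\<lambda>_. complex_of_real ((cmod (m n $$ (i, j)))\<^sup>2))) C"
      unfolding hankel_bounded_scalar by simp
    then show ?thesis unfolding BMOA_mcarr_iff by auto
  qed
  then show "m \<in> mcarr BMOA2 d" using m by (simp add: BMOA2_def matrices_over_def scalars_def)
qed

lemma BMOA2_mnorm_le_iff:
  assumes m: "m \<in> mcarr BMOA2 d" and C: "0 \<le> C"
  shows "mnorm BMOA2 d m \<le> C \<longleftrightarrow>
    form_bounded_on (UNIV \<times> ({..<d} \<times> {..<d})) (hankel (square_symbol m)) (C\<^sup>2)"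
    and "0 \<le> mnorm BMOA2 d m"
proof -
  have car: "m n \<in> carrier_mat d d" for n using m BMOA2_mcarr_iff by blast
  have flat: "hankel_bounded (d * d) (\<lambda>n. tensor_conj (m n)) K \<longleftrightarrow>
      form_bounded_on (UNIV \<times> ({..<d} \<times> {..<d})) (hankel (square_symbol m)) K" for K
    by (rule hankel_bounded_flat) (simp add: tensor_conj_entry[OF car] square_symbol_def)
  have mem: "(\<lambda>n. tensor_conj (m n)) \<in> mcarr BMOA (d * d)"
    using m unfolding BMOA_mcarr_iff flat BMOA2_mcarr_iff by (auto intro: tensor_conj_carrier)
  note b = BMOA_mnorm_le_iff[OF mem]
  have eq: "mnorm BMOA2 d m = sqrt (mnorm BMOA (d * d) (\<lambda>n. tensor_conj (m n)))" by (simp add: BMOA2_def)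
  show "0 \<le> mnorm BMOA2 d m" unfolding eq using b(2)[OF C] by simp
  have "mnorm BMOA2 d m \<le> C \<longleftrightarrow> mnorm BMOA (d * d) (\<lambda>n. tensor_conj (m n)) \<le> C\<^sup>2"
    unfolding eq by (rule sqrt_le_iff_power2[OF C])
  also have "\<dots> \<longleftrightarrow> hankel_bounded (d * d) (\<lambda>n. tensor_conj (m n)) (C\<^sup>2)" by (rule b(1)) simp
  finally show "mnorm BMOA2 d m \<le> C \<longleftrightarrow>
    form_bounded_on (UNIV \<times> ({..<d} \<times> {..<d})) (hankel (square_symbol m)) (C\<^sup>2)"
    unfolding flat .
qed

section \<open>Completely bounded multipliers\<close>

lemma amplify_multiplier_carrier: "amplify k d (multiplier m) a n \<in> carrier_mat (k * d) (k * d)"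
  by (simp add: amplify_def)

lemma amplify_multiplier_entry:
  assumes "m n \<in> carrier_mat d d" "r < k * d" "c < k * d"
  shows "amplify k d (multiplier m) a n $$ (r, c) = a n $$ (r div d, c div d) * m n $$ (r mod d, c mod d)"
  using assms by (simp add: amplify_def multiplier_def mod_less_of_mult)

text \<open>To identify the multipliers from \<open>X\<close> to \<open>Y\<close> with \<open>Z\<close> it is enough that the norm in \<open>Z\<close> bounds every
  amplification, and that it is at most \<open>C\<close> as soon as \<open>C\<close> bounds all amplifications on the unit
  balls.\<close>

theorem cb_multipliers_eqI:
  assumes upper: "\<And>m k a. m \<in> mcarr Z d \<Longrightarrow> 1 \<le> k \<Longrightarrow> a \<in> mcarr X k \<Longrightarrow>
      amplify k d (multiplier m) a \<in> mcarr Y (k * d) \<and>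
      mnorm Y (k * d) (amplify k d (multiplier m) a) \<le> mnorm Z d m * mnorm X k a"
    and lower: "\<And>m C. (\<And>n. m n \<in> carrier_mat d d) \<Longrightarrow> 0 \<le> C \<Longrightarrow>
      (\<And>k a. 1 \<le> k \<Longrightarrow> a \<in> mcarr X k \<Longrightarrow> mnorm X k a \<le> 1 \<Longrightarrow>
        amplify k d (multiplier m) a \<in> mcarr Y (k * d) \<and> mnorm Y (k * d) (amplify k d (multiplier m) a) \<le> C) \<Longrightarrow>
      m \<in> mcarr Z d \<and> mnorm Z d m \<le> C"
    and car: "\<And>m n. m \<in> mcarr Z d \<Longrightarrow> m n \<in> carrier_mat d d"
    and Z: "\<And>m. m \<in> mcarr Z d \<Longrightarrow> 0 \<le> mnorm Z d m"
    and X: "\<And>k a. a \<in> mcarr X k \<Longrightarrow> 0 \<le> mnorm X k a"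
    and Y: "\<And>k a. a \<in> mcarr Y k \<Longrightarrow> 0 \<le> mnorm Y k a"
    and x0: "x0 \<in> mcarr X 1" "mnorm X 1 x0 \<le> 1"
  shows "mcarr (cb_multipliers X Y) d = mcarr Z d \<and>
    (\<forall>m\<in>mcarr (cb_multipliers X Y) d. mnorm (cb_multipliers X Y) d m = mnorm Z d m)"
proof -
  have sub: "m \<in> mcarr Z d" if m: "m \<in> mcarr (cb_multipliers X Y) d" for m
  proof -
    have mc: "\<And>n. m n \<in> carrier_mat d d" and cb: "cb_map d X Y (multiplier m)"
      using m by (auto simp: cb_multipliers_def)
    obtain C where C: "\<And>k F. 1 \<le> k \<Longrightarrow> F \<in> mcarr X k \<Longrightarrow>
        mnorm Y (k * d) (amplify k d (multiplier m) F) \<le> C * mnorm X k F"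
      using cb unfolding cb_map_def by blast
    have "mnorm Y (k * d) (amplify k d (multiplier m) a) \<le> max 0 C"
      if "1 \<le> k" "a \<in> mcarr X k" "mnorm X k a \<le> 1" for k a
    proof -
      have "mnorm Y (k * d) (amplify k d (multiplier m) a) \<le> C * mnorm X k a" by (rule C[OF that(1,2)])
      also have "\<dots> \<le> max 0 C * mnorm X k a" using X[OF that(2)] by (intro mult_right_mono) auto
      also have "\<dots> \<le> max 0 C * 1" using that by (intro mult_left_mono) auto
      finally show ?thesis by simp
    qed
    then show ?thesis using lower[OF mc, of "max 0 C"] cb unfolding cb_map_def by auto
  qed
  have sup: "m \<in> mcarr (cb_multipliers X Y) d" if "m \<in> mcarr Z d" for m
    using upper[OF that] car[OF that] unfolding cb_multipliers_def cb_map_def by auto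
  have "cb_norm d X Y (multiplier m) = mnorm Z d m" if m: "m \<in> mcarr Z d" for m
  proof -
    let ?S = "{mnorm Y (k * d) (amplify k d (multiplier m) F) |k F. 1 \<le> k \<and> F \<in> mcarr X k \<and> mnorm X k F \<le> 1}"
    have ne: "?S \<noteq> {}" using x0 by auto
    have le: "s \<le> mnorm Z d m" if sS: "s \<in> ?S" for s
    proof -
      obtain k F where s: "s = mnorm Y (k * d) (amplify k d (multiplier m) F)" and F: "1 \<le> k" "F \<in> mcarr X k" "mnorm X k F \<le> 1"
        using sS by blast
      have "s \<le> mnorm Z d m * mnorm X k F" unfolding s using upper[OF m F(1,2)] by blast
      also have "\<dots> \<le> mnorm Z d m * 1" using Z[OF m] F by (intro mult_left_mono) auto
      finally show ?thesis by simp
    qed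
    have bdd: "bdd_above ?S" using le by (rule bdd_aboveI)
    have "0 \<le> Sup ?S"
    proof -
      have "0 \<le> mnorm Y (1 * d) (amplify 1 d (multiplier m) x0)" using upper[OF m _ x0(1)] Y by simp
      also have "\<dots> \<le> Sup ?S" by (rule cSup_upper[OF _ bdd]) (use x0 in \<open>auto intro!: exI[of _ "1::nat"] exI[of _ x0]\<close>)
      finally show ?thesis .
    qed
    moreover have "mnorm Y (k * d) (amplify k d (multiplier m) a) \<le> Sup ?S"
      if "1 \<le> k" "a \<in> mcarr X k" "mnorm X k a \<le> 1" for k a
      by (rule cSup_upper[OF _ bdd]) (use that in auto)
    ultimately have "m \<in> mcarr Z d \<and> mnorm Z d m \<le> Sup ?S"
      using car[OF m] upper[OF m] by (intro lower) blast+
    then have ge: "mnorm Z d m \<le> Sup ?S" ..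
    have "Sup ?S \<le> mnorm Z d m" by (rule cSup_least[OF ne le])
    then show ?thesis unfolding cb_norm_def using ge by (rule antisym)
  qed
  then have norm: "mnorm (cb_multipliers X Y) d m = mnorm Z d m" if "m \<in> mcarr Z d" for m
    using that by (simp add: cb_multipliers_def)
  have "mcarr (cb_multipliers X Y) d = mcarr Z d" using sub sup by blast
  then show ?thesis using norm by simp
qed

lemma flat_index:
  assumes "p < k" "\<alpha> < (d :: nat)"
  shows "p * d + \<alpha> < k * d" "(p * d + \<alpha>) div d = p" "(p * d + \<alpha>) mod d = \<alpha>"
proof -
  have "p * d + \<alpha> < Suc p * d" using assms by simp
  also have "\<dots> \<le> k * d" using assms by (intro mult_le_mono1) simp
  finally show "p * d + \<alpha> < k * d" .
qed (use assms in auto)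

text \<open>The coefficients of the function \<open>\<Sum> z\<^sup>i\<^sup>+\<^sup>j e\<^sub>i\<^sub>j\<close>.\<close>

definition hankel_unit :: "nat \<Rightarrow> nat \<Rightarrow> complex mat" where
  "hankel_unit N n = mat N N (\<lambda>(i, j). if i + j = n then 1 else 0)"

lemma hankel_unit_entry: "i < N \<Longrightarrow> j < N \<Longrightarrow> hankel_unit N n $$ (i, j) = (if i + j = n then 1 else 0)"
  by (simp add: hankel_unit_def)

text \<open>Pairing \<open>\<Sum> z\<^sup>i\<^sup>+\<^sup>j e\<^sub>i\<^sub>j\<close> with a bounded matrix function yields a Hankel matrix of Fourier
  coefficients of the latter.\<close>

lemma hankel_unit_H1: "hankel_unit N \<in> mcarr H1 N" "mnorm H1 N (hankel_unit N) \<le> 1"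
proof -
  define F where "F z = mat N N (\<lambda>(i, j). z powi (int i + int j))" for z :: complex
  have powi: "(\<lambda>z. z powi k) \<in> Hp 1" if "k \<ge> 0" for k
    using that by (simp add: Hp_def Lp_1_iff fourier_powi)
  have F: "F \<in> matrices_over (Hp 1) N" using powi by (simp add: matrices_over_def F_def)
  have c: "coeffs N F = hankel_unit N"
    by (auto simp: fun_eq_iff coeffs_def F_def hankel_unit_def fourier_powi intro!: eq_matI)
  show "hankel_unit N \<in> mcarr H1 N" unfolding H1_mcarr c[symmetric] using F by blast
  have "L1_mnorm N F \<le> 1"
  proof (rule L1_mnorm_le[OF Hp_Lp[OF F]])
    fix k G assume G: "G \<in> matrices_over Linf k" "AE z in circle. form_bounded_on {..<k} (entries (G z)) 1"
    have "form_bounded_on ({..<k} \<times> {..<N})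
        (\<lambda>(p, i) (q, j). LINT w|circle. G w $$ (p, q) * w powi (int i + int j)) 1"
      by (rule form_bounded_integral_powi) (use G matrices_over_entry[OF G(1)] in auto)
    then show "form_bounded_on ({..<k} \<times> {..<N}) (pairing (\<lambda>z. entries (G z)) F) 1"
      by (rule iffD1[OF form_bounded_cong, rotated]) (auto simp: pairing_def F_def)
  qed simp
  then show "mnorm H1 N (hankel_unit N) \<le> 1" using H1_mnorm[OF F] c by simp
qed

lemma H1_mnorm_nonneg: "a \<in> mcarr H1 k \<Longrightarrow> 0 \<le> mnorm H1 k a"
  using H1_mnorm L1_mnorm_nonneg[OF Hp_Lp] by (auto simp: H1_mcarr)

text \<open>The coefficients \<open>a\<^sub>n \<otimes> m\<^sub>n\<close> of the image of \<open>a\<close> under the multiplier with symbol \<open>m\<close>.\<close>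

definition tensor_symbol :: "(nat \<Rightarrow> complex mat) \<Rightarrow> (nat \<Rightarrow> complex mat) \<Rightarrow> nat \<Rightarrow> nat \<times> nat \<Rightarrow> nat \<times> nat \<Rightarrow> complex" where
  "tensor_symbol a m n = (\<lambda>(i, \<alpha>) (j, \<beta>). a n $$ (i, j) * m n $$ (\<alpha>, \<beta>))"

lemma hankel_bounded_amplify:
  assumes "\<And>n. m n \<in> carrier_mat d d"
  shows "hankel_bounded (k * d) (amplify k d (multiplier m) a) C \<longleftrightarrow>
    form_bounded_on (UNIV \<times> ({..<k} \<times> {..<d})) (hankel (tensor_symbol a m)) C"
  by (rule hankel_bounded_flat) (simp add: amplify_multiplier_entry assms tensor_symbol_def)

lemma BMOA_memI:
  assumes "\<And>n. a n \<in> carrier_mat d d" "hankel_bounded d a C"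
  shows "a \<in> mcarr BMOA d \<and> mnorm BMOA d a \<le> C"
proof -
  have "a \<in> mcarr BMOA d" using assms BMOA_mcarr_iff by blast
  moreover have "0 \<le> C" using assms(2) by (auto simp: hankel_bounded_def dest: form_bounded_nonneg)
  ultimately show ?thesis using BMOA_mnorm_le_iff(1) assms(2) by blast
qed

section \<open>Multipliers from H1 to BMOA\<close>

lemma H1_BMOA_upper:
  assumes m: "m \<in> mcarr BMOA d" and a: "a \<in> mcarr H1 k"
  shows "amplify k d (multiplier m) a \<in> mcarr BMOA (k * d) \<and>
    mnorm BMOA (k * d) (amplify k d (multiplier m) a) \<le> mnorm BMOA d m * mnorm H1 k a"
proof (rule BMOA_memI[OF amplify_multiplier_carrier])
  define V where "V = mnorm BMOA d m"
  have car: "\<And>n. m n \<in> carrier_mat d d" using m BMOA_mcarr_iff by blast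
  have V: "0 \<le> V" using BMOA_mnorm_le_iff(2)[OF m order_refl] by (simp add: V_def)
  have hb: "hankel_bounded d m V" using BMOA_mnorm_le_iff(1)[OF m V] by (simp add: V_def)
  obtain F where F: "F \<in> matrices_over (Hp 1) k" "a = coeffs k F" using a by (auto simp: H1_mcarr)
  have L: "mnorm H1 k a = L1_mnorm k F" using H1_mnorm[OF F(1)] F(2) by simp
  have "form_bounded_on (UNIV \<times> ({..<k} \<times> {..<d})) (hankel (tensor_symbol a m)) (V * L1_mnorm k F)"
  proof (rule form_bounded_UNIV_nat)
    show "0 \<le> V * L1_mnorm k F" using V L1_mnorm_nonneg[OF Hp_Lp[OF F(1)]] by simp
    fix N :: nat
    let ?P = "{..<N} \<times> {..<d}"
    define G where "G w = (\<lambda>(p, \<alpha>) (q, \<beta>). m (p + q) $$ (\<alpha>, \<beta>) * w powi (- int (p + q)))" for w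
    have bdd: "form_bounded_on ?P (G w) V" if w: "cmod w = 1" for w
    proof -
      have "form_bounded_on ?P (hankel (\<lambda>n. entries (m n))) V"
        by (rule form_bounded_subset[OF hb[unfolded hankel_bounded_def]]) auto
      then have "form_bounded_on ?P (\<lambda>i j. w powi (- int (fst i)) * hankel (\<lambda>n. entries (m n)) i j * w powi (- int (fst j))) V"
        by (rule form_bounded_diag) (use w in auto)
      then show ?thesis
        by (rule iffD1[OF form_bounded_cong, rotated])
           (auto simp: G_def hankel_def powi_add_circle[OF w, symmetric] mult_ac simp flip: power_int_add)
    qed
    have "form_bounded_on (?P \<times> {..<k}) (pairing G F) (V * L1_mnorm k F)"
    proof (rule pairing_bound[OF Hp_Lp[OF F(1)]])
      show "(\<lambda>w. G w x y) \<in> Linf" for x y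
        unfolding G_def by (cases x; cases y) (simp add: Linf_scale)
      show "AE w in circle. form_bounded_on ?P (G w) V" by (rule AE_I2) (simp add: bdd)
    qed (use V in auto)
    then show "form_bounded_on ({..<N} \<times> ({..<k} \<times> {..<d})) (hankel (tensor_symbol a m)) (V * L1_mnorm k F)"
    proof (rule form_bounded_transfer[where f = "\<lambda>(p, i, \<alpha>). ((p, \<alpha>), i)"])
      fix x y assume "x \<in> {..<N} \<times> ({..<k} \<times> {..<d})" "y \<in> {..<N} \<times> ({..<k} \<times> {..<d})"
      then obtain p i \<alpha> q j \<beta> where e: "x = (p, i, \<alpha>)" "y = (q, j, \<beta>)" "i < k" "j < k" by auto
      have "pairing G F ((p, \<alpha>), i) ((q, \<beta>), j)
        = (LINT w|circle. m (p + q) $$ (\<alpha>, \<beta>) * (F w $$ (i, j) * w powi (- int (p + q))))"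
        by (simp add: pairing_def G_def mult_ac)
      also have "\<dots> = m (p + q) $$ (\<alpha>, \<beta>) * a (p + q) $$ (i, j)"
        using e by (simp add: F(2) coeffs_entry fourier_def)
      finally show "pairing G F ((\<lambda>(p, i, \<alpha>). ((p, \<alpha>), i)) x) ((\<lambda>(p, i, \<alpha>). ((p, \<alpha>), i)) y) = hankel (tensor_symbol a m) x y"
        by (simp add: e hankel_def tensor_symbol_def mult.commute)
    qed (auto simp: inj_on_def)
  qed
  then show "hankel_bounded (k * d) (amplify k d (multiplier m) a) (mnorm BMOA d m * mnorm H1 k a)"
    unfolding hankel_bounded_amplify[OF car] L V_def .
qed

text \<open>In the Hankel matrix of the image of the test element, the entry from \<open>(q, q)\<close> to \<open>(p, p)\<close> is
  \<open>m\<^sub>p\<^sub>+\<^sub>q\<close>.\<close>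

lemma H1_BMOA_lower:
  assumes m: "\<And>n. m n \<in> carrier_mat d d" and C: "0 \<le> C"
    and hyp: "\<And>k a. 1 \<le> k \<Longrightarrow> a \<in> mcarr H1 k \<Longrightarrow> mnorm H1 k a \<le> 1 \<Longrightarrow>
      amplify k d (multiplier m) a \<in> mcarr BMOA (k * d) \<and> mnorm BMOA (k * d) (amplify k d (multiplier m) a) \<le> C"
  shows "m \<in> mcarr BMOA d \<and> mnorm BMOA d m \<le> C"
proof (rule BMOA_memI[OF m])
  show "hankel_bounded d m C"
    unfolding hankel_bounded_def
  proof (rule form_bounded_UNIV_nat[OF C])
    fix N :: nat
    \<comment> \<open>Amplifications start at size \<open>1\<close>, so the section \<open>N\<close> is read off from size \<open>N + 1\<close>.\<close>
    let ?k = "Suc N" and ?a = "hankel_unit (Suc N)"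
    have "hankel_bounded (?k * d) (amplify ?k d (multiplier m) ?a) C"
      using hyp[OF _ hankel_unit_H1, of ?k] BMOA_mnorm_le_iff(1)[OF _ C] by (auto simp del: mult_Suc)
    then have "form_bounded_on (UNIV \<times> ({..<?k} \<times> {..<d})) (hankel (tensor_symbol ?a m)) C"
      unfolding hankel_bounded_amplify[OF m] .
    then show "form_bounded_on ({..<N} \<times> {..<d}) (hankel (\<lambda>n. entries (m n))) C"
      by (rule form_bounded_transfer[where f = "\<lambda>x. (fst x, x)"])
         (auto simp: inj_on_def hankel_def tensor_symbol_def hankel_unit_entry)
  qed
qed

section \<open>Multipliers from H1 to H2\<close>

lemma summable_mult_cnj:
  fixes f g :: "nat \<Rightarrow> complex"
  assumes "summable (\<lambda>n. (cmod (f n))\<^sup>2)" "summable (\<lambda>n. (cmod (g n))\<^sup>2)"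
  shows "summable (\<lambda>n. cmod (f n * cnj (g n)))"
proof (rule summable_comparison_test'[of _ 0])
  show "summable (\<lambda>n. (cmod (f n))\<^sup>2 + (cmod (g n))\<^sup>2)" by (intro summable_add assms)
  fix n
  have "2 * (cmod (f n) * cmod (g n)) \<le> (cmod (f n))\<^sup>2 + (cmod (g n))\<^sup>2"
    using sum_squares_bound[of "cmod (f n)" "cmod (g n)"] by (simp add: mult.assoc)
  moreover have "0 \<le> cmod (f n) * cmod (g n)" by simp
  ultimately show "norm (cmod (f n * cnj (g n))) \<le> (cmod (f n))\<^sup>2 + (cmod (g n))\<^sup>2"
    unfolding norm_mult complex_mod_cnj real_norm_def by linarith
qed

text \<open>It is enough to bound the matrices \<open>\<Sum> T\<^sub>n \<otimes> cnj T\<^sub>n\<close> with Fejer weights: on the diagonal they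
  give the square summability of the entries, after which the weights can be removed by dominated
  convergence.\<close>

lemma H2_memI:
  assumes car: "\<And>n. T n \<in> carrier_mat R R" and C: "0 \<le> C"
    and bdd: "\<And>M. form_bounded_on ({..<R} \<times> {..<R})
      (\<lambda>(r, r') (c, c'). \<Sum>n\<le>M. of_real (fejer_weight M (int n)) * (T n $$ (r, c) * cnj (T n $$ (r', c')))) (C\<^sup>2)"
  shows "T \<in> mcarr H2 R \<and> mnorm H2 R T \<le> C"
proof -
  have s: "summable (\<lambda>n. (cmod (T n $$ (r, c)))\<^sup>2)" if rc: "r < R" "c < R" for r c
  proof (rule summableI_nonneg_bounded)
    fix K
    have "(\<lambda>M. \<Sum>n<K. fejer_weight M (int n) * (cmod (T n $$ (r, c)))\<^sup>2) \<longlonglongrightarrow> (\<Sum>n<K. 1 * (cmod (T n $$ (r, c)))\<^sup>2)"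
      by (intro tendsto_intros fejer_weight_tendsto)
    moreover have "\<forall>\<^sub>F M in sequentially. (\<Sum>n<K. fejer_weight M (int n) * (cmod (T n $$ (r, c)))\<^sup>2) \<le> C\<^sup>2"
      using eventually_ge_at_top[of K]
    proof eventually_elim
      case (elim M)
      have "cmod (\<Sum>n\<le>M. of_real (fejer_weight M (int n)) * (T n $$ (r, c) * cnj (T n $$ (r, c)))) \<le> C\<^sup>2"
        using form_bounded_entry[OF bdd[of M], of "(r, r)" "(c, c)"] rc by simp
      also have "(\<Sum>n\<le>M. of_real (fejer_weight M (int n)) * (T n $$ (r, c) * cnj (T n $$ (r, c))))
          = complex_of_real (\<Sum>n\<le>M. fejer_weight M (int n) * (cmod (T n $$ (r, c)))\<^sup>2)"
        by (simp add: complex_norm_square[symmetric])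
      finally have "(\<Sum>n\<le>M. fejer_weight M (int n) * (cmod (T n $$ (r, c)))\<^sup>2) \<le> C\<^sup>2"
        unfolding norm_of_real by linarith
      moreover have "(\<Sum>n<K. fejer_weight M (int n) * (cmod (T n $$ (r, c)))\<^sup>2)
          \<le> (\<Sum>n\<le>M. fejer_weight M (int n) * (cmod (T n $$ (r, c)))\<^sup>2)"
        by (rule sum_mono2) (use elim fejer_weight_bounds in auto)
      ultimately show ?case by linarith
    qed
    ultimately show "(\<Sum>n<K. (cmod (T n $$ (r, c)))\<^sup>2) \<le> C\<^sup>2"
      using tendsto_upperbound[of _ _ sequentially "C\<^sup>2"] by fastforce
  qed simp
  have mem: "T \<in> mcarr H2 R" unfolding H2_mcarr_iff using car s by blast
  have "form_bounded_on ({..<R} \<times> {..<R}) (gram_kernel T) (C\<^sup>2)"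
  proof (rule form_bounded_tendsto[where F = sequentially, OF always_eventually])
    show "\<forall>M. form_bounded_on ({..<R} \<times> {..<R})
      (\<lambda>(r, r') (c, c'). \<Sum>n\<le>M. of_real (fejer_weight M (int n)) * (T n $$ (r, c) * cnj (T n $$ (r', c')))) (C\<^sup>2)"
      using bdd by blast
    fix x y assume "x \<in> {..<R} \<times> {..<R}" "y \<in> {..<R} \<times> {..<R}"
    then obtain r r' c c' where e: "x = (r, r')" "y = (c, c')" "r < R" "r' < R" "c < R" "c' < R" by auto
    define t where "t n = T n $$ (r, c) * cnj (T n $$ (r', c'))" for n
    have st: "summable (\<lambda>n. cmod (t n))" unfolding t_def by (intro summable_mult_cnj s e)
    have "(\<lambda>M. \<Sum>n. of_real (fejer_weight M (int n)) * t n) \<longlonglongrightarrow> (\<Sum>n. t n)"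
    proof (rule tannerys_theorem[THEN conjunct2, THEN conjunct2])
      show "(\<lambda>M. of_real (fejer_weight M (int n)) * t n) \<longlonglongrightarrow> t n" for n
        using tendsto_mult[OF tendsto_of_real[OF fejer_weight_tendsto[of "int n"]] tendsto_const[of "t n"]] by simp
      have "norm (of_real (fejer_weight M (int n)) * t n) \<le> cmod (t n)" for M n
        using fejer_weight_bounds[of M "int n"] by (simp add: norm_mult mult_left_le_one_le)
      then show "\<forall>\<^sub>F (n, M) in at_top \<times>\<^sub>F sequentially. norm (of_real (fejer_weight M (int n)) * t n) \<le> cmod (t n)"
        by (intro always_eventually) auto
    qed (use st in auto)
    moreover have "(\<Sum>n. of_real (fejer_weight M (int n)) * t n) = (\<Sum>n\<le>M. of_real (fejer_weight M (int n)) * t n)" for M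
      by (rule suminf_finite) (auto simp: fejer_weight_zero)
    ultimately show "(\<lambda>M. (\<lambda>(r, r') (c, c'). \<Sum>n\<le>M. of_real (fejer_weight M (int n)) * (T n $$ (r, c) * cnj (T n $$ (r', c')))) x y)
        \<longlonglongrightarrow> gram_kernel T x y"
      by (simp add: e gram_kernel_def t_def)
  qed auto
  then show ?thesis using mem H2_mnorm_le_iff(1)[OF mem C] by blast
qed

text \<open>The pairing with \<open>F\<close> is used twice. First, for fixed \<open>w\<close>, the Fejer mean at \<open>v/w\<close> is paired with the
  conjugate of \<open>F(v)\<close>; this is a trigonometric polynomial \<open>G(w)\<close>, bounded by \<open>V\<close> times the norm of \<open>F\<close>.
  Then \<open>G\<close> is paired with \<open>F\<close>. Coefficients of negative index drop out since \<open>F\<close> is analytic.\<close>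

lemma fejer_mean_pairing:
  fixes \<phi> :: "int \<Rightarrow> 'a \<Rightarrow> 'a \<Rightarrow> complex"
  assumes D: "finite D" and V: "0 \<le> V" and F: "F \<in> matrices_over (Hp 1) k"
    and bdd: "\<And>z. cmod z = 1 \<Longrightarrow> form_bounded_on D (fejer_mean \<phi> M z) V"
  shows "form_bounded_on ((D \<times> {..<k}) \<times> {..<k})
    (\<lambda>((x, i'), i) ((y, j'), j). \<Sum>n\<le>M. of_real (fejer_weight M (int n)) *
      (\<phi> (int n) x y * (coeffs k F n $$ (i, j) * cnj (coeffs k F n $$ (i', j'))))) (V * L1_mnorm k F * L1_mnorm k F)"
proof -
  define L where "L = L1_mnorm k F"
  note FL = Hp_Lp[OF F]
  have L: "0 \<le> L" unfolding L_def by (rule L1_mnorm_nonneg[OF FL])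
  let ?S = "{- int M..int M}"
  define c where "c n x y = of_real (fejer_weight M n) * \<phi> n x y" for n x y
  \<comment> \<open>These coefficients are indexed by all integers, but vanish for negative \<open>n\<close>.\<close>
  define f where "f n i j = fourier (\<lambda>z. F z $$ (i, j)) n" for n i j
  have Fi: "integrable circle (\<lambda>z. F z $$ (i, j))" if "i < k" "j < k" for i j
    using matrices_over_entry[OF F that] by (rule Hp_1_integrable)
  define G where "G w = (\<lambda>(x, i') (y, j'). \<Sum>n\<in>?S. (c n x y * cnj (f n i' j')) * w powi (- n))" for w
  have G: "form_bounded_on (D \<times> {..<k}) (G w) (V * L)" if w: "cmod w = 1" for w
  proof -
    \<comment> \<open>The conjugate turns the pairing with \<open>F\<close> into one with the conjugate of \<open>F\<close>.\<close>
    define H where "H v x y = cnj (\<Sum>n\<in>?S. (c n x y * w powi (- n)) * v powi n)" for v x y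
    have H: "H v x y = cnj (fejer_mean \<phi> M (v * cnj w) x y)" for v x y
      unfolding H_def fejer_mean_def c_def
      using cnj_powi_circle[OF w] by (simp add: power_int_mult_distrib mult_ac)
    have "form_bounded_on (D \<times> {..<k}) (pairing H F) (V * L)"
      unfolding L_def
    proof (rule pairing_bound[OF FL D])
      show "(\<lambda>v. H v x y) \<in> Linf" for x y
        unfolding H_def by (intro Linf_cnj Linf_sum Linf_scale Linf_powi) simp
      show "AE v in circle. form_bounded_on D (H v) V"
      proof (rule AE_I2)
        fix v assume "v \<in> space circle"
        then have "cmod (v * cnj w) = 1" using w by (simp add: norm_mult)
        then show "form_bounded_on D (H v) V" unfolding H form_bounded_cnj by (rule bdd)
      qed
    qed (rule V)
    then have "form_bounded_on (D \<times> {..<k}) (\<lambda>s t. cnj (pairing H F s t)) (V * L)"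
      unfolding form_bounded_cnj .
    then show ?thesis
    proof (rule iffD1[OF form_bounded_cong, rotated])
      fix s t assume "s \<in> D \<times> {..<k}" "t \<in> D \<times> {..<k}"
      then obtain x i' y j' where e: "s = (x, i')" "t = (y, j')" "i' < k" "j' < k" by auto
      have "pairing H F s t = (LINT v|circle. F v $$ (i', j') * cnj (\<Sum>n\<in>?S. (c n x y * w powi (- n)) * v powi n))"
        by (simp add: e pairing_def H_def mult.commute)
      also have "\<dots> = (\<Sum>n\<in>?S. cnj (c n x y * w powi (- n)) * f n i' j')"
        unfolding f_def by (rule integral_mult_cnj_trig[OF Fi[OF e(3,4)]]) simp
      finally show "cnj (pairing H F s t) = G w s t"
        by (simp add: e G_def mult_ac)
    qed
  qed
  have "form_bounded_on ((D \<times> {..<k}) \<times> {..<k}) (pairing G F) (V * L * L1_mnorm k F)"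
  proof (rule pairing_bound[OF FL])
    show "(\<lambda>w. G w s t) \<in> Linf" for s t
      unfolding G_def by (cases s; cases t) (auto intro!: Linf_sum Linf_scale)
    show "AE w in circle. form_bounded_on (D \<times> {..<k}) (G w) (V * L)"
      by (rule AE_I2) (simp add: G)
  qed (use D V L in auto)
  then show ?thesis
    unfolding L_def
  proof (rule iffD1[OF form_bounded_cong, rotated])
    fix s t assume "s \<in> (D \<times> {..<k}) \<times> {..<k}" "t \<in> (D \<times> {..<k}) \<times> {..<k}"
    then obtain x i' i y j' j where e: "s = ((x, i'), i)" "t = ((y, j'), j)" "i < k" "j < k" "i' < k" "j' < k" by auto
    have "pairing G F s t = (LINT w|circle. (\<Sum>n\<in>?S. (c n x y * cnj (f n i' j')) * (F w $$ (i, j) * w powi (- n))))"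
      unfolding e pairing_def G_def prod.case sum_distrib_right
      by (intro Bochner_Integration.integral_cong sum.cong refl) (simp add: mult_ac)
    also have "\<dots> = (\<Sum>n\<in>?S. (c n x y * cnj (f n i' j')) * f n i j)"
      using integrable_powi_mult[OF Fi[OF e(3,4)]]
      by (subst Bochner_Integration.integral_sum) (auto simp: f_def fourier_def)
    also have "\<dots> = (\<Sum>n\<in>int ` {..M}. (c n x y * cnj (f n i' j')) * f n i j)"
    proof (rule sum.mono_neutral_right)
      show "\<forall>n\<in>?S - int ` {..M}. (c n x y * cnj (f n i' j')) * f n i j = 0"
      proof
        fix n assume n: "n \<in> ?S - int ` {..M}"
        have "n < 0"
        proof (rule ccontr)
          assume "\<not> n < 0"
          then have "n = int (nat n)" "nat n \<le> M" using n by auto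
          then show False using n by blast
        qed
        then have "f n i j = 0" unfolding f_def by (rule Hp_neg[OF matrices_over_entry[OF F e(3,4)]])
        then show "(c n x y * cnj (f n i' j')) * f n i j = 0" by simp
      qed
    qed auto
    also have "\<dots> = (\<Sum>n\<le>M. (c (int n) x y * cnj (f (int n) i' j')) * f (int n) i j)"
      by (subst sum.reindex) (auto simp: inj_on_def)
    finally show "pairing G F s t = (\<lambda>((x, i'), i) ((y, j'), j). \<Sum>n\<le>M. of_real (fejer_weight M (int n)) *
      (\<phi> (int n) x y * (coeffs k F n $$ (i, j) * cnj (coeffs k F n $$ (i', j'))))) s t"
      using e by (simp add: coeffs_entry c_def f_def mult_ac)
  qed
qed

lemma H1_H2_upper:
  assumes m: "m \<in> mcarr BMOA2 d" and a: "a \<in> mcarr H1 k"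
  shows "amplify k d (multiplier m) a \<in> mcarr H2 (k * d) \<and>
    mnorm H2 (k * d) (amplify k d (multiplier m) a) \<le> mnorm BMOA2 d m * mnorm H1 k a"
proof (rule H2_memI[OF amplify_multiplier_carrier])
  define V where "V = mnorm BMOA2 d m"
  have car: "\<And>n. m n \<in> carrier_mat d d" using m BMOA2_mcarr_iff by blast
  have V: "0 \<le> V" using BMOA2_mnorm_le_iff(2)[OF m order_refl] by (simp add: V_def)
  let ?D = "{..<d} \<times> {..<d}"
  have hb: "form_bounded_on (UNIV \<times> ?D) (hankel (square_symbol m)) (V\<^sup>2)"
    using BMOA2_mnorm_le_iff(1)[OF m V] by (simp add: V_def)
  obtain F where F: "F \<in> matrices_over (Hp 1) k" "a = coeffs k F" using a by (auto simp: H1_mcarr)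
  have L: "mnorm H1 k a = L1_mnorm k F" using H1_mnorm[OF F(1)] F(2) by simp
  show "0 \<le> mnorm BMOA2 d m * mnorm H1 k a" using V H1_mnorm_nonneg[OF a] by (simp add: V_def)
  have finD: "finite ?D" by simp
  obtain \<phi> where \<phi>: "\<And>n. \<phi> (int n) = square_symbol m n"
    "\<And>N. form_bounded_on (UNIV \<times> ?D) (hankel (\<lambda>n. \<phi> (int n - int N))) (V\<^sup>2)"
    using hankel_extension[OF finD hb] by blast
  fix M :: nat
  let ?R = "{..<k * d}"
  have "form_bounded_on ((?D \<times> {..<k}) \<times> {..<k})
    (\<lambda>((x, i'), i) ((y, j'), j). \<Sum>n\<le>M. of_real (fejer_weight M (int n)) *
      (\<phi> (int n) x y * (coeffs k F n $$ (i, j) * cnj (coeffs k F n $$ (i', j'))))) (V\<^sup>2 * L1_mnorm k F * L1_mnorm k F)"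
    by (rule fejer_mean_pairing[OF finD _ F(1) fejer_mean_bounded[OF finD _ \<phi>(2)]]) simp_all
  moreover have "V\<^sup>2 * L1_mnorm k F * L1_mnorm k F = (mnorm BMOA2 d m * mnorm H1 k a)\<^sup>2"
    unfolding L V_def by (simp add: power2_eq_square)
  ultimately show "form_bounded_on (?R \<times> ?R)
      (\<lambda>(r, r') (c, c'). \<Sum>n\<le>M. of_real (fejer_weight M (int n)) *
        (amplify k d (multiplier m) a n $$ (r, c) * cnj (amplify k d (multiplier m) a n $$ (r', c'))))
      ((mnorm BMOA2 d m * mnorm H1 k a)\<^sup>2)"
  proof (simp only:, elim form_bounded_transfer)
    let ?f = "\<lambda>(r, r'). (((r mod d, r' mod d), r' div d), r div d)"
    show "inj_on ?f (?R \<times> ?R)" by (auto simp: inj_on_def) (metis div_mult_mod_eq)+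
    show "?f ` (?R \<times> ?R) \<subseteq> (?D \<times> {..<k}) \<times> {..<k}"
      by (auto intro: div_less_of_mult mod_less_of_mult)
  qed (auto simp: amplify_multiplier_entry[OF car] \<phi>(1) square_symbol_def F(2) mult_ac intro!: sum.cong)
qed

lemma BMOA2_memI:
  assumes m: "\<And>n. m n \<in> carrier_mat d d" and C: "0 \<le> C"
    and sec: "\<And>N. form_bounded_on ({..<N} \<times> ({..<d} \<times> {..<d})) (hankel (square_symbol m)) (C\<^sup>2)"
  shows "m \<in> mcarr BMOA2 d \<and> mnorm BMOA2 d m \<le> C"
proof -
  have b: "form_bounded_on (UNIV \<times> ({..<d} \<times> {..<d})) (hankel (square_symbol m)) (C\<^sup>2)"
    by (rule form_bounded_UNIV_nat[OF _ sec]) simp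
  then have "m \<in> mcarr BMOA2 d" using m BMOA2_mcarr_iff by blast
  then show ?thesis using BMOA2_mnorm_le_iff(1)[OF _ C] b by blast
qed

text \<open>In \<open>\<Sum> T\<^sub>n \<otimes> cnj T\<^sub>n\<close>, for the image \<open>T\<close> of the test element, restrict both tensor factors to the
  same block row \<open>p\<close> and the same block column \<open>q\<close>: only the term \<open>n = p + q\<close> remains, and it is
  \<open>m\<^sub>n \<otimes> cnj m\<^sub>n\<close>.\<close>

lemma H1_H2_lower:
  assumes m: "\<And>n. m n \<in> carrier_mat d d" and C: "0 \<le> C"
    and hyp: "\<And>k a. 1 \<le> k \<Longrightarrow> a \<in> mcarr H1 k \<Longrightarrow> mnorm H1 k a \<le> 1 \<Longrightarrow>
      amplify k d (multiplier m) a \<in> mcarr H2 (k * d) \<and> mnorm H2 (k * d) (amplify k d (multiplier m) a) \<le> C"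
  shows "m \<in> mcarr BMOA2 d \<and> mnorm BMOA2 d m \<le> C"
proof (rule BMOA2_memI[OF m C])
  fix N :: nat
  let ?k = "Suc N" and ?a = "hankel_unit (Suc N)" and ?D = "{..<d} \<times> {..<d}"
  let ?T = "amplify ?k d (multiplier m) ?a" and ?R = "{..<Suc N * d}"
  have "form_bounded_on (?R \<times> ?R) (gram_kernel ?T) (C\<^sup>2)"
    using hyp[OF _ hankel_unit_H1, of ?k] H2_mnorm_le_iff(1)[OF _ C] by (auto simp del: mult_Suc)
  then show "form_bounded_on ({..<N} \<times> ?D) (hankel (square_symbol m)) (C\<^sup>2)"
  proof (rule form_bounded_transfer)
    let ?f = "\<lambda>(p, \<alpha>, \<alpha>'). (p * d + \<alpha>, p * d + \<alpha>')"
    show "inj_on ?f ({..<N} \<times> ?D)"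
    proof (rule inj_onI, clarsimp)
      fix p \<alpha> \<alpha>' q \<beta> \<beta>'
      assume *: "\<alpha> < d" "\<beta> < d" "p * d + \<alpha> = q * d + \<beta>" "p * d + \<alpha>' = q * d + \<beta>'"
      have "(p * d + \<alpha>) div d = p" "(q * d + \<beta>) div d = q" using *(1,2) by simp_all
      then have "p = q" using *(3) by simp
      with * show "p = q \<and> \<alpha> = \<beta> \<and> \<alpha>' = \<beta>'" by simp
    qed
    show "?f ` ({..<N} \<times> ?D) \<subseteq> ?R \<times> ?R" using flat_index(1)[of _ "Suc N" _ d] by auto
    fix x y assume "x \<in> {..<N} \<times> ?D" "y \<in> {..<N} \<times> ?D"
    then obtain p \<alpha> \<alpha>' q \<beta> \<beta>' where e: "x = (p, \<alpha>, \<alpha>')" "y = (q, \<beta>, \<beta>')"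
      "p < Suc N" "q < Suc N" "\<alpha> < d" "\<alpha>' < d" "\<beta> < d" "\<beta>' < d" by fastforce
    have "?T n $$ (p * d + \<alpha>, q * d + \<beta>) * cnj (?T n $$ (p * d + \<alpha>', q * d + \<beta>'))
        = (if n = p + q then square_symbol m n (\<alpha>, \<alpha>') (\<beta>, \<beta>') else 0)" for n
      using e by (simp add: amplify_multiplier_entry[OF m] flat_index hankel_unit_entry square_symbol_def del: mult_Suc)
    moreover have "(\<lambda>n. if n = p + q then square_symbol m n (\<alpha>, \<alpha>') (\<beta>, \<beta>') else 0) sums square_symbol m (p + q) (\<alpha>, \<alpha>') (\<beta>, \<beta>')"
      by (rule sums_single)
    ultimately show "gram_kernel ?T (?f x) (?f y) = hankel (square_symbol m) x y"
      by (simp add: e gram_kernel_def hankel_def sums_iff)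
  qed
qed

section \<open>Multipliers from H2 to BMOA\<close>

text \<open>Integrating the Hankel kernel, modulated by \<open>w\<close>, against \<open>w\<^sup>p\<^sup>+\<^sup>q\<close> selects the entries with
  \<open>p + q = p' + q'\<close>. The result is \<open>\<Sum> J\<^sub>n \<otimes> J\<^sub>n \<otimes> f\<^sub>n\<close>, where \<open>J\<^sub>n\<close> are the coefficients of the test
  element, and it is bounded by the norm of \<open>\<Sum> J\<^sub>n \<otimes> f\<^sub>n\<close>.\<close>

lemma hankel_twist_bounded:
  assumes b: "form_bounded_on ({..<N} \<times> E) (hankel f) B" and E: "finite E"
  shows "form_bounded_on (({..<N} \<times> {..<N}) \<times> E)
    (\<lambda>((p, p'), x) ((q, q'), y). if p + q = p' + q' then f (p + q) x y else 0) B"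
proof -
  let ?P = "{..<N} \<times> E"
  define G where "G w = (\<lambda>(p', x) (q', y). f (p' + q') x y * w powi (- int (p' + q')))" for w
  have bdd: "form_bounded_on ?P (G w) B" if w: "cmod w = 1" for w
  proof -
    have "form_bounded_on ?P (\<lambda>i j. w powi (- int (fst i)) * hankel f i j * w powi (- int (fst j))) B"
      by (rule form_bounded_diag[OF b]) (use w in auto)
    then show ?thesis
      by (rule iffD1[OF form_bounded_cong, rotated])
         (auto simp: G_def hankel_def powi_add_circle[OF w, symmetric] mult_ac)
  qed
  have "form_bounded_on (?P \<times> {..<N})
      (\<lambda>(s, p) (t, q). LINT w|circle. G w s t * w powi (int p + int q)) B"
  proof (rule form_bounded_integral_powi)
    show "(\<lambda>w. G w s t) \<in> Linf" for s t
      unfolding G_def by (cases s; cases t) (simp add: Linf_scale)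
    show "AE w in circle. form_bounded_on ?P (G w) B" by (rule AE_I2) (simp add: bdd)
    show "0 \<le> B" by (rule form_bounded_nonneg[OF b])
  qed (use E in auto)
  then show ?thesis
  proof (rule form_bounded_transfer[where f = "\<lambda>((p, p'), x). ((p', x), p)"])
    fix s t assume "s \<in> ({..<N} \<times> {..<N}) \<times> E" "t \<in> ({..<N} \<times> {..<N}) \<times> E"
    obtain p p' x q q' y where e: "s = ((p, p'), x)" "t = ((q, q'), y)" by (metis surj_pair)
    have "(LINT w|circle. G w (p', x) (q', y) * w powi (int p + int q))
      = (LINT w|circle. f (p' + q') x y * w powi (int (p + q) - int (p' + q')))"
    proof (intro Bochner_Integration.integral_cong refl)
      fix w assume "w \<in> space circle"
      then have "cmod w = 1" by simp
      from powi_add_circle[OF this, of "- int (p' + q')" "int p + int q"]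
      show "G w (p', x) (q', y) * w powi (int p + int q) = f (p' + q') x y * w powi (int (p + q) - int (p' + q'))"
        by (simp add: G_def algebra_simps)
    qed
    also have "\<dots> = (if p + q = p' + q' then f (p + q) x y else 0)"
      using integral_powi_circle[of "int (p + q) - int (p' + q')"] by auto
    finally show "(\<lambda>(s, p) (t, q). LINT w|circle. G w s t * w powi (int p + int q))
       ((\<lambda>((p, p'), x). ((p', x), p)) s) ((\<lambda>((p, p'), x). ((p', x), p)) t)
      = (\<lambda>((p, p'), x) ((q, q'), y). if p + q = p' + q' then f (p + q) x y else 0) s t"
      by (simp add: e)
  qed (auto simp: inj_on_def)
qed

text \<open>Truncating the series perturbs each of finitely many entries by a null sequence.\<close>

lemma square_kernel_truncation:
  assumes a: "a \<in> mcarr H2 k" and B: "form_bounded_on ({..<k} \<times> {..<k}) (gram_kernel a) B"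
  obtains C where "C \<longlonglongrightarrow> B"
    "\<And>M. form_bounded_on ({..<k} \<times> {..<k}) (square_kernel {..<M} (\<lambda>n. entries (a n))) (C M)"
proof -
  let ?K = "{..<k} \<times> {..<k}"
  define \<delta> where "\<delta> M = (\<Sum>x\<in>?K. \<Sum>y\<in>?K. cmod (square_kernel {..<M} (\<lambda>n. entries (a n)) x y - gram_kernel a x y))" for M
  have lim: "(\<lambda>M. square_kernel {..<M} (\<lambda>n. entries (a n)) x y) \<longlonglongrightarrow> gram_kernel a x y" if xy: "x \<in> ?K" "y \<in> ?K" for x y
  proof -
    obtain i i' j j' where e: "x = (i, i')" "y = (j, j')" "i < k" "i' < k" "j < k" "j' < k" using xy by auto
    have s: "summable (\<lambda>n. (cmod (a n $$ (i, j)))\<^sup>2)" if "i < k" "j < k" for i j using a that unfolding H2_mcarr_iff by blast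
    have "summable (\<lambda>n. a n $$ (i, j) * cnj (a n $$ (i', j')))"
      by (intro summable_norm_cancel[OF summable_mult_cnj] s e)
    from summable_LIMSEQ[OF this] show ?thesis by (simp add: e square_kernel_def gram_kernel_def)
  qed
  have "\<delta> \<longlonglongrightarrow> (\<Sum>x\<in>?K. \<Sum>y\<in>?K. cmod (gram_kernel a x y - gram_kernel a x y))"
    unfolding \<delta>_def by (intro tendsto_intros lim)
  then have \<delta>: "\<delta> \<longlonglongrightarrow> 0" by simp
  show ?thesis
  proof (rule that)
    have "(\<lambda>M. B + real (card ?K) * real (card ?K) * \<delta> M) \<longlonglongrightarrow> B + real (card ?K) * real (card ?K) * 0"
      by (intro tendsto_intros \<delta>)
    then show "(\<lambda>M. B + real (card ?K) * real (card ?K) * \<delta> M) \<longlonglongrightarrow> B" by simp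
    fix M :: nat
    have "form_bounded_on ?K (\<lambda>x y. square_kernel {..<M} (\<lambda>n. entries (a n)) x y - gram_kernel a x y)
        (real (card ?K) * real (card ?K) * \<delta> M)"
    proof (rule form_bounded_entriesI)
      show "0 \<le> \<delta> M" unfolding \<delta>_def by (intro sum_nonneg) auto
      fix x y assume xy: "x \<in> ?K" "y \<in> ?K"
      show "cmod (square_kernel {..<M} (\<lambda>n. entries (a n)) x y - gram_kernel a x y) \<le> \<delta> M"
        unfolding \<delta>_def using xy by (intro member_le_sum2) auto
    qed auto
    from form_bounded_add[OF B this]
    show "form_bounded_on ?K (square_kernel {..<M} (\<lambda>n. entries (a n))) (B + real (card ?K) * real (card ?K) * \<delta> M)"
      by simp
  qed
qed

text \<open>A Hankel section of the image of \<open>a\<close> is \<open>\<Sum> a\<^sub>n \<otimes> b\<^sub>n\<close> with \<open>b\<^sub>n = J\<^sub>n \<otimes> m\<^sub>n\<close>, where \<open>J\<^sub>n\<close> are the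
  coefficients of the test element.\<close>

lemma H2_BMOA_upper:
  assumes m: "m \<in> mcarr BMOA2 d" and a: "a \<in> mcarr H2 k"
  shows "amplify k d (multiplier m) a \<in> mcarr BMOA (k * d) \<and>
    mnorm BMOA (k * d) (amplify k d (multiplier m) a) \<le> mnorm BMOA2 d m * mnorm H2 k a"
proof (rule BMOA_memI[OF amplify_multiplier_carrier])
  define V where "V = mnorm BMOA2 d m"
  define L where "L = mnorm H2 k a"
  have car: "\<And>n. m n \<in> carrier_mat d d" using m BMOA2_mcarr_iff by blast
  have V: "0 \<le> V" using BMOA2_mnorm_le_iff(2)[OF m order_refl] by (simp add: V_def)
  have L: "0 \<le> L" using H2_mnorm_le_iff(2)[OF a order_refl] by (simp add: L_def)
  let ?D = "{..<d} \<times> {..<d}"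
  have hb: "form_bounded_on (UNIV \<times> ?D) (hankel (square_symbol m)) (V\<^sup>2)"
    using BMOA2_mnorm_le_iff(1)[OF m V] by (simp add: V_def)
  have ga: "form_bounded_on ({..<k} \<times> {..<k}) (gram_kernel a) (L\<^sup>2)"
    using H2_mnorm_le_iff(1)[OF a L] by (simp add: L_def)
  obtain C where C: "C \<longlonglongrightarrow> L\<^sup>2"
    "\<And>M. form_bounded_on ({..<k} \<times> {..<k}) (square_kernel {..<M} (\<lambda>n. entries (a n))) (C M)"
    using square_kernel_truncation[OF a ga] by metis
  have "form_bounded_on (UNIV \<times> ({..<k} \<times> {..<d})) (hankel (tensor_symbol a m)) (V * L)"
  proof (rule form_bounded_UNIV_nat)
    show "0 \<le> V * L" using V L by simp
    fix N :: nat
    define P where "P = {..<N} \<times> {..<d}"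
    have finP: "finite P" by (simp add: P_def)
    define b where "b n = (\<lambda>(p, \<alpha>) (q, \<beta>). if p + q = n then m n $$ (\<alpha>, \<beta>) else 0)" for n :: nat
    have tw: "form_bounded_on (({..<N} \<times> {..<N}) \<times> ?D)
      (\<lambda>((p, p'), x) ((q, q'), y). if p + q = p' + q' then square_symbol m (p + q) x y else 0) (V\<^sup>2)"
      by (rule hankel_twist_bounded) (auto intro: form_bounded_subset[OF hb])
    have sqb: "form_bounded_on (P \<times> P) (square_kernel {..<M} b) (V\<^sup>2)" if M: "M \<ge> 2 * N" for M
      using tw
    proof (rule form_bounded_transfer[where f = "\<lambda>((p, \<alpha>), (p', \<alpha>')). ((p, p'), (\<alpha>, \<alpha>'))"])
      fix s t assume "s \<in> P \<times> P" "t \<in> P \<times> P"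
      then obtain p \<alpha> p' \<alpha>' q \<beta> q' \<beta>' where e: "s = ((p, \<alpha>), (p', \<alpha>'))" "t = ((q, \<beta>), (q', \<beta>'))" "p < N" "q < N"
        unfolding P_def by auto
      have "square_kernel {..<M} b s t = (\<Sum>n<M. if n = p + q then (if p + q = p' + q' then square_symbol m (p + q) (\<alpha>, \<alpha>') (\<beta>, \<beta>') else 0) else 0)"
        unfolding e square_kernel_def prod.case b_def square_symbol_def by (intro sum.cong refl) auto
      then show "(\<lambda>((p, p'), x) ((q, q'), y). if p + q = p' + q' then square_symbol m (p + q) x y else 0)
        ((\<lambda>((p, \<alpha>), (p', \<alpha>')). ((p, p'), (\<alpha>, \<alpha>'))) s) ((\<lambda>((p, \<alpha>), (p', \<alpha>')). ((p, p'), (\<alpha>, \<alpha>'))) t)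
        = square_kernel {..<M} b s t" using e M by simp
    qed (auto simp: inj_on_def P_def)
    let ?I = "{..<N} \<times> ({..<k} \<times> {..<d})"
    have sec: "form_bounded_on ?I (hankel (tensor_symbol a m)) (sqrt (C M * V\<^sup>2))" if M: "M \<ge> 2 * N" for M
    proof -
      have "form_bounded_on ({..<k} \<times> P) (tensor_kernel {..<M} (\<lambda>n. entries (a n)) b) (sqrt (C M * V\<^sup>2))"
        by (rule tensor_kernel_cauchy_schwarz[OF _ _ _ finP finP C(2) sqb[OF M]]) auto
      then show ?thesis
      proof (rule form_bounded_transfer[where f = "\<lambda>(p, i, \<alpha>). (i, (p, \<alpha>))"])
        fix s t assume "s \<in> ?I" "t \<in> ?I"
        then obtain p i \<alpha> q j \<beta> where e: "s = (p, i, \<alpha>)" "t = (q, j, \<beta>)" "p < N" "q < N" by auto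
        have "tensor_kernel {..<M} (\<lambda>n. entries (a n)) b (i, (p, \<alpha>)) (j, (q, \<beta>))
          = (\<Sum>n<M. if n = p + q then a (p + q) $$ (i, j) * m (p + q) $$ (\<alpha>, \<beta>) else 0)"
          unfolding tensor_kernel_def prod.case b_def by (intro sum.cong refl) auto
        then show "tensor_kernel {..<M} (\<lambda>n. entries (a n)) b ((\<lambda>(p, i, \<alpha>). (i, (p, \<alpha>))) s) ((\<lambda>(p, i, \<alpha>). (i, (p, \<alpha>))) t)
          = hankel (tensor_symbol a m) s t"
          using e M by (simp add: hankel_def tensor_symbol_def)
      qed (auto simp: inj_on_def P_def)
    qed
    show "form_bounded_on ?I (hankel (tensor_symbol a m)) (V * L)"
    proof (rule form_bounded_tendsto[where F = sequentially])
      show "\<forall>\<^sub>F M in sequentially. form_bounded_on ?I (hankel (tensor_symbol a m)) (sqrt (C M * V\<^sup>2))"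
        using eventually_ge_at_top[of "2 * N"] by eventually_elim (rule sec)
      have "(\<lambda>M. sqrt (C M * V\<^sup>2)) \<longlonglongrightarrow> sqrt (L\<^sup>2 * V\<^sup>2)" by (intro tendsto_intros C)
      then show "(\<lambda>M. sqrt (C M * V\<^sup>2)) \<longlonglongrightarrow> V * L" using V L by (simp add: real_sqrt_mult mult.commute)
    qed auto
  qed
  then show "hankel_bounded (k * d) (amplify k d (multiplier m) a) (mnorm BMOA2 d m * mnorm H2 k a)"
    unfolding hankel_bounded_amplify[OF car] L_def V_def .
qed

text \<open>Let \<open>B\<close> bound a Hankel section of \<open>m \<otimes> cnj m\<close>. The element with coefficients \<open>J\<^sub>n \<otimes> cnj m\<^sub>n\<close> has norm at
  most \<open>sqrt B\<close> over \<open>H\<^sup>2\<close>, and a compression of the Hankel matrix of its image is the section itself.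
  So \<open>C * sqrt B\<close> is another bound, and for the least bound this says \<open>B \<le> C\<^sup>2\<close>.\<close>

lemma H2_BMOA_lower:
  assumes m: "\<And>n. m n \<in> carrier_mat d d" and C: "0 \<le> C"
    and hyp: "\<And>k a. 1 \<le> k \<Longrightarrow> a \<in> mcarr H2 k \<Longrightarrow> mnorm H2 k a \<le> 1 \<Longrightarrow>
      amplify k d (multiplier m) a \<in> mcarr BMOA (k * d) \<and> mnorm BMOA (k * d) (amplify k d (multiplier m) a) \<le> C"
    and d: "1 \<le> d"
  shows "m \<in> mcarr BMOA2 d \<and> mnorm BMOA2 d m \<le> C"
proof (rule BMOA2_memI[OF m C])
  fix N :: nat
  let ?D = "{..<d} \<times> {..<d}"
  let ?b = "\<lambda>B. form_bounded_on ({..<Suc N} \<times> ?D) (hankel (square_symbol m)) B"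
  have improve: "?b (C * sqrt B)" if B: "?b B" "B > 0" for B
  proof -
    \<comment> \<open>Normalised so that the norm of \<open>a\<close> over \<open>H\<^sup>2\<close> is at most \<open>1\<close>.\<close>
    define t where "t = 1 / sqrt B"
    have t: "t > 0" "t\<^sup>2 * B = 1" using B(2) by (auto simp: t_def power_divide)
    define a where "a n = mat (Suc N * d) (Suc N * d) (\<lambda>(r, c).
      of_real t * (hankel_unit (Suc N) n $$ (r div d, c div d) * cnj (m n $$ (r mod d, c mod d))))" for n
    have ae: "a n $$ (r, c) = (if r div d + c div d = n then of_real t * cnj (m n $$ (r mod d, c mod d)) else 0)"
      if "r < Suc N * d" "c < Suc N * d" for n r c
      using that div_less_of_mult[OF that(1)] div_less_of_mult[OF that(2)] by (simp add: a_def hankel_unit_entry)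
    have a2: "a \<in> mcarr H2 (Suc N * d)"
      unfolding H2_mcarr_iff
    proof (intro conjI allI impI)
      fix r c assume rc: "r < Suc N * d" "c < Suc N * d"
      show "summable (\<lambda>n. (cmod (a n $$ (r, c)))\<^sup>2)"
        by (rule summable_finite[of "{r div d + c div d}"]) (auto simp: ae[OF rc])
    qed (simp add: a_def)
    let ?R = "{..<Suc N * d}"
    have tw: "form_bounded_on (({..<Suc N} \<times> {..<Suc N}) \<times> ?D)
      (\<lambda>((p, p'), x) ((q, q'), y). if p + q = p' + q' then square_symbol m (p + q) x y else 0) B"
      by (rule hankel_twist_bounded[OF B(1)]) simp
    define \<kappa> where "\<kappa> = (\<lambda>((p, p'), x) ((q, q'), y). if p + q = p' + q' then square_symbol m (p + q) x y else 0 :: complex)"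
    have "form_bounded_on (({..<Suc N} \<times> {..<Suc N}) \<times> ?D)
      (\<lambda>s t'. of_real (t\<^sup>2) * cnj (\<kappa> s t')) (cmod (of_real (t\<^sup>2)) * B)"
      by (intro form_bounded_scale iffD2[OF form_bounded_cnj] tw[folded \<kappa>_def])
    then have k1: "form_bounded_on (({..<Suc N} \<times> {..<Suc N}) \<times> ?D)
      (\<lambda>s t'. of_real (t\<^sup>2) * cnj (\<kappa> s t')) 1" using t by (simp add: norm_power)
    have "form_bounded_on (?R \<times> ?R) (gram_kernel a) 1"
      using k1
    proof (rule form_bounded_transfer)
      let ?f = "\<lambda>(r, r'). ((r div d, r' div d), (r mod d, r' mod d))"
      show "inj_on ?f (?R \<times> ?R)" by (auto simp: inj_on_def) (metis div_mult_mod_eq)+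
      show "?f ` (?R \<times> ?R) \<subseteq> ({..<Suc N} \<times> {..<Suc N}) \<times> ?D"
        by (auto intro: div_less_of_mult mod_less_of_mult simp del: mult_Suc)
      fix s u assume "s \<in> ?R \<times> ?R" "u \<in> ?R \<times> ?R"
      then obtain r r' c c' where e: "s = (r, r')" "u = (c, c')" "r < Suc N * d" "r' < Suc N * d" "c < Suc N * d" "c' < Suc N * d"
        by (auto simp del: mult_Suc)
      let ?v = "if r div d + c div d = r' div d + c' div d then
        of_real (t\<^sup>2) * cnj (square_symbol m (r div d + c div d) (r mod d, r' mod d) (c mod d, c' mod d)) else 0"
      have "a n $$ (r, c) * cnj (a n $$ (r', c')) = (if n = r div d + c div d then ?v else 0)" for n
        unfolding ae[OF e(3,5)] ae[OF e(4,6)] by (auto simp: square_symbol_def power2_eq_square mult_ac)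
      moreover have "(\<lambda>n. if n = r div d + c div d then ?v else 0) sums ?v" by (rule sums_single)
      ultimately have "gram_kernel a s u = ?v" by (simp add: e gram_kernel_def sums_iff)
      then show "of_real (t\<^sup>2) * cnj (\<kappa> (?f s) (?f u)) = gram_kernel a s u"
        by (simp add: e \<kappa>_def)
    qed
    then have "mnorm H2 (Suc N * d) a \<le> 1" using H2_mnorm_le_iff(1)[OF a2, of 1] by simp
    moreover have "1 \<le> Suc N * d" using d by simp
    ultimately have "hankel_bounded (Suc N * d * d) (amplify (Suc N * d) d (multiplier m) a) C"
      using hyp[OF _ a2] BMOA_mnorm_le_iff(1)[OF _ C] by blast
    then have "form_bounded_on (UNIV \<times> (?R \<times> {..<d})) (hankel (tensor_symbol a m)) C"
      unfolding hankel_bounded_amplify[OF m] .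
    then have "form_bounded_on ({..<Suc N} \<times> ?D) (\<lambda>x y. of_real t * hankel (square_symbol m) x y) C"
    proof (rule form_bounded_transfer)
      let ?f = "\<lambda>(p, \<alpha>, \<alpha>'). (p, (p * d + \<alpha>', \<alpha>))"
      show "inj_on ?f ({..<Suc N} \<times> ?D)" by (auto simp: inj_on_def)
      show "?f ` ({..<Suc N} \<times> ?D) \<subseteq> UNIV \<times> (?R \<times> {..<d})"
        using flat_index(1)[of _ "Suc N" _ d] by (auto simp del: mult_Suc)
      fix x y assume "x \<in> {..<Suc N} \<times> ?D" "y \<in> {..<Suc N} \<times> ?D"
      then obtain p \<alpha> \<alpha>' q \<beta> \<beta>' where e: "x = (p, \<alpha>, \<alpha>')" "y = (q, \<beta>, \<beta>')"
        "p < Suc N" "q < Suc N" "\<alpha> < d" "\<alpha>' < d" "\<beta> < d" "\<beta>' < d" by auto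
      have "a (p + q) $$ (p * d + \<alpha>', q * d + \<beta>') = of_real t * cnj (m (p + q) $$ (\<alpha>', \<beta>'))"
        using e by (subst ae) (auto simp: flat_index simp del: mult_Suc)
      then show "hankel (tensor_symbol a m) (?f x) (?f y) = of_real t * hankel (square_symbol m) x y"
        by (simp add: e hankel_def tensor_symbol_def square_symbol_def mult_ac)
    qed
    from form_bounded_scale[OF this, of "of_real (sqrt B)"]
    have "form_bounded_on ({..<Suc N} \<times> ?D)
        (\<lambda>x y. of_real (sqrt B) * (of_real t * hankel (square_symbol m) x y)) (cmod (of_real (sqrt B)) * C)" .
    moreover have "of_real (sqrt B) * (of_real t * z) = z" for z :: complex
      using B(2) by (simp add: t_def flip: mult.assoc of_real_mult)
    ultimately show ?thesis using B(2) by (simp add: mult.commute)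
  qed
  define h where "h = Inf {B. ?b B}"
  obtain B0 where B0: "?b B0" using form_bounded_exists[of "{..<Suc N} \<times> ?D" "{..<Suc N} \<times> ?D"] by blast
  have bddb: "bdd_below {B. ?b B}" by (rule bdd_belowI[of _ 0]) (auto dest: form_bounded_nonneg)
  have bh: "?b h"
  proof (rule form_bounded_eps)
    fix e :: real assume "e > 0"
    then have "Inf {B. ?b B} < h + e" by (simp add: h_def)
    moreover have "{B. ?b B} \<noteq> {}" using B0 by blast
    ultimately obtain B where B: "?b B" "B < h + e" using cInf_lessD[of "{B. ?b B}" "h + e"] by blast
    show "?b (h + e)" by (rule form_bounded_mono[OF B(1)]) (use B(2) in simp)
  qed
  have "h \<le> C\<^sup>2"
  proof (cases "h > 0")
    case True
    have "h \<le> C * sqrt h" unfolding h_def by (rule cInf_lower[OF _ bddb]) (use improve[OF bh True] in \<open>simp add: h_def\<close>)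
    then have "sqrt h * sqrt h \<le> C * sqrt h" using True by simp
    then have "sqrt h \<le> C" using True by (simp only: mult_le_cancel_right) auto
    then show ?thesis using sqrt_le_iff_power2[OF C] by blast
  next
    case False
    then show ?thesis by (meson not_less order_trans zero_le_power2)
  qed
  then have "?b (C\<^sup>2)" using form_bounded_mono[OF bh] by blast
  then show "form_bounded_on ({..<N} \<times> ?D) (hankel (square_symbol m)) (C\<^sup>2)"
    by (rule form_bounded_subset) auto
qed

lemma zero_H2: "(\<lambda>_. 0\<^sub>m 1 1) \<in> mcarr H2 1" "mnorm H2 1 (\<lambda>_. 0\<^sub>m 1 1) \<le> 1"
proof -
  show mem: "(\<lambda>_. 0\<^sub>m 1 1) \<in> mcarr H2 1" unfolding H2_mcarr_iff by simp
  have "form_bounded_on ({..<1} \<times> {..<1}) (\<lambda>x y. 0) (1\<^sup>2)" by simp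
  then have "form_bounded_on ({..<1} \<times> {..<1}) (gram_kernel (\<lambda>_. 0\<^sub>m 1 1)) (1\<^sup>2)"
    by (rule iffD1[OF form_bounded_cong, rotated]) (auto simp: gram_kernel_def)
  then show "mnorm H2 1 (\<lambda>_. 0\<^sub>m 1 1) \<le> 1" using H2_mnorm_le_iff(1)[OF mem, of 1] by simp
qed

section \<open>The three spaces of multipliers\<close>

lemma mnorm_nonneg:
  "a \<in> mcarr BMOA d \<Longrightarrow> 0 \<le> mnorm BMOA d a"
  "a \<in> mcarr H2 d \<Longrightarrow> 0 \<le> mnorm H2 d a"
  "a \<in> mcarr BMOA2 d \<Longrightarrow> 0 \<le> mnorm BMOA2 d a"
  using BMOA_mnorm_le_iff(2)[OF _ order_refl] H2_mnorm_le_iff(2)[OF _ order_refl] BMOA2_mnorm_le_iff(2)[OF _ order_refl]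
  by blast+

theorem cb_multipliers_H1_BMOA: "complete_isometric_eq (cb_multipliers H1 BMOA) BMOA"
  unfolding complete_isometric_eq_def
proof (intro allI impI, rule cb_multipliers_eqI)
  fix d m n assume "m \<in> mcarr BMOA d"
  then show "m n \<in> carrier_mat d d" using BMOA_mcarr_iff by blast
qed (use H1_BMOA_upper H1_BMOA_lower mnorm_nonneg H1_mnorm_nonneg hankel_unit_H1[of 1] in blast)+

theorem cb_multipliers_H1_H2: "complete_isometric_eq (cb_multipliers H1 H2) BMOA2"
  unfolding complete_isometric_eq_def
proof (intro allI impI, rule cb_multipliers_eqI)
  fix d m n assume "m \<in> mcarr BMOA2 d"
  then show "m n \<in> carrier_mat d d" using BMOA2_mcarr_iff by blast
qed (use H1_H2_upper H1_H2_lower mnorm_nonneg H1_mnorm_nonneg hankel_unit_H1[of 1] in blast)+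

theorem cb_multipliers_H2_BMOA: "complete_isometric_eq (cb_multipliers H2 BMOA) BMOA2"
  unfolding complete_isometric_eq_def
proof (intro allI impI, rule cb_multipliers_eqI)
  fix d m n assume "m \<in> mcarr BMOA2 d"
  then show "m n \<in> carrier_mat d d" using BMOA2_mcarr_iff by blast
qed (use H2_BMOA_upper H2_BMOA_lower mnorm_nonneg zero_H2 in blast)+

theorem proposition6p2:
  shows "complete_isometric_eq (cb_multipliers H1 BMOA) BMOA \<and>
    complete_isometric_eq (cb_multipliers H1 H2) (cb_multipliers H2 BMOA) \<and>
    complete_isometric_eq (cb_multipliers H2 BMOA) BMOA2"
  using cb_multipliers_H1_BMOA cb_multipliers_H1_H2 cb_multipliers_H2_BMOA unfolding complete_isometric_eq_def by simp

end
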